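(* Let $\mathscr{V}_0,\mathscr{V}_1$ be two real Hilbert spaces such that $\mathscr{V}_1\subseteq\mathscr{V}_0$ is dense with compact embedding, and let $s\in(0,1)$. Then $$\|\cdot\|_{\mathrm{E}^s(\mathscr{V}_0,\mathscr{V}_1)}=\sqrt{d_s}\,\|\cdot\|_{\mathrm{H}^s(\mathscr{V}_0,\mathscr{V}_1)}=\sqrt{d_s}\,C_s\,\|\cdot\|_{\mathrm{K}^s(\mathscr{V}_0,\mathscr{V}_1)},$$ where $C_s:=\sqrt{\frac{2\sin(\pi s)}{\pi}}$ and $d_s=2^{1-2s}\frac{\Gamma(1-s)}{\Gamma(s)}$. (The equalities hold for every $u\in\mathscr{V}_0$, each norm being $+\infty$ when $u$ is not in the corresponding interpolation space; in particular the three interpolation spaces coincide.)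
   Context: Denote by $\langle\cdot,\cdot\rangle_i$ and $\|\cdot\|_i$ the scalar product and norm of $\mathscr{V}_i$, $i=0,1$. There is an orthonormal basis $(\varphi_k)_{k}$ of $\mathscr{V}_0$ and positive reals $\lambda_k$ ($\lambda_k\to\infty$) with $\langle\varphi_k,w\rangle_1=\lambda_k^2\langle\varphi_k,w\rangle_0$ for all $w\in\mathscr{V}_1$ and all $k$. Hilbert interpolation norm: $\|u\|_{\mathrm{H}^s(\mathscr{V}_0,\mathscr{V}_1)}^2:=\sum_{k}\lambda_k^{2s}\langle u,\varphi_k\rangle_0^2$, with space $[\mathscr{V}_0,\mathscr{V}_1]_{\mathrm{H}^s}$ of all $u\in\mathscr{V}_0$ for which this is finite. K-norm: $\mathrm{K}(t;u):=\inf_{v\in\mathscr{V}_1}\sqrt{\|u-v\|_0^2+t^2\|v\|_1^2}$ for $t>0$, and $\|u\|_{\mathrm{K}^s(\mathscr{V}_0,\mathscr{V}_1)}^2:=\int_0^\infty t^{-2s-1}\mathrm{K}(t;u)^2\,dt$, with space $[\mathscr{V}_0,\mathscr{V}_1]_{\mathrm{K}^s}$ of all $u\in\mathscr{V}_0$ for which this is finite. Extension norm: let $\alpha:=1-2s$. $L_2(\mathbb{R}^+,\mathscr{V}_i;y^\alpha)$ is the space of measurable $v:\mathbb{R}^+\to\mathscr{V}_i$ with $\int_{\mathbb{R}^+}y^\alpha\|v(y)\|_i^2dy<\infty$; $H^1(\mathbb{R}^+,\mathscr{V}_0;y^\alpha)$ is the space of $v\in L_2(\mathbb{R}^+,\mathscr{V}_0;y^\alpha)$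 with (weak) derivative $v'\in L_2(\mathbb{R}^+,\mathscr{V}_0;y^\alpha)$; $\mathbb{V}:=\mathbb{V}(\mathscr{V}_0,\mathscr{V}_1;y^\alpha):=H^1(\mathbb{R}^+,\mathscr{V}_0;y^\alpha)\cap L_2(\mathbb{R}^+,\mathscr{V}_1;y^\alpha)$ with norm $\|v\|_{\mathbb{V}}^2:=\int_{\mathbb{R}^+}y^\alpha(\|v(y)\|_1^2+\|v'(y)\|_0^2)\,dy$. The trace is $\mathrm{tr}\,v:=v(0)$ (value at $y=0$ of the representative of $v$ continuous on $[0,\infty)$ into $\mathscr{V}_0$). Then $[\mathscr{V}_0,\mathscr{V}_1]_{\mathrm{E}^s}:=\mathrm{tr}(\mathbb{V})$ and $\|u\|_{\mathrm{E}^s(\mathscr{V}_0,\mathscr{V}_1)}:=\inf\{\|\mathscr{U}\|_{\mathbb{V}}:\mathscr{U}\in\mathbb{V},\ \mathrm{tr}\,\mathscr{U}=u\}$. *)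

theory Defs
  imports "HOL-Analysis.Analysis"
begin

text \<open>
  The two real Hilbert spaces are types \<open>'a\<close> (for $V_0$) and \<open>'b\<close> (for $V_1$) of class
  \<^class>\<open>real_inner\<close> and \<^class>\<open>banach\<close>; the inclusion of $V_1$ in $V_0$ is an injective
  bounded linear map \<open>j :: 'b \<Rightarrow> 'a\<close>.  Thus the scalar product of $V_1$ is that of \<open>'b\<close>, and
  for \<open>v w :: 'b\<close> the scalar product of $V_0$ is \<open>j v \<bullet> j w\<close>.  All norms below are
  extended-valued.
\<close>

definition dense_compact_embedding :: "('b::real_inner \<Rightarrow> 'a::real_inner) \<Rightarrow> bool" where
  "dense_compact_embedding j \<longleftrightarrow>
     bounded_linear j \<and> inj j \<and> closure (range j) = UNIV \<and> compact (closure (j ` cball 0 1))"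

text \<open>
  The index set is an arbitrary set \<open>I\<close> of naturals, so that finite-dimensional spaces are
  included; divergence of \<open>lam\<close> to infinity is along the cofinite filter on \<open>I\<close>, hence is the
  usual one for infinite \<open>I\<close> and void for finite \<open>I\<close>.
\<close>

definition eigenbasis ::
    "('b::real_inner \<Rightarrow> 'a::real_inner) \<Rightarrow> nat set \<Rightarrow> (nat \<Rightarrow> 'b) \<Rightarrow> (nat \<Rightarrow> real) \<Rightarrow> bool" where
  "eigenbasis j I \<phi> lam \<longleftrightarrow>
     (\<forall>k\<in>I. \<forall>l\<in>I. j (\<phi> k) \<bullet> j (\<phi> l) = (if k = l then 1 else 0)) \<and>
     closure (span ((\<lambda>k. j (\<phi> k)) ` I)) = UNIV \<and>
     (\<forall>k\<in>I. 0 < lam k) \<and>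
     filterlim lam at_top (inf cofinite (principal I)) \<and>
     (\<forall>k\<in>I. \<forall>w. \<phi> k \<bullet> w = (lam k)\<^sup>2 * (j (\<phi> k) \<bullet> j w))"

definition esqrt :: "ennreal \<Rightarrow> ennreal" where
  "esqrt x = (if x = \<infinity> then \<infinity> else ennreal (sqrt (enn2real x)))"

definition H_norm ::
    "('b::real_inner \<Rightarrow> 'a::real_inner) \<Rightarrow> nat set \<Rightarrow> (nat \<Rightarrow> 'b) \<Rightarrow> (nat \<Rightarrow> real) \<Rightarrow> real \<Rightarrow> 'a \<Rightarrow> ennreal"
  where
  "H_norm j I \<phi> lam s u =
     esqrt (\<Sum>\<^sub>\<infinity>k\<in>I. ennreal (lam k powr (2 * s) * (u \<bullet> j (\<phi> k))\<^sup>2))"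

definition H_space ::
    "('b::real_inner \<Rightarrow> 'a::real_inner) \<Rightarrow> nat set \<Rightarrow> (nat \<Rightarrow> 'b) \<Rightarrow> (nat \<Rightarrow> real) \<Rightarrow> real \<Rightarrow> 'a set"
  where
  "H_space j I \<phi> lam s = {u. H_norm j I \<phi> lam s u < \<infinity>}"

definition K_functional :: "('b::real_inner \<Rightarrow> 'a::real_inner) \<Rightarrow> real \<Rightarrow> 'a \<Rightarrow> real" where
  "K_functional j t u = (INF v. sqrt ((norm (u - j v))\<^sup>2 + t\<^sup>2 * (norm v)\<^sup>2))"

definition K_norm :: "('b::real_inner \<Rightarrow> 'a::real_inner) \<Rightarrow> real \<Rightarrow> 'a \<Rightarrow> ennreal" where
  "K_norm j s u =
     esqrt (\<integral>\<^sup>+t. ennreal (t powr (- 2 * s - 1) * (K_functional j t u)\<^sup>2) \<partial>lebesgue_on {0<..})"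

definition K_space :: "('b::real_inner \<Rightarrow> 'a::real_inner) \<Rightarrow> real \<Rightarrow> 'a set" where
  "K_space j s = {u. K_norm j s u < \<infinity>}"

definition weighted_L2 :: "real \<Rightarrow> (real \<Rightarrow> 'c::real_normed_vector) set" where
  "weighted_L2 \<alpha> = {v \<in> borel_measurable (lebesgue_on {0<..}).
     (\<integral>\<^sup>+y. ennreal (y powr \<alpha> * (norm (v y))\<^sup>2) \<partial>lebesgue_on {0<..}) < \<infinity>}"

text \<open>
  Weak derivative on the open half-line: $\int \eta' w = - \int \eta g$ for all $C^1$ functions
  $\eta$ with compact support in $(0,\infty)$.  The identity of vector-valued integrals is read
  off by pairing with every \<open>x\<close>, because the library's Bochner integral would force the type to
  be second countable.  It is used only for \<open>w\<close> and \<open>g\<close> in \<^const>\<open>weighted_L2\<close>, where the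
  scalar integrands are integrable.
\<close>

definition has_weak_derivative ::
    "(real \<Rightarrow> 'a::real_inner) \<Rightarrow> (real \<Rightarrow> 'a) \<Rightarrow> bool" where
  "has_weak_derivative w g \<longleftrightarrow>
     (\<forall>\<eta> \<eta>' K. (\<forall>y. (\<eta> has_real_derivative \<eta>' y) (at y)) \<and> continuous_on UNIV \<eta>' \<and>
        compact K \<and> K \<subseteq> {0<..} \<and> (\<forall>y. y \<notin> K \<longrightarrow> \<eta> y = 0) \<longrightarrow>
      (\<forall>x. (\<integral>y. \<eta>' y * (w y \<bullet> x) \<partial>lebesgue_on {0<..}) =
           - (\<integral>y. \<eta> y * (g y \<bullet> x) \<partial>lebesgue_on {0<..})))"

text \<open>
  \<open>ext_fun j s v g\<close>: the function \<open>v\<close> belongs to the extension space for \<open>\<alpha> = 1 - 2 * s\<close>, and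
  \<open>g\<close> represents its weak derivative $v'$ (which is determined up to null sets).
\<close>

definition ext_fun ::
    "('b::real_inner \<Rightarrow> 'a::real_inner) \<Rightarrow> real \<Rightarrow> (real \<Rightarrow> 'b) \<Rightarrow> (real \<Rightarrow> 'a) \<Rightarrow> bool" where
  "ext_fun j s v g \<longleftrightarrow>
     v \<in> weighted_L2 (1 - 2 * s) \<and> (\<lambda>y. j (v y)) \<in> weighted_L2 (1 - 2 * s) \<and>
     g \<in> weighted_L2 (1 - 2 * s) \<and> has_weak_derivative (\<lambda>y. j (v y)) g"

definition ext_norm :: "real \<Rightarrow> (real \<Rightarrow> 'b::real_inner) \<Rightarrow> (real \<Rightarrow> 'a::real_inner) \<Rightarrow> ennreal" where
  "ext_norm s v g = esqrt (\<integral>\<^sup>+y. ennreal (y powr (1 - 2 * s) * ((norm (v y))\<^sup>2 + (norm (g y))\<^sup>2))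
     \<partial>lebesgue_on {0<..})"

definition has_trace :: "('b::real_inner \<Rightarrow> 'a::real_inner) \<Rightarrow> (real \<Rightarrow> 'b) \<Rightarrow> 'a \<Rightarrow> bool" where
  "has_trace j v u \<longleftrightarrow>
     (\<exists>c. continuous_on {0..} c \<and> (AE y in lebesgue_on {0<..}. c y = j (v y)) \<and> c 0 = u)"

definition E_space :: "('b::real_inner \<Rightarrow> 'a::real_inner) \<Rightarrow> real \<Rightarrow> 'a set" where
  "E_space j s = {u. \<exists>v g. ext_fun j s v g \<and> has_trace j v u}"

text \<open>The infimum of the empty set is \<open>\<infinity>\<close>.\<close>

definition E_norm :: "('b::real_inner \<Rightarrow> 'a::real_inner) \<Rightarrow> real \<Rightarrow> 'a \<Rightarrow> ennreal" where
  "E_norm j s u = Inf {ext_norm s v g |v g. ext_fun j s v g \<and> has_trace j v u}"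

definition C_const :: "real \<Rightarrow> real" where
  "C_const s = sqrt (2 * sin (pi * s) / pi)"

definition d_const :: "real \<Rightarrow> real" where
  "d_const s = 2 powr (1 - 2 * s) * (Gamma (1 - s) / Gamma s)"

end

theory Submission
  imports Defs
begin

text \<open>
  In an eigenbasis all three squared norms are diagonal: each is a sum over $k$ of a scalar
  quantity that depends on $\lambda_k$ and is quadratic in the coefficient $u_k$ of $u$. So the
  theorem reduces to two minimization problems for one real unknown.

  For the K-norm, completing the square gives
  $\min_x ((u_k - x)^2 + t^2 \lambda^2 x^2) = \frac{t^2\lambda^2}{1 + t^2\lambda^2} u_k^2$, and the
  integral of this against $t^{-2s-1}$ is a Beta integral, equal to
  $\lambda^{2s} \frac{\pi}{2 \sin \pi s} u_k^2$ (\<open>K_weight_integral\<close>, \<open>K_integral\<close>).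

  For the extension norm one minimizes $\int_0^\infty y^\alpha (\lambda^2 f^2 + f'^2)\,dy$ under
  $f(0) = u_k$. The minimizer is $u_k \psi_s(\lambda y)$, where $\psi_s$ is the decaying solution of
  $(y^\alpha \psi')' = y^\alpha \psi$ with $\psi(0) = 1$; it is
  $\frac{2^{1-s}}{\Gamma(s)} y^s K_s(y)$ with the modified Bessel function $K_s$. Here it is given by
  $\psi_s(y) = \frac{1}{\Gamma(s)} \int_0^\infty t^{s-1} e^{-t - y^2/(4t)}\,dt$. The substitution
  $t \mapsto y^2/(4t)$ turns the derivative of this integral into
  $y^{1-2s} \psi_s'(y) = - d_s \psi_{1-s}(y)$ (\<open>bessel_profile_deriv\<close>). Since $d_s d_{1-s} = 1$,
  the same formula for $1 - s$ closes a first-order system for $\psi_s$ and its flux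
  $- y^\alpha \psi_s'$. The minimal energy is the product of value and flux at $0$, that is
  $d_s \lambda^{2s} u_k^2$ (\<open>ext_profile_energy\<close>).

  For minimality, the definition of the weak derivative of the competitor is applied to the flux of
  the minimizer, cut off near $0$ and near infinity (\<open>scalar_extension_lower_bound\<close>). The edge of the cut-off near $0$ picks up the trace, the
  edge near infinity contributes nothing, and the rest is a completed square.

  To return to the Hilbert spaces, lower bounds need only Bessel's inequality in both spaces and
  monotone convergence (\<open>extension_energy_lower_bound\<close>). The upper bounds are attained by the
  series of the scalar minimizers, \<open>harmonic_extension\<close> in the case of the extension norm; when
  the spectral sum is infinite, the lower bound shows that no extension exists.

  The eigenbasis itself comes from a maximal orthogonal family of eigenvectors. On its orthogonal
  complement the Rayleigh quotient $\|jv\|_0 / \|v\|_1$ attains its maximum, because $j$ is compact,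
  and a maximizer would be a further eigenvector (\<open>eigenbasis_exists\<close>).
\<close>

section \<open>Orthogonal series in a Hilbert space\<close>

text \<open>
  Zero vectors are admitted. A family indexed by a set of naturals, possibly finite, becomes a
  sequence by padding with zeros, and sums over the index set become ordinary series.
\<close>

definition orthonormal_seq :: "(nat \<Rightarrow> 'v::real_inner) \<Rightarrow> bool" where
  "orthonormal_seq e \<longleftrightarrow> (\<forall>k l. k \<noteq> l \<longrightarrow> e k \<bullet> e l = 0) \<and> (\<forall>k. e k = 0 \<or> norm (e k) = 1)"

lemma orthogonal_sum_norm:
  fixes f :: "nat \<Rightarrow> 'v::real_inner"
  assumes "\<And>k l. k \<noteq> l \<Longrightarrow> f k \<bullet> f l = 0" "finite A"
  shows "(norm (\<Sum>k\<in>A. f k))\<^sup>2 = (\<Sum>k\<in>A. (norm (f k))\<^sup>2)"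
  by (rule norm_sum_Pythagorean) (use assms in \<open>auto simp: pairwise_def orthogonal_def\<close>)

lemma orthogonal_summable:
  fixes f :: "nat \<Rightarrow> 'v::{real_inner,banach}"
  assumes orth: "\<And>k l. k \<noteq> l \<Longrightarrow> f k \<bullet> f l = 0" and sq: "summable (\<lambda>k. (norm (f k))\<^sup>2)"
  shows "summable f"
  unfolding summable_Cauchy
proof (intro allI impI)
  fix e :: real assume "e > 0"
  then have "e\<^sup>2 > 0" by simp
  with sq obtain N where N: "\<And>m n. m \<ge> N \<Longrightarrow> norm (\<Sum>k=m..<n. (norm (f k))\<^sup>2) < e\<^sup>2"
    unfolding summable_Cauchy by blast
  have "norm (sum f {m..<n}) < e" if "m \<ge> N" for m n
  proof -
    have "(norm (sum f {m..<n}))\<^sup>2 = (\<Sum>k=m..<n. (norm (f k))\<^sup>2)"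
      by (rule orthogonal_sum_norm[OF orth]) auto
    also have "\<dots> < e\<^sup>2" using N[OF that, of n] by simp
    finally show ?thesis using \<open>e > 0\<close> by (simp add: power_less_imp_less_base)
  qed
  then show "\<exists>N. \<forall>m\<ge>N. \<forall>n. norm (sum f {m..<n}) < e" by blast
qed

lemma orthogonal_suminf_norm:
  fixes f :: "nat \<Rightarrow> 'v::{real_inner,banach}"
  assumes orth: "\<And>k l. k \<noteq> l \<Longrightarrow> f k \<bullet> f l = 0" and sq: "summable (\<lambda>k. (norm (f k))\<^sup>2)"
  shows "(\<lambda>k. (norm (f k))\<^sup>2) sums (norm (suminf f))\<^sup>2"
proof -
  have "(\<lambda>n. sum f {..<n}) \<longlonglongrightarrow> suminf f"
    using orthogonal_summable[OF assms] by (rule summable_LIMSEQ)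
  then have "(\<lambda>n. (norm (sum f {..<n}))\<^sup>2) \<longlonglongrightarrow> (norm (suminf f))\<^sup>2"
    by (intro tendsto_intros)
  then show ?thesis
    unfolding sums_def by (simp add: orthogonal_sum_norm[OF orth])
qed

lemma orthonormal_seq_scaled:
  assumes "orthonormal_seq e"
  shows "k \<noteq> l \<Longrightarrow> (a k *\<^sub>R e k) \<bullet> (a l *\<^sub>R e l) = 0" and "(norm (a k *\<^sub>R e k))\<^sup>2 \<le> (a k)\<^sup>2"
proof -
  show "(norm (a k *\<^sub>R e k))\<^sup>2 \<le> (a k)\<^sup>2"
    using assms by (cases "e k = 0") (auto simp: orthonormal_seq_def)
qed (use assms in \<open>auto simp: orthonormal_seq_def\<close>)

lemma orthonormal_coeff:
  assumes "orthonormal_seq e"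
  shows "(norm ((u \<bullet> e k) *\<^sub>R e k))\<^sup>2 = (u \<bullet> e k)\<^sup>2"
  using assms by (cases "e k = 0") (auto simp: orthonormal_seq_def)

lemma Bessel_finite:
  assumes "orthonormal_seq e" "finite A"
  shows "(\<Sum>k\<in>A. (u \<bullet> e k)\<^sup>2) \<le> (norm u)\<^sup>2"
proof -
  let ?p = "\<Sum>k\<in>A. (u \<bullet> e k) *\<^sub>R e k"
  have np: "(norm ?p)\<^sup>2 = (\<Sum>k\<in>A. (u \<bullet> e k)\<^sup>2)"
  proof -
    have "(norm ?p)\<^sup>2 = (\<Sum>k\<in>A. (norm ((u \<bullet> e k) *\<^sub>R e k))\<^sup>2)"
      by (rule orthogonal_sum_norm) (use assms in \<open>auto simp: orthonormal_seq_def\<close>)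
    then show ?thesis by (simp only: orthonormal_coeff[OF assms(1)])
  qed
  have "u \<bullet> ?p = (\<Sum>k\<in>A. (u \<bullet> e k)\<^sup>2)"
    by (simp add: inner_sum_right power2_eq_square)
  then have "(norm (u - ?p))\<^sup>2 = (norm u)\<^sup>2 - (\<Sum>k\<in>A. (u \<bullet> e k)\<^sup>2)"
    using np by (simp add: power2_norm_eq_inner inner_diff_left inner_diff_right inner_commute)
  then show ?thesis by (metis diff_ge_0_iff_ge zero_le_power2)
qed

lemma Bessel:
  assumes "orthonormal_seq e"
  shows "summable (\<lambda>k. (u \<bullet> e k)\<^sup>2)"
proof (rule summableI_nonneg_bounded)
  show "(\<Sum>k<n. (u \<bullet> e k)\<^sup>2) \<le> (norm u)\<^sup>2" for n by (rule Bessel_finite[OF assms]) auto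
qed auto

lemma orthonormal_summable:
  fixes e :: "nat \<Rightarrow> 'v::{real_inner,banach}"
  assumes "orthonormal_seq e" "summable (\<lambda>k. (a k)\<^sup>2)"
  shows "summable (\<lambda>k. a k *\<^sub>R e k)"
    and "summable (\<lambda>k. (norm (a k *\<^sub>R e k))\<^sup>2)"
proof -
  show *: "summable (\<lambda>k. (norm (a k *\<^sub>R e k))\<^sup>2)"
    by (rule summable_comparison_test'[OF assms(2), of 0])
      (use orthonormal_seq_scaled(2)[OF assms(1)] in auto)
  show "summable (\<lambda>k. a k *\<^sub>R e k)"
    by (rule orthogonal_summable[OF orthonormal_seq_scaled(1)[OF assms(1)] *]) auto
qed

lemma orthonormal_suminf_inner:
  fixes e :: "nat \<Rightarrow> 'v::{real_inner,banach}"
  assumes "orthonormal_seq e" "summable (\<lambda>k. (a k)\<^sup>2)"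
  shows "(\<Sum>k. a k *\<^sub>R e k) \<bullet> e l = a l * (norm (e l))\<^sup>2"
proof -
  have "(\<lambda>k. (a k *\<^sub>R e k) \<bullet> e l) sums ((\<Sum>k. a k *\<^sub>R e k) \<bullet> e l)"
    using bounded_linear.sums[OF bounded_linear_inner_left]
      summable_sums[OF orthonormal_summable(1)[OF assms]] by blast
  moreover have "(\<lambda>k. (a k *\<^sub>R e k) \<bullet> e l) = (\<lambda>k. if k = l then a l * (norm (e l))\<^sup>2 else 0)"
    using assms(1) by (auto simp: orthonormal_seq_def power2_norm_eq_inner fun_eq_iff)
  ultimately show ?thesis
    using sums_single[of l "\<lambda>k. a l * (norm (e l))\<^sup>2"] sums_unique2 by fastforce
qed

lemma orthonormal_remainder:
  fixes e :: "nat \<Rightarrow> 'v::{real_inner,banach}"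
  assumes "orthonormal_seq e"
  shows "(u - (\<Sum>k. (u \<bullet> e k) *\<^sub>R e k)) \<bullet> e l = 0"
proof -
  have "(u \<bullet> e l) * (norm (e l))\<^sup>2 = u \<bullet> e l"
    using assms by (cases "e l = 0") (auto simp: orthonormal_seq_def)
  then show ?thesis
    by (simp add: inner_diff_left orthonormal_suminf_inner[OF assms Bessel[OF assms]])
qed

lemma orthogonal_to_dense_span:
  fixes p :: "'v::real_inner"
  assumes "closure (span S) = UNIV" "\<And>x. x \<in> S \<Longrightarrow> p \<bullet> x = 0"
  shows "p = 0"
proof -
  have "subspace {x. p \<bullet> x = 0}"
    by (auto simp: subspace_def inner_add_right)
  then have "span S \<subseteq> {x. p \<bullet> x = 0}"
    using assms(2) by (intro span_minimal) auto
  moreover have "closed {x. p \<bullet> x = 0}"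
    by (intro closed_Collect_eq continuous_on_inner continuous_on_const continuous_on_id)
  ultimately have "closure (span S) \<subseteq> {x. p \<bullet> x = 0}"
    by (rule closure_minimal)
  with assms(1) have "p \<bullet> p = 0" by blast
  then show ?thesis by simp
qed

lemma orthonormal_expansion:
  fixes e :: "nat \<Rightarrow> 'v::{real_inner,banach}"
  assumes "orthonormal_seq e" "closure (span (range e)) = UNIV"
  shows "(\<lambda>k. (u \<bullet> e k) *\<^sub>R e k) sums u"
proof -
  have "u - (\<Sum>k. (u \<bullet> e k) *\<^sub>R e k) = 0"
    by (rule orthogonal_to_dense_span[OF assms(2)])
      (use orthonormal_remainder[OF assms(1)] in auto)
  then show ?thesis
    using summable_sums[OF orthonormal_summable(1)[OF assms(1) Bessel[OF assms(1), of u]]]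
    by (metis eq_iff_diff_eq_0)
qed

lemma Parseval:
  fixes e :: "nat \<Rightarrow> 'v::{real_inner,banach}"
  assumes "orthonormal_seq e" "closure (span (range e)) = UNIV"
  shows "(\<lambda>k. (u \<bullet> e k)\<^sup>2) sums (norm u)\<^sup>2"
proof -
  have "(\<lambda>k. (norm ((u \<bullet> e k) *\<^sub>R e k))\<^sup>2) sums (norm (\<Sum>k. (u \<bullet> e k) *\<^sub>R e k))\<^sup>2"
    by (rule orthogonal_suminf_norm[OF orthonormal_seq_scaled(1)[OF assms(1)]])
      (assumption, simp only: orthonormal_coeff[OF assms(1)] Bessel[OF assms(1)])
  then show ?thesis
    by (simp only: orthonormal_coeff[OF assms(1)] sums_unique[OF orthonormal_expansion[OF assms], symmetric])
qed

section \<open>Existence of an eigenbasis\<close>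

text \<open>
  A maximizing sequence of unit vectors has, by compactness, a subsequence with convergent images.
  Nearly equal images of nearly maximal norm have a midpoint of nearly maximal norm, so the
  vectors themselves have a midpoint of norm close to one and are close by the parallelogram
  identity. Hence the subsequence converges in norm.
\<close>

lemma compact_embedding_norm_attained:
  fixes j :: "'b::{real_inner, banach} \<Rightarrow> 'a::{real_inner, banach}"
  assumes j: "bounded_linear j" "inj j" "compact (closure (j ` cball 0 1))"
    and W: "subspace W" "closed W" "W \<noteq> {0}"
  obtains v where "v \<in> W" "norm v = 1" "\<And>w. w \<in> W \<Longrightarrow> norm (j w) \<le> norm (j v) * norm w"
proof -
  interpret j: bounded_linear j by fact
  define S where "S = {norm (j w) |w. w \<in> W \<and> norm w = 1}"
  define M where "M = Sup S"
  obtain w0 where w0: "w0 \<in> W" "w0 \<noteq> 0"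
    using W(1,3) subspace_0 by blast
  have unit: "w /\<^sub>R norm w \<in> W" "norm (w /\<^sub>R norm w) = 1" if "w \<in> W" "w \<noteq> 0" for w
    using that W(1) by (auto intro: subspace_scale)
  have ne: "S \<noteq> {}" using unit[OF w0] unfolding S_def by blast
  obtain C where C: "\<And>x. norm (j x) \<le> norm x * C" using j.bounded by blast
  have bdd: "bdd_above S"
    unfolding S_def by (rule bdd_aboveI[of _ C]) (use C in \<open>auto, metis mult_1\<close>)
  have jM: "norm (j w) \<le> M * norm w" if "w \<in> W" for w
  proof (cases "w = 0")
    case False
    have "norm (j (w /\<^sub>R norm w)) \<in> S"
      using unit[OF that False] unfolding S_def by blast
    then have "norm (j (w /\<^sub>R norm w)) \<le> M"
      unfolding M_def using bdd by (rule cSup_upper)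
    then show ?thesis using False by (simp add: j.scaleR field_simps)
  qed (simp add: j.zero)
  have "j w0 \<noteq> 0" using j(2) w0(2) by (metis j.zero injD)
  then have "0 < M * norm w0" using jM[OF w0(1)] by (meson less_le_trans zero_less_norm_iff)
  then have Mpos: "M > 0" using w0(2) by (simp add: zero_less_mult_iff)
  have "\<exists>s. s \<in> S \<and> M - 1 / Suc n < s" for n
    using less_cSupE[of "M - 1 / Suc n" S] ne unfolding M_def by auto
  then have "\<exists>x. x \<in> W \<and> norm x = 1 \<and> M - 1 / Suc n < norm (j x)" for n
    unfolding S_def by blast
  then obtain x where x: "\<And>n. x n \<in> W" "\<And>n. norm (x n) = 1" "\<And>n. M - 1 / Suc n < norm (j (x n))"
    by metis
  have "\<And>n. j (x n) \<in> closure (j ` cball 0 1)"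
    using x(2) closure_subset[of "j ` cball 0 1"] by force
  then obtain l r where r: "strict_mono r" and l: "((\<lambda>n. j (x n)) \<circ> r) \<longlonglongrightarrow> l"
    using j(3) unfolding compact_def by meson
  define y where "y = x \<circ> r"
  have y: "y n \<in> W" "norm (y n) = 1" for n using x by (auto simp: y_def)
  have jy: "(\<lambda>n. j (y n)) \<longlonglongrightarrow> l" using l by (simp add: y_def o_def)
  have "(\<lambda>n. norm (j (y n))) \<longlonglongrightarrow> M"
  proof (rule real_tendsto_sandwich)
    show "\<forall>\<^sub>F n in sequentially. M - 1 / Suc n \<le> norm (j (y n))"
    proof (rule always_eventually, rule allI)
      fix n
      have "n \<le> r n" using r by (rule seq_suble)
      then have "M - 1 / Suc n \<le> M - 1 / Suc (r n)" by (simp add: frac_le)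
      also have "\<dots> \<le> norm (j (y n))" using x(3)[of "r n"] by (simp add: y_def)
      finally show "M - 1 / Suc n \<le> norm (j (y n))" .
    qed
    show "\<forall>\<^sub>F n in sequentially. norm (j (y n)) \<le> M"
      using jM[OF y(1)] y(2) by simp
    show "(\<lambda>n. M - 1 / Suc n) \<longlonglongrightarrow> M"
      using tendsto_diff[OF tendsto_const LIMSEQ_inverse_real_of_nat, of M] by (simp add: inverse_eq_divide)
  qed simp
  then have lM: "norm l = M" using jy LIMSEQ_unique tendsto_norm by blast
  have close: "(norm (y m - y n))\<^sup>2 \<le> 8 * \<delta> / M"
    if "dist (j (y m)) l < \<delta>" "dist (j (y n)) l < \<delta>" "\<delta> \<le> M" for m n \<delta>
  proof -
    have "2 * M = norm (l + l)" using lM norm_scaleR[of 2 l] by (simp add: scaleR_2)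
    also have "\<dots> \<le> norm (j (y m) + j (y n)) + (norm (l - j (y m)) + norm (l - j (y n)))"
      using norm_triangle_ineq[of "j (y m) + j (y n)" "(l - j (y m)) + (l - j (y n))"]
        norm_triangle_ineq[of "l - j (y m)" "l - j (y n)"] by (simp add: algebra_simps)
    finally have "2 * M - 2 * \<delta> \<le> norm (j (y m) + j (y n))"
      using that by (simp add: dist_norm norm_minus_commute)
    also have "\<dots> \<le> M * norm (y m + y n)"
      using jM[OF subspace_add[OF W(1) y(1) y(1)]] by (simp add: j.add)
    finally have "(2 * M - 2 * \<delta>)\<^sup>2 \<le> (M * norm (y m + y n))\<^sup>2"
      using that by (intro power_mono) auto
    moreover have "4 * M\<^sup>2 - 8 * \<delta> * M \<le> (2 * M - 2 * \<delta>)\<^sup>2"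
      by (simp add: power2_eq_square algebra_simps)
    ultimately have "M\<^sup>2 * (norm (y m + y n))\<^sup>2 \<ge> 4 * M\<^sup>2 - 8 * \<delta> * M"
      unfolding power_mult_distrib by linarith
    moreover have "(norm (y m - y n))\<^sup>2 = 4 - (norm (y m + y n))\<^sup>2"
      using y(2)[of m] y(2)[of n] by (simp add: norm_eq_1 power2_norm_eq_inner inner_diff_left inner_diff_right
          inner_add_left inner_add_right inner_commute)
    then have "M\<^sup>2 * (norm (y m - y n))\<^sup>2 = 4 * M\<^sup>2 - M\<^sup>2 * (norm (y m + y n))\<^sup>2"
      by (simp only: right_diff_distrib mult.commute)
    ultimately have "M\<^sup>2 * (norm (y m - y n))\<^sup>2 \<le> 8 * \<delta> * M"
      by linarith
    then show ?thesis using Mpos by (simp add: field_simps power2_eq_square)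
  qed
  have "Cauchy y"
  proof (rule metric_CauchyI)
    fix e :: real assume e: "e > 0"
    \<comment> \<open>The distance bound needs $8\delta/M < e^2$; $\delta \le M$ keeps $2M - 2\delta$ nonnegative before squaring.\<close>
    define \<delta> where "\<delta> = min M (M * e\<^sup>2 / 16)"
    have \<delta>: "\<delta> > 0" "\<delta> \<le> M" "\<delta> \<le> M * e\<^sup>2 / 16" using e Mpos by (auto simp: \<delta>_def)
    from jy \<delta>(1) obtain N where N: "\<And>n. n \<ge> N \<Longrightarrow> dist (j (y n)) l < \<delta>"
      unfolding lim_sequentially by blast
    have "dist (y m) (y n) < e" if "m \<ge> N" "n \<ge> N" for m n
    proof -
      have "(norm (y m - y n))\<^sup>2 \<le> 8 * \<delta> / M" using close[OF N N] that \<delta> by blast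
      also have "\<dots> \<le> e\<^sup>2 / 2" using \<delta>(3) Mpos by (simp add: field_simps)
      also have "\<dots> < e\<^sup>2" using e by simp
      finally show ?thesis using e by (simp add: dist_norm power_less_imp_less_base)
    qed
    then show "\<exists>N. \<forall>m\<ge>N. \<forall>n\<ge>N. dist (y m) (y n) < e" by blast
  qed
  then obtain v where v: "y \<longlonglongrightarrow> v" using Cauchy_convergent convergent_def by blast
  have "(\<lambda>n. j (y n)) \<longlonglongrightarrow> j v" using v by (rule j.tendsto)
  then have "norm (j v) = M" using jy lM LIMSEQ_unique by blast
  moreover have "norm v = 1" using tendsto_norm[OF v] y(2) by (simp add: LIMSEQ_const_iff)
  moreover have "v \<in> W" using W(2) v y(1) closed_sequentially by blast
  ultimately show ?thesis using that jM by blast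
qed

text \<open>
  The form $\|jv\|^2 \langle x, x\rangle - \langle jx, jx\rangle$ is nonnegative on \<open>W\<close> and vanishes
  at \<open>v\<close>, so its polarization at \<open>v\<close> vanishes too: otherwise a small step from \<open>v\<close> would make
  the form negative.
\<close>

lemma maximizer_eigen_equation:
  fixes j :: "'b::real_inner \<Rightarrow> 'a::real_inner"
  assumes j: "linear j" and W: "subspace W" and v: "v \<in> W" "norm v = 1"
    and max: "\<And>w. w \<in> W \<Longrightarrow> norm (j w) \<le> norm (j v) * norm w" and w: "w \<in> W"
  shows "j v \<bullet> j w = (norm (j v))\<^sup>2 * (v \<bullet> w)"
proof (rule ccontr)
  assume neg: "\<not> ?thesis"
  define M where "M = norm (j v)"
  define B where "B = M\<^sup>2 * (v \<bullet> w) - j v \<bullet> j w"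
  define Q where "Q = (\<lambda>x. M\<^sup>2 * (x \<bullet> x) - j x \<bullet> j x)"
  have B: "B \<noteq> 0" using neg by (auto simp: B_def M_def)
  have Q: "Q x \<ge> 0" if "x \<in> W" for x
  proof -
    have "(norm (j x))\<^sup>2 \<le> (M * norm x)\<^sup>2"
      using max[OF that] by (intro power_mono) (auto simp: M_def)
    then show ?thesis by (simp add: Q_def power_mult_distrib power2_norm_eq_inner)
  qed
  have Qv: "Q v = 0" using v(2) by (simp add: Q_def M_def norm_eq_1 power2_norm_eq_inner)
  have expand: "Q (v + \<tau> *\<^sub>R w) = 2 * \<tau> * B + \<tau>\<^sup>2 * Q w" for \<tau>
  proof -
    have "Q (v + \<tau> *\<^sub>R w) = Q v + 2 * \<tau> * B + \<tau>\<^sup>2 * Q w"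
      by (simp add: Q_def B_def linear_add[OF j] linear_scale[OF j] inner_add_left inner_add_right
          inner_commute power2_eq_square algebra_simps)
    then show ?thesis using Qv by simp
  qed
  \<comment> \<open>The step $-B/q$ would be the minimizer for $q = Q(w)$; adding one avoids division by zero.\<close>
  define q where "q = Q w + 1"
  have q: "q \<ge> 1" using Q[OF w] by (simp add: q_def)
  have "0 \<le> Q (v + (- B / q) *\<^sub>R w)" using W v(1) w by (intro Q subspace_add subspace_scale)
  also have "\<dots> = 2 * (- B / q) * B + (- B / q)\<^sup>2 * (q - 1)"
    unfolding expand by (simp add: q_def)
  also have "\<dots> = - (B\<^sup>2 * (q + 1)) / q\<^sup>2"
    using q by (simp add: field_simps power2_eq_square)
  also have "\<dots> < 0" using B q by (intro divide_neg_pos) (auto intro!: mult_pos_pos simp: zero_less_power2)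
  finally show False by simp
qed

text \<open>
  The unit eigenvectors of $j^* j$ in weak form. The eigenvalue is forced to be $\|jv\|^2$, as one sees by pairing with \<open>v\<close> itself.
\<close>

definition unit_eigenvectors :: "('b::real_inner \<Rightarrow> 'a::real_inner) \<Rightarrow> 'b set" where
  "unit_eigenvectors j = {v. norm v = 1 \<and> (\<forall>w. j v \<bullet> j w = (norm (j v))\<^sup>2 * (v \<bullet> w))}"

text \<open>
  Images of orthogonal eigenvectors are orthogonal, so infinitely many of norm at least
  \<open>\<epsilon>\<close> would have mutual distances at least \<open>\<epsilon>\<close> inside a compact set. This gives both the
  countability of an orthogonal family of eigenvectors and the divergence of the $\lambda_k$.
\<close>

lemma finite_large_eigenvectors:
  fixes j :: "'b::real_inner \<Rightarrow> 'a::real_inner"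
  assumes comp: "compact (closure (j ` cball 0 1))"
    and A: "A \<subseteq> unit_eigenvectors j" "pairwise orthogonal A" and \<epsilon>: "\<epsilon> > 0"
  shows "finite {v \<in> A. \<epsilon> \<le> norm (j v)}"
proof (rule ccontr)
  assume "infinite {v \<in> A. \<epsilon> \<le> norm (j v)}"
  then obtain x :: "nat \<Rightarrow> 'b" where x: "inj x" "range x \<subseteq> {v \<in> A. \<epsilon> \<le> norm (j v)}"
    using infinite_countable_subset by blast
  then have xA: "x n \<in> A" "\<epsilon> \<le> norm (j (x n))" "norm (x n) = 1" for n
    using A(1) by (auto simp: unit_eigenvectors_def)
  have "\<And>n. j (x n) \<in> closure (j ` cball 0 1)"
    using xA(3) closure_subset[of "j ` cball 0 1"] by force
  then obtain l r where r: "strict_mono r" and l: "((\<lambda>n. j (x n)) \<circ> r) \<longlonglongrightarrow> l"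
    using comp unfolding compact_def by meson
  obtain N where N: "\<forall>m\<ge>N. \<forall>n\<ge>N. dist (j (x (r m))) (j (x (r n))) < \<epsilon>"
    using metric_CauchyD[OF LIMSEQ_imp_Cauchy[OF l] \<epsilon>] unfolding o_def by blast
  let ?p = "x (r N)" and ?q = "x (r (Suc N))"
  have "?p \<noteq> ?q" using x(1) strict_monoD[OF r, of N "Suc N"] by (auto dest: injD)
  then have "?p \<bullet> ?q = 0" using A(2) xA(1) by (auto simp: pairwise_def orthogonal_def)
  then have "j ?p \<bullet> j ?q = 0" using A(1) xA(1)[of "r N"] by (force simp: unit_eigenvectors_def)
  then have "(norm (j ?p - j ?q))\<^sup>2 = (norm (j ?p))\<^sup>2 + (norm (j ?q))\<^sup>2"
    by (simp add: power2_norm_eq_inner inner_diff_left inner_diff_right inner_commute)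
  also have "\<dots> \<ge> \<epsilon>\<^sup>2" using power_mono[OF xA(2)[of "r N"], of 2] \<epsilon> by (simp add: add_increasing2)
  finally have "\<epsilon> \<le> norm (j ?p - j ?q)" by (rule power2_le_imp_le) simp
  then show False using N[rule_format, of N "Suc N"] by (simp add: dist_norm)
qed

lemma maximal_orthogonal_subset:
  fixes E :: "'b::real_inner set"
  obtains A where "A \<subseteq> E" "pairwise orthogonal A"
    "\<And>v. v \<in> E \<Longrightarrow> (\<And>a. a \<in> A \<Longrightarrow> v \<bullet> a = 0) \<Longrightarrow> v \<in> A"
proof -
  let ?F = "{A. A \<subseteq> E \<and> pairwise orthogonal A}"
  have "\<exists>M\<in>?F. \<forall>X\<in>?F. M \<subseteq> X \<longrightarrow> X = M"
  proof (rule subset_Zorn')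
    fix C assume C: "subset.chain ?F C"
    have "pairwise orthogonal (\<Union>C)"
      unfolding pairwise_def
    proof (intro ballI impI)
      fix x y assume "x \<in> \<Union>C" "y \<in> \<Union>C" "x \<noteq> y"
      then obtain X Y where XY: "X \<in> C" "Y \<in> C" "x \<in> X" "y \<in> Y" by blast
      then have "X \<subseteq> Y \<or> Y \<subseteq> X" "X \<in> ?F" "Y \<in> ?F" using C by (auto simp: subset_chain_def)
      then show "orthogonal x y" using XY \<open>x \<noteq> y\<close> by (auto simp: pairwise_def)
    qed
    then show "\<Union>C \<in> ?F" using C by (auto simp: subset_chain_def)
  qed
  then obtain A where A: "A \<subseteq> E" "pairwise orthogonal A"
    "\<And>X. X \<subseteq> E \<Longrightarrow> pairwise orthogonal X \<Longrightarrow> A \<subseteq> X \<Longrightarrow> X = A"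
    unfolding Bex_def Ball_def mem_Collect_eq by metis
  have "v \<in> A" if "v \<in> E" "\<And>a. a \<in> A \<Longrightarrow> v \<bullet> a = 0" for v
  proof -
    have "pairwise orthogonal (insert v A)"
      using A(2) that(2) by (auto simp: pairwise_insert orthogonal_def inner_commute)
    then have "insert v A = A" using A(1,3) that(1) by blast
    then show ?thesis by blast
  qed
  then show ?thesis using that A by blast
qed

text \<open>
  Take a maximal orthogonal family of unit eigenvectors. If its orthogonal complement \<open>W\<close> were
  nonzero, a maximizer of the Rayleigh quotient on \<open>W\<close> would satisfy the eigenvector equation
  against \<open>W\<close>, and against the closed span of the family because both sides vanish there. It would
  then be a further eigenvector. So the family spans $V_1$ densely, and its image spans $V_0$ densely.
\<close>

lemma eigenbasis_exists:
  fixes j :: "'b::{real_inner, banach} \<Rightarrow> 'a::{real_inner, banach}"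
  assumes "dense_compact_embedding j"
  shows "\<exists>I \<phi> lam. eigenbasis j I \<phi> lam"
proof -
  have j: "bounded_linear j" "inj j" "closure (range j) = UNIV"
    and comp: "compact (closure (j ` cball 0 1))"
    using assms by (auto simp: dense_compact_embedding_def)
  interpret j: bounded_linear j by fact
  obtain A where A: "A \<subseteq> unit_eigenvectors j" "pairwise orthogonal A"
    and Amax: "\<And>v. v \<in> unit_eigenvectors j \<Longrightarrow> (\<And>a. a \<in> A \<Longrightarrow> v \<bullet> a = 0) \<Longrightarrow> v \<in> A"
    using maximal_orthogonal_subset by blast
  have n1: "norm a = 1" if "a \<in> A" for a using A(1) that by (auto simp: unit_eigenvectors_def)
  have eig: "j a \<bullet> j w = (norm (j a))\<^sup>2 * (a \<bullet> w)" if "a \<in> A" for a w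
    using A(1) that by (auto simp: unit_eigenvectors_def)
  have jpos: "norm (j a) > 0" if "a \<in> A" for a
    using n1[OF that] j(2) by (metis injD j.zero norm_zero zero_less_norm_iff zero_neq_one)
  have orth: "a \<bullet> b = 0" if "a \<in> A" "b \<in> A" "a \<noteq> b" for a b
    using A(2) that by (auto simp: pairwise_def orthogonal_def)
  have "A = (\<Union>n. {a \<in> A. 1 / Suc n \<le> norm (j a)})"
  proof (intro equalityI subsetI)
    fix a assume a: "a \<in> A"
    obtain n where "1 / Suc n < norm (j a)" using nat_approx_posE[OF jpos[OF a]] .
    then show "a \<in> (\<Union>n. {a \<in> A. 1 / Suc n \<le> norm (j a)})" using a by (auto intro: less_imp_le)
  qed auto
  moreover have "countable (\<Union>n. {a \<in> A. 1 / Suc n \<le> norm (j a)})"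
    using finite_large_eigenvectors[OF comp A] by (intro countable_UN) (auto intro: countable_finite)
  ultimately have "countable A" by simp
  then obtain h :: "'b \<Rightarrow> nat" where h: "inj_on h A" by (rule countableE)
  define I where "I = h ` A"
  define ev where "ev = inv_into A h"
  have evA: "ev k \<in> A" if "k \<in> I" for k using that by (auto simp: ev_def I_def inv_into_into)
  have ev_inj: "ev k = ev l \<longleftrightarrow> k = l" if "k \<in> I" "l \<in> I" for k l
    using that by (auto simp: ev_def I_def h)
  have ev_range: "ev ` I = A" using h by (auto simp: ev_def I_def image_image)
  define e where "e = (\<lambda>k. if k \<in> I then ev k else 0)"
  have e: "orthonormal_seq e"
    unfolding orthonormal_seq_def e_def using n1 evA orth ev_inj by auto
  define W where "W = {w. \<forall>a\<in>A. w \<bullet> a = 0}"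
  have Wsub: "subspace W" by (auto simp: W_def subspace_def inner_add_left)
  have "W = (\<Inter>a\<in>A. {w. w \<bullet> a = 0})" by (auto simp: W_def)
  then have Wcl: "closed W"
    by (simp only:) (intro closed_INT ballI closed_Collect_eq continuous_on_inner continuous_on_const continuous_on_id)
  have remW: "w - (\<Sum>k. (w \<bullet> e k) *\<^sub>R e k) \<in> W" for w
  proof -
    have "(w - (\<Sum>k. (w \<bullet> e k) *\<^sub>R e k)) \<bullet> ev k = 0" if "k \<in> I" for k
      using orthonormal_remainder[OF e, of w k] that by (simp add: e_def)
    then show ?thesis using ev_range by (auto simp: W_def)
  qed
  \<comment> \<open>Otherwise the complement would contain a further eigenvector.\<close>
  have W0: "W = {0}"
  proof (rule ccontr)
    assume "W \<noteq> {0}"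
    from compact_embedding_norm_attained[OF j(1,2) comp Wsub Wcl this]
    obtain v where v: "v \<in> W" "norm v = 1" and vmax: "\<And>w. w \<in> W \<Longrightarrow> norm (j w) \<le> norm (j v) * norm w"
      by blast
    have "j v \<bullet> j w = (norm (j v))\<^sup>2 * (v \<bullet> w)" for w
    proof -
      let ?p = "\<Sum>k. (w \<bullet> e k) *\<^sub>R e k"
      have ps: "(\<lambda>k. (w \<bullet> e k) *\<^sub>R e k) sums ?p"
        using orthonormal_summable(1)[OF e Bessel[OF e]] by (rule summable_sums)
      have ve: "v \<bullet> e k = 0" "j v \<bullet> j (e k) = 0" for k
      proof -
        show *: "v \<bullet> e k = 0" using v(1) evA by (auto simp: e_def W_def)
        show "j v \<bullet> j (e k) = 0"
          using eig[OF evA, of k v] * by (auto simp: e_def inner_commute j.zero)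
      qed
      have "(\<lambda>k. v \<bullet> ((w \<bullet> e k) *\<^sub>R e k)) sums (v \<bullet> ?p)"
        by (rule bounded_linear.sums[OF bounded_linear_inner_right ps])
      then have "(\<lambda>k. 0 :: real) sums (v \<bullet> ?p)" using ve by simp
      then have 1: "v \<bullet> ?p = 0" by (rule sums_unique2[OF _ sums_zero])
      have "(\<lambda>k. j v \<bullet> j ((w \<bullet> e k) *\<^sub>R e k)) sums (j v \<bullet> j ?p)"
        by (intro bounded_linear.sums[OF bounded_linear_inner_right] j.sums ps)
      then have "(\<lambda>k. 0 :: real) sums (j v \<bullet> j ?p)" using ve by (simp add: j.scaleR)
      then have 2: "j v \<bullet> j ?p = 0" by (rule sums_unique2[OF _ sums_zero])
      have "j v \<bullet> j (w - ?p) = (norm (j v))\<^sup>2 * (v \<bullet> (w - ?p))"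
        by (rule maximizer_eigen_equation[OF j.linear_axioms Wsub v vmax remW])
      then show ?thesis using 1 2 by (simp add: j.diff inner_diff_right)
    qed
    then have "v \<in> unit_eigenvectors j" using v(2) by (simp add: unit_eigenvectors_def)
    then have "v \<in> A" using Amax v(1) by (auto simp: W_def)
    then have "v \<bullet> v = 0" using v(1) by (auto simp: W_def)
    then show False using v(2) by simp
  qed
  define \<phi> where "\<phi> = (\<lambda>k. ev k /\<^sub>R norm (j (ev k)))"
  \<comment> \<open>For a unit eigenvector of $V_1$ the quotient of the two norms is the inverse of its norm in $V_0$.\<close>
  define lam where "lam = (\<lambda>k. 1 / norm (j (ev k)))"
  have onb: "j (\<phi> k) \<bullet> j (\<phi> l) = (if k = l then 1 else 0)" if "k \<in> I" "l \<in> I" for k l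
  proof (cases "k = l")
    case True
    then show ?thesis using jpos[OF evA[OF that(1)]]
      by (simp add: \<phi>_def j.scaleR dot_square_norm power2_eq_square)
  next
    case False
    then have "ev k \<bullet> ev l = 0" using orth evA ev_inj that by blast
    then show ?thesis using False eig[OF evA[OF that(1)], of "ev l"] by (simp add: \<phi>_def j.scaleR)
  qed
  have "closure (span ((\<lambda>k. j (\<phi> k)) ` I)) = UNIV"
  proof -
    let ?V = "span ((\<lambda>k. j (\<phi> k)) ` I)"
    have "j w \<in> closure ?V" for w
    proof -
      have "w = (\<Sum>k. (w \<bullet> e k) *\<^sub>R e k)" using remW[of w] W0 by simp
      then have "(\<lambda>k. (w \<bullet> e k) *\<^sub>R e k) sums w"
        using summable_sums[OF orthonormal_summable(1)[OF e Bessel[OF e, of w]]] by metis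
      from j.sums[OF this] have "(\<lambda>n. \<Sum>k<n. j ((w \<bullet> e k) *\<^sub>R e k)) \<longlonglongrightarrow> j w"
        by (simp add: sums_def)
      moreover have "(\<Sum>k<n. j ((w \<bullet> e k) *\<^sub>R e k)) \<in> ?V" for n
      proof (rule span_sum)
        fix k
        show "j ((w \<bullet> e k) *\<^sub>R e k) \<in> ?V"
        proof (cases "k \<in> I")
          case True
          have "ev k = norm (j (ev k)) *\<^sub>R \<phi> k" using jpos[OF evA[OF True]] by (simp add: \<phi>_def)
          then have "j ((w \<bullet> e k) *\<^sub>R e k) = ((w \<bullet> e k) * norm (j (ev k))) *\<^sub>R j (\<phi> k)"
            using True by (metis (full_types) e_def j.scaleR scaleR_scaleR)
          then show ?thesis using True by (simp add: span_base span_scale)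
        qed (simp add: e_def j.zero span_zero)
      qed
      ultimately show ?thesis
        unfolding closure_sequential by (intro exI[of _ "\<lambda>n. \<Sum>k<n. j ((w \<bullet> e k) *\<^sub>R e k)"] conjI allI)
    qed
    then have "closure (range j) \<subseteq> closure ?V" by (intro closure_minimal) auto
    then show ?thesis using j(3) by blast
  qed
  moreover have "filterlim lam at_top (inf cofinite (principal I))"
    unfolding filterlim_at_top eventually_inf_principal eventually_cofinite
  proof
    fix Z :: real
    define Z' where "Z' = max Z 1"
    have "{k. \<not> (k \<in> I \<longrightarrow> Z \<le> lam k)} \<subseteq> h ` {a \<in> A. 1 / Z' \<le> norm (j a)}"
    proof
      fix k assume "k \<in> {k. \<not> (k \<in> I \<longrightarrow> Z \<le> lam k)}"
      then have k: "k \<in> I" "lam k < Z" by auto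
      have "1 / norm (j (ev k)) < Z'" "Z' > 0" using k(2) by (auto simp: lam_def Z'_def)
      then have "1 / Z' \<le> norm (j (ev k))" using jpos[OF evA[OF k(1)]] by (simp add: field_simps)
      moreover have "k = h (ev k)" using k(1) by (simp add: ev_def I_def f_inv_into_f)
      ultimately show "k \<in> h ` {a \<in> A. 1 / Z' \<le> norm (j a)}" using evA[OF k(1)] by blast
    qed
    moreover have "finite {a \<in> A. 1 / Z' \<le> norm (j a)}"
      by (rule finite_large_eigenvectors[OF comp A]) (simp add: Z'_def)
    ultimately show "finite {k. \<not> (k \<in> I \<longrightarrow> Z \<le> lam k)}" by (meson finite_imageI finite_subset)
  qed
  moreover have "\<phi> k \<bullet> w = (lam k)\<^sup>2 * (j (\<phi> k) \<bullet> j w)" if "k \<in> I" for k w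
    using eig[OF evA[OF that], of w] jpos[OF evA[OF that]]
    by (simp add: \<phi>_def lam_def j.scaleR power2_eq_square)
  moreover have "lam k > 0" if "k \<in> I" for k using jpos[OF evA[OF that]] by (simp add: lam_def)
  ultimately have "eigenbasis j I \<phi> lam" unfolding eigenbasis_def using onb by blast
  then show ?thesis by blast
qed

section \<open>The Bessel profile\<close>

lemma half_line_sets [simp]: "{0<..} \<in> sets (lebesgue :: real measure)" "{0<..} \<inter> space lebesgue \<in> sets (lebesgue :: real measure)"
  by auto

text \<open>
  Values in an arbitrary topological space are allowed, because the types of the Hilbert spaces
  are not of a second countable class.
\<close>

lemma half_line_continuous_measurable:
  fixes f :: "real \<Rightarrow> 'c::topological_space"
  assumes "continuous_on {0<..} f"
  shows "f \<in> borel_measurable (lebesgue_on {0<..})"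
proof (rule borel_measurableI)
  fix S :: "'c set" assume "open S"
  then have "open (f -` S \<inter> {0<..})"
    using continuous_on_open_vimage[of "{0<..}" f] assms by auto
  then have "f -` S \<inter> {0<..} \<in> sets lebesgue" by auto
  then show "f -` S \<inter> space (lebesgue_on {0<..}) \<in> sets (lebesgue_on {0<..})"
    by (simp add: sets_restrict_space_iff)
qed

lemma half_line_nn_integral:
  fixes f :: "real \<Rightarrow> real"
  assumes "\<And>y. y > 0 \<Longrightarrow> 0 \<le> f y" "(f has_integral I) {0<..}"
  shows "(\<integral>\<^sup>+y. ennreal (f y) \<partial>lebesgue_on {0<..}) = ennreal I"
proof -
  have "(\<integral>\<^sup>+y. ennreal (f y) \<partial>lebesgue_on {0<..}) = (\<integral>\<^sup>+y. ennreal (f y) * indicator {0<..} y \<partial>lebesgue)"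
    by (rule nn_integral_restrict_space) simp
  also have "\<dots> = (\<integral>\<^sup>+y. ennreal (f y) * indicator {0<..} y \<partial>lborel)"
    by (rule nn_integral_completion)
  also have "\<dots> = (\<integral>\<^sup>+y. ennreal (indicator {0<..} y * f y) \<partial>lborel)"
    by (rule nn_integral_cong) (simp add: indicator_def)
  finally show ?thesis using nn_integral_has_integral_lebesgue[OF _ assms(2)] assms(1) by simp
qed

definition bessel_kernel :: "real \<Rightarrow> real \<Rightarrow> real \<Rightarrow> real" where
  "bessel_kernel s y t = t powr (s - 1) * exp (- t - y\<^sup>2 / (4 * t))"

text \<open>
  This is $2\,(y/2)^s K_s(y)$ with the modified Bessel function $K_s$. In this form the value at $0$
  is $\Gamma(s)$, and the derivative in \<open>y\<close> is $-y/2$ times the integral of order $s - 1$.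
\<close>

definition bessel_integral :: "real \<Rightarrow> real \<Rightarrow> real" where
  "bessel_integral s y = (\<integral>t. bessel_kernel s y t \<partial>lebesgue_on {0<..})"

lemma bessel_kernel_nonneg: "bessel_kernel s y t \<ge> 0"
  by (simp add: bessel_kernel_def)

lemma bessel_kernel_measurable: "bessel_kernel s y \<in> borel_measurable (lebesgue_on {0<..})"
  by (rule half_line_continuous_measurable)
    (auto simp: bessel_kernel_def[abs_def] intro!: continuous_intros)

lemma Gamma_kernel_integrable:
  fixes s :: real
  assumes "s > 0"
  shows "integrable (lebesgue_on {0<..}) (\<lambda>t. t powr (s - 1) * exp (- t))"
    and "(\<integral>t. t powr (s - 1) * exp (- t) \<partial>lebesgue_on {0<..}) = Gamma s"
proof -
  let ?f = "\<lambda>t::real. t powr (s - 1) * exp (- t)"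
  have "(?f has_integral Gamma s) {0..}"
    using Gamma_integral_real[OF assms] by (simp add: exp_minus divide_inverse)
  then have hi: "(?f has_integral Gamma s) {0<..}"
    by (rule has_integral_spike_set_eq[THEN iffD1, rotated -1])
      (auto intro: negligible_subset[of "{0}"])
  then have "?f absolutely_integrable_on {0<..}"
    by (intro nonnegative_absolutely_integrable_1) (auto simp: integrable_on_def)
  then show i: "integrable (lebesgue_on {0<..}) ?f"
    by (rule absolutely_integrable_imp_integrable) simp
  show "(\<integral>t. ?f t \<partial>lebesgue_on {0<..}) = Gamma s"
    using lebesgue_integral_eq_integral[OF i] integral_unique[OF hi] by simp
qed

text \<open>
  The second bound comes from $x e^{-x} \le 1$ with $x = y^2/(4t)$. It yields
  the quadratic decay of the profile, from which all estimates for large arguments follow.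
\<close>

lemma bessel_kernel_bounds:
  assumes "t > 0"
  shows "bessel_kernel s y t \<le> t powr (s - 1) * exp (- t)"
    and "y\<^sup>2 * bessel_kernel s y t \<le> 4 * (t powr s * exp (- t))"
proof -
  show "bessel_kernel s y t \<le> t powr (s - 1) * exp (- t)"
    using assms by (simp add: bessel_kernel_def mult_left_mono)
  let ?x = "y\<^sup>2 / (4 * t)"
  have "?x \<le> exp ?x" using exp_ge_add_one_self[of ?x] by linarith
  then have "?x * exp (- ?x) \<le> exp ?x * exp (- ?x)" by (intro mult_right_mono) auto
  then have "?x * exp (- ?x) \<le> 1" by (simp add: exp_minus)
  then have "(4 * t) * (?x * exp (- ?x)) \<le> (4 * t) * 1" using assms by (intro mult_left_mono) auto
  then have "y\<^sup>2 * exp (- ?x) \<le> 4 * t" using assms by simp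
  then have "(t powr (s - 1) * exp (- t)) * (y\<^sup>2 * exp (- ?x)) \<le> (t powr (s - 1) * exp (- t)) * (4 * t)"
    by (rule mult_left_mono) simp
  also have "\<dots> = 4 * (t powr s * exp (- t))"
    using assms by (simp add: powr_diff)
  also have "(t powr (s - 1) * exp (- t)) * (y\<^sup>2 * exp (- ?x)) = y\<^sup>2 * bessel_kernel s y t"
    using mult_exp_exp[of "- t" "- ?x"] by (simp add: bessel_kernel_def)
  finally show "y\<^sup>2 * bessel_kernel s y t \<le> 4 * (t powr s * exp (- t))" .
qed

lemma bessel_kernel_integrable:
  assumes "s > 0"
  shows "integrable (lebesgue_on {0<..}) (bessel_kernel s y)"
  by (rule Bochner_Integration.integrable_bound[OF Gamma_kernel_integrable(1)[OF assms] bessel_kernel_measurable])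
    (use bessel_kernel_bounds(1) bessel_kernel_nonneg in \<open>auto intro!: AE_I2\<close>)

text \<open>
  The substitution $t \mapsto y^2/(4t)$ preserves the exponent and reflects the order. It makes
  the integral of the negative order $s - 1$ converge for $y > 0$ and evaluates it.
\<close>

lemma bessel_reflection:
  assumes "s < 1" "y > 0"
  shows "integrable (lebesgue_on {0<..}) (bessel_kernel (s - 1) y)"
    and "bessel_integral (s - 1) y = (y / 2) powr (2 * s - 2) * bessel_integral (1 - s) y"
proof -
  let ?g = "\<lambda>t::real. y\<^sup>2 / (4 * t)"
  let ?f = "bessel_kernel (1 - s) y"
  have img: "?g ` {0<..} = {0<..}"
  proof
    show "{0<..} \<subseteq> ?g ` {0<..}"
    proof
      fix x :: real assume "x \<in> {0<..}"
      then show "x \<in> ?g ` {0<..}" using assms(2)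
        by (intro image_eqI[of _ _ "?g x"]) (auto simp: field_simps)
    qed
  qed (use assms(2) in auto)
  have inj: "inj_on ?g {0<..}" using assms(2) by (auto simp: inj_on_def field_simps)
  have der: "(?g has_field_derivative - (y\<^sup>2 / (4 * t\<^sup>2))) (at t within {0<..})" if "t \<in> {0<..}" for t
    using that by (auto intro!: derivative_eq_intros simp: field_simps power2_eq_square)
  have eq: "\<bar>- (y\<^sup>2 / (4 * t\<^sup>2))\<bar> * ?f (?g t) = (y / 2) powr (2 - 2 * s) * bessel_kernel (s - 1) y t"
    if "t > 0" for t
  proof -
    have "?g t powr (- s) = (y / 2) powr (- 2 * s) * t powr s"
    proof -
      have "?g t = (y / 2) powr 2 / t" using assms(2) by (simp add: powr_numeral power2_eq_square)
      then have "?g t powr (- s) = ((y / 2) powr 2) powr (- s) / t powr (- s)"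
        using that assms(2) by (metis powr_divide powr_ge_zero less_imp_le)
      also have "\<dots> = (y / 2) powr (- 2 * s) * t powr s" using powr_minus_divide[of t "- s"] by (simp add: powr_powr)
      finally show ?thesis .
    qed
    moreover have "- ?g t - y\<^sup>2 / (4 * ?g t) = - t - y\<^sup>2 / (4 * t)"
      using assms(2) that by (simp add: field_simps)
    ultimately have "\<bar>- (y\<^sup>2 / (4 * t\<^sup>2))\<bar> * ?f (?g t) =
        (y / 2) powr 2 / t\<^sup>2 * ((y / 2) powr (- 2 * s) * t powr s * exp (- t - y\<^sup>2 / (4 * t)))"
      using assms(2) that by (simp add: bessel_kernel_def powr_numeral power2_eq_square)
    also have "\<dots> = ((y / 2) powr 2 * (y / 2) powr (- 2 * s)) * (t powr s / t powr 2 * exp (- t - y\<^sup>2 / (4 * t)))"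
      using that by (simp add: powr_numeral)
    also have "\<dots> = (y / 2) powr (2 - 2 * s) * bessel_kernel (s - 1) y t"
      by (simp add: bessel_kernel_def powr_add[symmetric] powr_diff[symmetric])
    finally show ?thesis .
  qed
  have i1: "integrable (lebesgue_on {0<..}) ?f" using assms(1) by (intro bessel_kernel_integrable) simp
  have a1: "?f absolutely_integrable_on {0<..}"
    using i1 by (simp add: set_integrable_def integrable_restrict_space)
  have v1: "integral {0<..} ?f = bessel_integral (1 - s) y"
    using lebesgue_integral_eq_integral[OF i1] by (simp add: bessel_integral_def)
  let ?h = "\<lambda>t. \<bar>- (y\<^sup>2 / (4 * t\<^sup>2))\<bar> * ?f (?g t)"
  have h: "?h absolutely_integrable_on {0<..} \<and> integral {0<..} ?h = bessel_integral (1 - s) y"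
    using has_absolute_integral_change_of_variables_1'[OF _ der inj, of ?f] a1 v1 unfolding img by auto
  then have i2: "integrable (lebesgue_on {0<..}) ?h"
    by (intro absolutely_integrable_imp_integrable) auto
  let ?c = "(y / 2) powr (2 - 2 * s)"
  have c: "?c > 0" using assms(2) by simp
  have hc: "?h t = ?c * bessel_kernel (s - 1) y t" if "t \<in> space (lebesgue_on {0<..})" for t
    by (rule eq) (use that in simp)
  have i3: "integrable (lebesgue_on {0<..}) (\<lambda>t. ?c * bessel_kernel (s - 1) y t)"
    by (rule Bochner_Integration.integrable_cong[OF refl hc, THEN iffD1, OF _ i2])
  then show "integrable (lebesgue_on {0<..}) (bessel_kernel (s - 1) y)"
    using c by simp
  have "bessel_integral (1 - s) y = (\<integral>t. ?h t \<partial>lebesgue_on {0<..})"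
    using h lebesgue_integral_eq_integral[OF i2] by simp
  also have "\<dots> = (\<integral>t. ?c * bessel_kernel (s - 1) y t \<partial>lebesgue_on {0<..})"
    by (rule Bochner_Integration.integral_cong[OF refl hc])
  also have "\<dots> = ?c * bessel_integral (s - 1) y" by (simp add: bessel_integral_def)
  finally have "bessel_integral (1 - s) y = ?c * bessel_integral (s - 1) y" .
  then have "(y / 2) powr (2 * s - 2) * bessel_integral (1 - s) y
      = ((y / 2) powr (2 * s - 2) * ?c) * bessel_integral (s - 1) y"
    by simp
  moreover have "(y / 2) powr (2 * s - 2) * ?c = 1"
    using assms(2) by (simp only: powr_add[symmetric]) simp
  ultimately show "bessel_integral (s - 1) y = (y / 2) powr (2 * s - 2) * bessel_integral (1 - s) y"
    by simp
qed

lemma bessel_integral_continuous: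
  assumes "s > 0"
  shows "continuous_on UNIV (bessel_integral s)"
proof (rule continuous_on_sequentiallyI)
  fix u :: "nat \<Rightarrow> real" and a assume u: "u \<longlonglongrightarrow> a"
  show "(\<lambda>n. bessel_integral s (u n)) \<longlonglongrightarrow> bessel_integral s a"
    unfolding bessel_integral_def
  proof (rule integral_dominated_convergence[OF bessel_kernel_measurable bessel_kernel_measurable
        Gamma_kernel_integrable(1)[OF assms]])
    show "AE t in lebesgue_on {0<..}. (\<lambda>n. bessel_kernel s (u n) t) \<longlonglongrightarrow> bessel_kernel s a t"
      by (rule AE_I2) (auto simp: bessel_kernel_def intro!: tendsto_intros u)
    show "AE t in lebesgue_on {0<..}. norm (bessel_kernel s (u n) t) \<le> t powr (s - 1) * exp (- t)" for n
      by (rule AE_I2) (use bessel_kernel_bounds(1) bessel_kernel_nonneg in auto)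
  qed
qed

lemma bessel_kernel_deriv:
  assumes "t > 0"
  shows "((\<lambda>r. bessel_kernel s r t) has_field_derivative - (r / 2) * bessel_kernel (s - 1) r t) (at r within A)"
  using assms by (auto simp: bessel_kernel_def powr_diff field_simps power2_eq_square
      intro!: derivative_eq_intros)

text \<open>
  Differentiation under the integral by dominated convergence. For increments below $y/2$ the mean
  value theorem bounds the difference quotients by a multiple of the kernel of order $s - 1$ at
  $y/2$, which is integrable by reflection.
\<close>

lemma bessel_integral_deriv:
  assumes s: "0 < s" "s < 1" and y: "y > 0"
  shows "(bessel_integral s has_real_derivative - (y / 2) * bessel_integral (s - 1) y) (at y)"
proof -
  let ?L = "lebesgue_on {0<..} :: real measure"
  let ?q = "\<lambda>h t. (bessel_kernel s (y + h) t - bessel_kernel s y t) / h"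
  let ?S = "{- y / 2<..<y / 2}"
  have "((\<lambda>h. (bessel_integral s (y + h) - bessel_integral s y) / h) \<longlongrightarrow> - (y / 2) * bessel_integral (s - 1) y)
      (at 0 within ?S)"
    unfolding tendsto_at_iff_sequentially comp_def
  proof (intro allI impI)
    fix X :: "nat \<Rightarrow> real" assume X: "\<forall>i. X i \<in> ?S - {0}" "X \<longlonglongrightarrow> 0"
    have "(\<lambda>n. \<integral>t. ?q (X n) t \<partial>?L) \<longlonglongrightarrow> (\<integral>t. - (y / 2) * bessel_kernel (s - 1) y t \<partial>?L)"
    proof (rule integral_dominated_convergence)
      show "(\<lambda>t. - (y / 2) * bessel_kernel (s - 1) y t) \<in> borel_measurable ?L"
        by (intro borel_measurable_times bessel_kernel_measurable) auto
      show "?q (X n) \<in> borel_measurable ?L" for n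
        by (intro borel_measurable_divide borel_measurable_diff bessel_kernel_measurable) auto
      show "integrable ?L (\<lambda>t. y * bessel_kernel (s - 1) (y / 2) t)"
        using bessel_reflection(1)[of s "y / 2"] s y by auto
      show "AE t in ?L. (\<lambda>n. ?q (X n) t) \<longlonglongrightarrow> - (y / 2) * bessel_kernel (s - 1) y t"
      proof (rule AE_I2)
        fix t assume "t \<in> space ?L"
        then have "t > 0" by simp
        from bessel_kernel_deriv[OF this, of s y UNIV]
        have "((\<lambda>h. ?q h t) \<longlongrightarrow> - (y / 2) * bessel_kernel (s - 1) y t) (at 0)"
          by (simp add: DERIV_def)
        then show "(\<lambda>n. ?q (X n) t) \<longlonglongrightarrow> - (y / 2) * bessel_kernel (s - 1) y t"
          using X unfolding tendsto_at_iff_sequentially comp_def by auto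
      qed
      show "AE t in ?L. norm (?q (X n) t) \<le> y * bessel_kernel (s - 1) (y / 2) t" for n
      proof (rule AE_I2)
        fix t assume "t \<in> space ?L"
        then have t: "t > 0" by simp
        have Xn: "X n \<noteq> 0" "\<bar>X n\<bar> < y / 2" using X(1)[rule_format, of n] by auto
        have "norm (bessel_kernel s (y + X n) t - bessel_kernel s y t)
            \<le> (y * bessel_kernel (s - 1) (y / 2) t) * norm (y + X n - y)"
        proof (rule field_differentiable_bound[of "{y / 2..2 * y}"])
          fix r assume r: "r \<in> {y / 2..2 * y}"
          show "((\<lambda>r. bessel_kernel s r t) has_field_derivative - (r / 2) * bessel_kernel (s - 1) r t)
              (at r within {y / 2..2 * y})"
            by (rule bessel_kernel_deriv[OF t])
          have "(y / 2)\<^sup>2 \<le> r\<^sup>2" using r y by (intro power_mono) auto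
          then have "(y / 2)\<^sup>2 / (4 * t) \<le> r\<^sup>2 / (4 * t)" using t by (intro divide_right_mono) auto
          then have "bessel_kernel (s - 1) r t \<le> bessel_kernel (s - 1) (y / 2) t"
            unfolding bessel_kernel_def by (intro mult_left_mono) auto
          then have "(r / 2) * bessel_kernel (s - 1) r t \<le> y * bessel_kernel (s - 1) (y / 2) t"
            using r y by (intro mult_mono) (auto simp: bessel_kernel_nonneg)
          then show "norm (- (r / 2) * bessel_kernel (s - 1) r t) \<le> y * bessel_kernel (s - 1) (y / 2) t"
            using r y by (simp add: abs_mult bessel_kernel_nonneg)
        qed (use Xn y in auto)
        then show "norm (?q (X n) t) \<le> y * bessel_kernel (s - 1) (y / 2) t"
          using Xn by (simp add: field_simps)
      qed
    qed
    moreover have "(\<integral>t. - (y / 2) * bessel_kernel (s - 1) y t \<partial>?L) = - (y / 2) * bessel_integral (s - 1) y"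
      by (simp add: bessel_integral_def)
    moreover have "(\<integral>t. ?q (X n) t \<partial>?L) = (bessel_integral s (y + X n) - bessel_integral s y) / X n" for n
      using bessel_kernel_integrable[OF s(1)] by (simp add: bessel_integral_def)
    ultimately show "(\<lambda>n. (bessel_integral s (y + X n) - bessel_integral s y) / X n)
        \<longlonglongrightarrow> - (y / 2) * bessel_integral (s - 1) y"
      by (simp only:)
  qed
  moreover have "at 0 within ?S = at 0" using y by (intro at_within_open) auto
  ultimately show ?thesis by (simp add: DERIV_def)
qed

lemma Gamma_real_nonzero: "s > 0 \<Longrightarrow> Gamma s \<noteq> (0 :: real)"
  by (metis Gamma_real_pos less_irrefl)

definition bessel_profile :: "real \<Rightarrow> real \<Rightarrow> real" where
  "bessel_profile s y = bessel_integral s y / Gamma s"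

lemma bessel_profile_0: "s > 0 \<Longrightarrow> bessel_profile s 0 = 1"
  using Gamma_kernel_integrable(2)[of s] Gamma_real_nonzero[of s]
  by (simp add: bessel_profile_def bessel_integral_def bessel_kernel_def)

lemma bessel_profile_continuous: "s > 0 \<Longrightarrow> continuous_on A (bessel_profile s)"
  unfolding bessel_profile_def[abs_def]
  using continuous_on_subset[OF bessel_integral_continuous] Gamma_real_nonzero[of s]
  by (intro continuous_intros) auto

lemma bessel_profile_nonneg: "s > 0 \<Longrightarrow> bessel_profile s y \<ge> 0"
  unfolding bessel_profile_def bessel_integral_def
  using Gamma_real_pos[of s] by (intro divide_nonneg_pos integral_nonneg) (auto simp: bessel_kernel_nonneg)

lemma bessel_profile_le_1:
  assumes "s > 0"
  shows "bessel_profile s y \<le> 1"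
proof -
  have "bessel_integral s y \<le> Gamma s"
    unfolding bessel_integral_def Gamma_kernel_integrable(2)[OF assms, symmetric]
    by (rule integral_mono[OF bessel_kernel_integrable[OF assms] Gamma_kernel_integrable(1)[OF assms]])
      (use bessel_kernel_bounds(1) in auto)
  then show ?thesis using Gamma_real_pos[OF assms] by (simp add: bessel_profile_def)
qed

lemma bessel_profile_decay:
  assumes "s > 0"
  shows "y\<^sup>2 * bessel_profile s y \<le> 4 * s"
proof -
  have i: "integrable (lebesgue_on {0<..}) (\<lambda>t. t powr s * exp (- t))"
    and v: "(\<integral>t. t powr s * exp (- t) \<partial>lebesgue_on {0<..}) = s * Gamma s"
    using Gamma_kernel_integrable[of "s + 1"] assms Gamma_plus1[of s] by (auto simp: nonpos_Ints_def add.commute)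
  have "y\<^sup>2 * bessel_integral s y \<le> (\<integral>t. 4 * (t powr s * exp (- t)) \<partial>lebesgue_on {0<..})"
    unfolding bessel_integral_def integral_mult_right_zero[symmetric]
    by (rule integral_mono) (use bessel_kernel_bounds(2) bessel_kernel_integrable[OF assms] i in auto)
  also have "\<dots> = 4 * s * Gamma s" using v by simp
  finally show ?thesis using Gamma_real_pos[OF assms] by (simp add: bessel_profile_def field_simps)
qed

lemma d_const_pos: "0 < s \<Longrightarrow> s < 1 \<Longrightarrow> d_const s > 0"
  unfolding d_const_def by (intro mult_pos_pos divide_pos_pos Gamma_real_pos) auto

text \<open>
  The reason why applying \<open>bessel_profile_deriv\<close> twice leads back to the profile with factor one.
\<close>

lemma d_const_reflect: "0 < s \<Longrightarrow> s < 1 \<Longrightarrow> d_const s * d_const (1 - s) = 1"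
  using Gamma_real_nonzero[of s] Gamma_real_nonzero[of "1 - s"]
  by (simp add: d_const_def powr_add[symmetric])

text \<open>
  This is $y^{1-2s} \psi_s' = - d_s \psi_{1-s}$: the derivative lowers the order to $s - 1$, and
  reflection replaces it by $1 - s$. The constant $d_s$ of the theorem originates here.
\<close>

lemma bessel_profile_deriv:
  assumes s: "0 < s" "s < 1" and y: "y > 0"
  shows "(bessel_profile s has_real_derivative - (d_const s * y powr (2 * s - 1) * bessel_profile (1 - s) y)) (at y)"
proof -
  have G: "Gamma s > 0" "Gamma (1 - s) > 0" using s by (auto intro: Gamma_real_pos)
  have "(bessel_profile s has_real_derivative - (y / 2) * bessel_integral (s - 1) y / Gamma s) (at y)"
    unfolding bessel_profile_def[abs_def] by (intro DERIV_cdivide bessel_integral_deriv assms)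
  moreover have "- (y / 2) * bessel_integral (s - 1) y / Gamma s
      = - (d_const s * y powr (2 * s - 1) * bessel_profile (1 - s) y)"
  proof -
    have "(y / 2) * (y / 2) powr (2 * s - 2) = (y / 2) powr (2 * s - 1)"
      using y powr_add[of "y / 2" 1 "2 * s - 2"] by simp
    also have "\<dots> = 2 powr (1 - 2 * s) * y powr (2 * s - 1)"
      using y powr_minus_divide[of 2 "2 * s - 1"] by (simp add: powr_divide)
    finally have 1: "(y / 2) * (y / 2) powr (2 * s - 2) = 2 powr (1 - 2 * s) * y powr (2 * s - 1)" .
    have "(y / 2) * bessel_integral (s - 1) y = (2 powr (1 - 2 * s) * y powr (2 * s - 1)) * bessel_integral (1 - s) y"
      unfolding bessel_reflection(2)[OF s(2) y] 1[symmetric] by simp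
    then show ?thesis using G by (simp add: d_const_def bessel_profile_def field_simps)
  qed
  ultimately show ?thesis by simp
qed

section \<open>Two scalar integrals and the one-dimensional minimizer\<close>

lemma Beta_reflection:
  assumes s: "0 < s" "s < 1"
  shows "Beta (1 - s) s = pi / sin (pi * s)"
proof -
  have "complex_of_real (Gamma s * Gamma (1 - s)) = of_real (pi / sin (pi * s))"
    using Gamma_reflection_complex[of "of_real s"]
    by (simp add: Gamma_complex_of_real[symmetric] sin_of_real[symmetric])
  then have "Gamma s * Gamma (1 - s) = pi / sin (pi * s)" using of_real_eq_iff by blast
  then show ?thesis by (simp add: Beta_def mult.commute)
qed

text \<open>
  The substitution $x = t^2\lambda^2/(1 + t^2\lambda^2)$ maps the half-line to the unit interval and
  turns the integral into half a Beta integral with parameters $1 - s$ and $s$.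
\<close>

lemma K_weight_integral:
  assumes s: "0 < s" "s < 1" and l: "l > 0"
  shows "(\<integral>\<^sup>+t. ennreal (t powr (- 2 * s - 1) * (t\<^sup>2 * l\<^sup>2 / (1 + t\<^sup>2 * l\<^sup>2))) \<partial>lebesgue_on {0<..})
    = ennreal (l powr (2 * s) * (pi / (2 * sin (pi * s))))"
proof (rule half_line_nn_integral)
  let ?g = "\<lambda>t. t\<^sup>2 * l\<^sup>2 / (1 + t\<^sup>2 * l\<^sup>2)"
  let ?g' = "\<lambda>t. 2 * t * l\<^sup>2 / (1 + t\<^sup>2 * l\<^sup>2)\<^sup>2"
  let ?f = "\<lambda>x. x powr (1 - s - 1) * (1 - x) powr (s - 1)"
  let ?h = "\<lambda>t. t powr (- 2 * s - 1) * ?g t"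
  have pos: "1 + t\<^sup>2 * l\<^sup>2 > 0" for t by (metis add_pos_nonneg zero_less_one zero_le_power2 zero_le_mult_iff)
  have der: "(?g has_field_derivative ?g' t) (at t within {0<..})" for t
    using pos[of t] by (auto intro!: derivative_eq_intros simp: field_simps power2_eq_square)
  have gsq: "?g t = ?g u \<Longrightarrow> t\<^sup>2 = u\<^sup>2" for t u
    using pos[of t] pos[of u] l by (simp add: frac_eq_eq) (simp add: algebra_simps)
  have inj: "inj_on ?g {0<..}"
  proof (rule inj_onI)
    fix t u assume "t \<in> {0<..}" "u \<in> {0<..}" "?g t = ?g u"
    then show "t = u" using gsq[of t u] by (simp add: power2_eq_iff_nonneg less_imp_le)
  qed
  have img: "?g ` {0<..} = {0<..<1}"
  proof (intro equalityI subsetI)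
    fix x assume "x \<in> ?g ` {0<..}"
    then obtain t where "t > 0" "x = ?g t" by auto
    moreover have "t\<^sup>2 * l\<^sup>2 > 0" using l \<open>t > 0\<close> by simp
    ultimately show "x \<in> {0<..<1}" by simp
  next
    fix x :: real assume x: "x \<in> {0<..<1}"
    let ?t = "sqrt (x / (1 - x)) / l"
    have tl: "?t\<^sup>2 * l\<^sup>2 = x / (1 - x)" using x l by (simp add: power_divide)
    have "x = (x / (1 - x)) / (1 + x / (1 - x))" using x by (simp add: field_simps)
    then have "x = ?g ?t" by (simp only: tl)
    moreover have "?t > 0" using x l by simp
    ultimately show "x \<in> ?g ` {0<..}" by blast
  qed
  have hB: "(?f has_integral Beta (1 - s) s) {0<..<1}"
    using has_integral_Beta_real[of "1 - s" s] s by (simp add: has_integral_Icc_iff_Ioo)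
  then have aB: "?f absolutely_integrable_on {0<..<1}"
    by (intro nonnegative_absolutely_integrable_1) (auto simp: integrable_on_def)
  have "(\<lambda>t. \<bar>?g' t\<bar> * ?f (?g t)) absolutely_integrable_on {0<..} \<and>
      integral {0<..} (\<lambda>t. \<bar>?g' t\<bar> * ?f (?g t)) = Beta (1 - s) s"
    using has_absolute_integral_change_of_variables_1'[OF half_line_sets(1) der inj, of ?f] aB integral_unique[OF hB]
    unfolding img by blast
  then have hi: "((\<lambda>t. \<bar>?g' t\<bar> * ?f (?g t)) has_integral Beta (1 - s) s) {0<..}"
    unfolding has_integral_iff by (blast dest: set_lebesgue_integral_eq_integral(1))
  have eq: "\<bar>?g' t\<bar> * ?f (?g t) = 2 * l powr (- 2 * s) * ?h t" if t: "t \<in> {0<..}" for t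
  proof -
    define q where "q = t\<^sup>2 * l\<^sup>2"
    have q: "q > 0" using t l by (simp add: q_def)
    have "(q / (1 + q)) powr (- s) * (1 - q / (1 + q)) powr (s - 1)
        = q powr (- s) * (1 + q)"
    proof -
      have "1 - q / (1 + q) = 1 / (1 + q)" using q by (simp add: field_simps)
      then have "(q / (1 + q)) powr (- s) * (1 - q / (1 + q)) powr (s - 1)
          = q powr (- s) / ((1 + q) powr (- s) * (1 + q) powr (s - 1))"
        using q by (simp add: powr_divide)
      also have "(1 + q) powr (- s) * (1 + q) powr (s - 1) = (1 + q) powr (- 1)"
        by (simp only: powr_add[symmetric]) simp
      finally show ?thesis using q by (simp add: powr_minus_divide)
    qed
    moreover have "q powr (- s) = t powr (- 2 * s) * l powr (- 2 * s)"
    proof -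
      have "q = (t * l) powr 2" using t l by (simp add: q_def power_mult_distrib)
      then have "q powr (- s) = (t * l) powr (2 * (- s))" by (simp only: powr_powr)
      then show ?thesis using t l by (simp add: powr_mult)
    qed
    moreover have "\<bar>?g' t\<bar> = 2 * t * l\<^sup>2 / (1 + q)\<^sup>2" using t by (simp add: q_def)
    ultimately have "\<bar>?g' t\<bar> * ?f (?g t)
        = 2 * t * l\<^sup>2 / (1 + q)\<^sup>2 * (t powr (- 2 * s) * l powr (- 2 * s) * (1 + q))"
      by (simp add: q_def)
    also have "\<dots> = 2 * l powr (- 2 * s) * t powr (- 2 * s) * (t * l\<^sup>2) * ((1 + q) / (1 + q)\<^sup>2)"
      by simp
    also have "t * l\<^sup>2 = q / t" using t by (simp add: q_def power2_eq_square)
    also have "(1 + q) / (1 + q)\<^sup>2 = 1 / (1 + q)" using q by (simp add: power2_eq_square)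
    also have "2 * l powr (- 2 * s) * t powr (- 2 * s) * (q / t) * (1 / (1 + q))
        = 2 * l powr (- 2 * s) * ((t powr (- 2 * s) / t) * (q / (1 + q)))" by simp
    also have "t powr (- 2 * s) / t = t powr (- 2 * s - 1)" using t by (simp add: powr_diff)
    finally show ?thesis by (simp add: q_def)
  qed
  have "((\<lambda>t. (l powr (2 * s) / 2) * (2 * l powr (- 2 * s) * ?h t)) has_integral
      (l powr (2 * s) / 2) * Beta (1 - s) s) {0<..}"
    using has_integral_eq[OF eq hi] by (rule has_integral_mult_right)
  moreover have "(l powr (2 * s) / 2) * (2 * l powr (- 2 * s) * ?h t) = ?h t" for t
  proof -
    have "(l powr (2 * s) / 2) * (2 * l powr (- 2 * s) * ?h t) = (l powr (2 * s) * l powr (- 2 * s)) * ?h t"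
      by simp
    also have "l powr (2 * s) * l powr (- 2 * s) = 1" using l by (simp only: powr_add[symmetric]) simp
    finally show ?thesis by simp
  qed
  ultimately have "(?h has_integral (l powr (2 * s) / 2) * Beta (1 - s) s) {0<..}"
    by (simp only:)
  moreover have "(l powr (2 * s) / 2) * Beta (1 - s) s = l powr (2 * s) * (pi / (2 * sin (pi * s)))"
    by (simp add: Beta_reflection[OF s])
  ultimately show "(?h has_integral l powr (2 * s) * (pi / (2 * sin (pi * s)))) {0<..}" by (simp only:)
qed auto

definition ext_profile :: "real \<Rightarrow> real \<Rightarrow> real \<Rightarrow> real" where
  "ext_profile s l y = bessel_profile s (l * y)"

text \<open>
  The flux $- y^{1-2s} \partial_y \psi_s(\lambda y)$ of the scaled profile, written in the form which
  extends continuously to $y = 0$.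
\<close>

definition ext_flux :: "real \<Rightarrow> real \<Rightarrow> real \<Rightarrow> real" where
  "ext_flux s l y = d_const s * l powr (2 * s) * bessel_profile (1 - s) (l * y)"

lemma ext_profile_deriv:
  assumes s: "0 < s" "s < 1" and l: "l > 0" and y: "y > 0"
  shows "(ext_profile s l has_real_derivative - (y powr (2 * s - 1) * ext_flux s l y)) (at y)"
proof -
  have "((\<lambda>y. bessel_profile s (l * y)) has_real_derivative
      - (d_const s * (l * y) powr (2 * s - 1) * bessel_profile (1 - s) (l * y)) * l) (at y)"
    by (rule DERIV_chain2[OF bessel_profile_deriv]) (use s l y in \<open>auto intro!: derivative_eq_intros\<close>)
  moreover have "- (d_const s * (l * y) powr (2 * s - 1) * bessel_profile (1 - s) (l * y)) * l
      = - (y powr (2 * s - 1) * ext_flux s l y)"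
  proof -
    have e: "(l * y) powr (2 * s - 1) * l = l powr (2 * s) * y powr (2 * s - 1)"
      using l y by (simp add: powr_mult powr_diff)
    have "- (d_const s * (l * y) powr (2 * s - 1) * bessel_profile (1 - s) (l * y)) * l
        = - (d_const s * bessel_profile (1 - s) (l * y) * ((l * y) powr (2 * s - 1) * l))" by simp
    also have "\<dots> = - (y powr (2 * s - 1) * ext_flux s l y)" unfolding e ext_flux_def by simp
    finally show ?thesis .
  qed
  ultimately show ?thesis unfolding ext_profile_def[abs_def] by simp
qed

lemma ext_flux_deriv:
  assumes s: "0 < s" "s < 1" and l: "l > 0" and y: "y > 0"
  shows "(ext_flux s l has_real_derivative - (l\<^sup>2 * y powr (1 - 2 * s) * ext_profile s l y)) (at y)"
proof -
  have "((\<lambda>y. bessel_profile (1 - s) (l * y)) has_real_derivative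
      - (d_const (1 - s) * (l * y) powr (2 * (1 - s) - 1) * bessel_profile (1 - (1 - s)) (l * y)) * l) (at y)"
    by (rule DERIV_chain2[OF bessel_profile_deriv]) (use s l y in \<open>auto intro!: derivative_eq_intros\<close>)
  then have "(ext_flux s l has_real_derivative d_const s * l powr (2 * s) *
      (- (d_const (1 - s) * (l * y) powr (2 * (1 - s) - 1) * bessel_profile (1 - (1 - s)) (l * y)) * l)) (at y)"
    unfolding ext_flux_def[abs_def] by (rule DERIV_cmult)
  moreover have "d_const s * l powr (2 * s) *
      (- (d_const (1 - s) * (l * y) powr (2 * (1 - s) - 1) * bessel_profile (1 - (1 - s)) (l * y)) * l)
      = - (d_const s * d_const (1 - s)) * (l powr (2 * s) * l powr (1 - 2 * s) * l) * y powr (1 - 2 * s) * ext_profile s l y"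
    using l y by (simp add: powr_mult ext_profile_def)
  moreover have "l powr (2 * s) * l powr (1 - 2 * s) * l = l\<^sup>2"
    using l by (simp only: powr_add[symmetric]) (simp add: power2_eq_square)
  ultimately show ?thesis by (simp add: d_const_reflect[OF s])
qed

lemma ext_profile_bounds:
  assumes s: "0 < s"
  shows "0 \<le> ext_profile s l y" "ext_profile s l y \<le> 1" "(l * y)\<^sup>2 * ext_profile s l y \<le> 4 * s"
  using bessel_profile_nonneg[OF s] bessel_profile_le_1[OF s] bessel_profile_decay[OF s]
  by (auto simp: ext_profile_def)

lemma ext_flux_bounds:
  assumes s: "0 < s" "s < 1"
  shows "0 \<le> ext_flux s l y" "ext_flux s l y \<le> d_const s * l powr (2 * s)"
proof -
  have "0 \<le> d_const s * l powr (2 * s)" using d_const_pos[OF s] by simp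
  then show "0 \<le> ext_flux s l y" "ext_flux s l y \<le> d_const s * l powr (2 * s)"
    using bessel_profile_nonneg[of "1 - s" "l * y"] mult_left_mono[OF bessel_profile_le_1[of "1 - s" "l * y"]] s
    by (auto simp: ext_flux_def)
qed

lemma ext_profile_0: "0 < s \<Longrightarrow> ext_profile s l 0 = 1"
  by (simp add: ext_profile_def bessel_profile_0)

lemma ext_flux_0: "s < 1 \<Longrightarrow> ext_flux s l 0 = d_const s * l powr (2 * s)"
  by (simp add: ext_flux_def bessel_profile_0)

lemma ext_profile_continuous: "0 < s \<Longrightarrow> continuous_on A (ext_profile s l)"
  unfolding ext_profile_def[abs_def]
  by (rule continuous_on_compose2[OF bessel_profile_continuous[of s UNIV]]) (auto intro: continuous_intros)

lemma ext_flux_continuous: "s < 1 \<Longrightarrow> continuous_on A (ext_flux s l)"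
  unfolding ext_flux_def[abs_def]
  by (intro continuous_on_mult continuous_on_const
      continuous_on_compose2[OF bessel_profile_continuous[of "1 - s" UNIV]]) (auto intro: continuous_intros)

text \<open>
  By the first-order system the integrand is the derivative of minus profile times flux, so the
  energy is the product of the two at $0$; the product vanishes at infinity.
\<close>

lemma ext_profile_energy:
  assumes s: "0 < s" "s < 1" and l: "l > 0"
  shows "(\<integral>\<^sup>+y. ennreal (y powr (1 - 2 * s) * (l\<^sup>2 * (ext_profile s l y)\<^sup>2 +
      (y powr (2 * s - 1) * ext_flux s l y)\<^sup>2)) \<partial>lebesgue_on {0<..}) = ennreal (d_const s * l powr (2 * s))"
proof (rule half_line_nn_integral)
  let ?P = "ext_profile s l" and ?p = "ext_flux s l"
  let ?f = "\<lambda>y. y powr (1 - 2 * s) * (l\<^sup>2 * (?P y)\<^sup>2 + (y powr (2 * s - 1) * ?p y)\<^sup>2)"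
  let ?F = "\<lambda>y. - (?P y * ?p y)"
  let ?D = "d_const s * l powr (2 * s)"
  show nonneg: "0 \<le> ?f y" for y by simp
  have cP: "isCont ?P y" and cp: "isCont ?p y" for y
    using ext_profile_continuous[OF s(1), of UNIV l] ext_flux_continuous[OF s(2), of UNIV l]
    by (auto simp: continuous_on_eq_continuous_at)
  have D: "DERIV ?F y :> ?f y" if "y > 0" for y
  proof -
    have "DERIV ?F y :> - (- (y powr (2 * s - 1) * ?p y) * ?p y + - (l\<^sup>2 * y powr (1 - 2 * s) * ?P y) * ?P y)"
      using DERIV_minus[OF DERIV_mult[OF ext_profile_deriv[OF s l that] ext_flux_deriv[OF s l that]]]
      by simp
    moreover have "y powr (1 - 2 * s) * (y powr (2 * s - 1) * y powr (2 * s - 1)) = y powr (2 * s - 1)"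
      by (simp only: powr_add[symmetric]) simp
    then have e: "y powr (1 - 2 * s) * (y powr (2 * s - 1) * ?p y)\<^sup>2 = y powr (2 * s - 1) * (?p y)\<^sup>2"
      by (metis (no_types, opaque_lifting) mult.assoc power2_eq_square power_mult_distrib)
    have "- (- (y powr (2 * s - 1) * ?p y) * ?p y + - (l\<^sup>2 * y powr (1 - 2 * s) * ?P y) * ?P y) = ?f y"
      unfolding distrib_left e by (simp add: power2_eq_square)
    ultimately show ?thesis by metis
  qed
  have lim0: "(?F \<longlongrightarrow> - ?D) (at_right 0)"
  proof -
    have "isCont ?F 0" by (intro continuous_intros cP cp)
    then have "(?F \<longlongrightarrow> ?F 0) (at_right 0)"
      unfolding isCont_def by (rule filterlim_mono[OF _ order_refl at_le]) simp
    then show ?thesis by (simp add: ext_profile_0[OF s(1)] ext_flux_0[OF s(2)])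
  qed
  have lim1: "(?F \<longlongrightarrow> 0) at_top"
  proof (rule tendsto_minus_cancel_left[THEN iffD1], simp, rule tendsto_sandwich)
    show "\<forall>\<^sub>F y in at_top. 0 \<le> ?P y * ?p y"
      using ext_profile_bounds[OF s(1)] ext_flux_bounds[OF s] by simp
    show "\<forall>\<^sub>F y in at_top. ?P y * ?p y \<le> (4 * s / l\<^sup>2 * ?D) * inverse (y * y)"
      using eventually_gt_at_top[of 0]
    proof eventually_elim
      case (elim y)
      have "?P y \<le> 4 * s / l\<^sup>2 * inverse (y * y)"
        using ext_profile_bounds(3)[OF s(1), of l y] elim l by (simp add: field_simps power2_eq_square)
      then have "?P y * ?p y \<le> (4 * s / l\<^sup>2 * inverse (y * y)) * ?D"
        using ext_flux_bounds[OF s, of l y] s l by (intro mult_mono) auto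
      then show ?case by (simp add: mult_ac)
    qed
    have "((\<lambda>y::real. inverse (y * y)) \<longlongrightarrow> 0) at_top"
      by (intro tendsto_inverse_0_at_top filterlim_at_top_mult_at_top filterlim_ident)
    then show "((\<lambda>y. (4 * s / l\<^sup>2 * ?D) * inverse (y * y)) \<longlongrightarrow> 0) at_top"
      by (rule tendsto_mult_right_zero)
  qed simp
  have cont: "isCont ?f y" if "y > 0" for y
    using that by (intro continuous_intros cP cp) auto
  have "set_integrable lborel (einterval (ereal 0) \<infinity>) ?f" "(LBINT y=ereal 0..\<infinity>. ?f y) = 0 - (- ?D)"
    by (rule interval_integral_FTC_nonneg[where F = ?F]; use D cont nonneg lim0 lim1 in \<open>simp add: ereal_tendsto_simps\<close>)+
  then have "set_integrable lborel {0<..} ?f" "(LINT y:{0<..}|lborel. ?f y) = ?D"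
    by (simp_all add: interval_integral_to_infinity_eq)
  then show "(?f has_integral ?D) {0<..}"
    using set_borel_integral_eq_integral[of "{0<..}" ?f] by (simp add: has_integral_iff)
qed

section \<open>Expansion in eigenvectors and the K-functional\<close>

text \<open>
  An eigenbasis padded to a sequence: where \<open>b k\<close> is zero, \<open>lam k\<close> is an arbitrary positive
  number.
\<close>

locale eigen_sequence =
  fixes j :: "'b::{real_inner, banach} \<Rightarrow> 'a::{real_inner, banach}"
    and b :: "nat \<Rightarrow> 'b" and lam :: "nat \<Rightarrow> real"
  assumes bounded_linear_j: "bounded_linear j"
    and orthonormal: "orthonormal_seq (\<lambda>k. j (b k))"
    and dense: "closure (span (range (\<lambda>k. j (b k)))) = UNIV"
    and lam_pos: "lam k > 0"
    and eigen: "b k \<bullet> w = (lam k)\<^sup>2 * (j (b k) \<bullet> j w)"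
begin

sublocale j: bounded_linear j by (rule bounded_linear_j)

definition coeff :: "'a \<Rightarrow> nat \<Rightarrow> real" where
  "coeff u k = u \<bullet> j (b k)"

lemma coeff_diff: "coeff (u - w) k = coeff u k - coeff w k"
  by (simp add: coeff_def inner_diff_left)

lemma coeff_sq_summable: "summable (\<lambda>k. (coeff u k)\<^sup>2)"
  unfolding coeff_def by (rule Bessel[OF orthonormal])

lemma coeff_sq_sums: "(\<lambda>k. (coeff u k)\<^sup>2) sums (norm u)\<^sup>2"
  unfolding coeff_def by (rule Parseval[OF orthonormal dense])

text \<open>
  The eigenvectors are orthogonal in $V_1$ as well, of norm $\lambda_k$. Hence Bessel's inequality
  is available in both spaces.
\<close>

lemma scaled_orthonormal: "orthonormal_seq (\<lambda>k. b k /\<^sub>R lam k)"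
proof -
  have bb: "b k \<bullet> b l = (lam k)\<^sup>2 * (j (b k) \<bullet> j (b l))" for k l by (rule eigen)
  have "(b k /\<^sub>R lam k) \<bullet> (b l /\<^sub>R lam l) = 0" if "k \<noteq> l" for k l
    using orthonormal that bb[of k l] by (simp add: orthonormal_seq_def)
  moreover have "b k /\<^sub>R lam k = 0 \<or> norm (b k /\<^sub>R lam k) = 1" for k
  proof (cases "j (b k) = 0")
    case True
    then show ?thesis using bb[of k k] by simp
  next
    case False
    then have "norm (j (b k)) = 1" using orthonormal unfolding orthonormal_seq_def by blast
    then have "norm (b k) = lam k"
      using bb[of k k] lam_pos[of k] by (simp add: norm_eq_sqrt_inner)
    then show ?thesis using lam_pos[of k] by simp
  qed
  ultimately show ?thesis unfolding orthonormal_seq_def by blast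
qed

lemma inner_scaled: "w \<bullet> (b k /\<^sub>R lam k) = lam k * coeff (j w) k"
  using eigen[of k w] lam_pos[of k] by (simp add: coeff_def inner_commute power2_eq_square)

lemma V1_Bessel_finite: "finite A \<Longrightarrow> (\<Sum>k\<in>A. (lam k * coeff (j w) k)\<^sup>2) \<le> (norm w)\<^sup>2"
  using Bessel_finite[OF scaled_orthonormal, of A w] by (simp only: inner_scaled)

text \<open>
  The coefficients are multiples of those of some \<open>u\<close>, so they vanish wherever \<open>b\<close> is zero, and
  the padding does not disturb the square sums.
\<close>

lemma V1_series:
  assumes sq: "summable (\<lambda>k. (lam k * (c k * coeff u k))\<^sup>2)"
  shows "(\<lambda>k. (c k * coeff u k) *\<^sub>R b k) sums (\<Sum>k. (c k * coeff u k) *\<^sub>R b k)"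
    and "(\<lambda>k. (lam k * (c k * coeff u k))\<^sup>2) sums (norm (\<Sum>k. (c k * coeff u k) *\<^sub>R b k))\<^sup>2"
    and "coeff (j (\<Sum>k. (c k * coeff u k) *\<^sub>R b k)) l = c l * coeff u l"
proof -
  have eq: "(c k * coeff u k) *\<^sub>R b k = (lam k * (c k * coeff u k)) *\<^sub>R (b k /\<^sub>R lam k)" for k
    using lam_pos[of k] by simp
  have nrm: "(norm ((c k * coeff u k) *\<^sub>R b k))\<^sup>2 = (lam k * (c k * coeff u k))\<^sup>2" for k
  proof (cases "b k = 0")
    case True
    then show ?thesis by (simp add: coeff_def j.zero)
  next
    case False
    then have "b k /\<^sub>R lam k \<noteq> 0" using lam_pos[of k] by simp
    then have "norm (b k /\<^sub>R lam k) = 1"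
      using scaled_orthonormal unfolding orthonormal_seq_def by blast
    then show ?thesis unfolding eq by (simp only: norm_scaleR mult_1_right) (simp add: real_norm_def)
  qed
  have orth: "((c k * coeff u k) *\<^sub>R b k) \<bullet> ((c l * coeff u l) *\<^sub>R b l) = 0" if "k \<noteq> l" for k l
    unfolding eq by (rule orthonormal_seq_scaled(1)[OF scaled_orthonormal that])
  have sn: "summable (\<lambda>k. (norm ((c k * coeff u k) *\<^sub>R b k))\<^sup>2)" using sq by (simp only: nrm)
  show 1: "(\<lambda>k. (c k * coeff u k) *\<^sub>R b k) sums (\<Sum>k. (c k * coeff u k) *\<^sub>R b k)"
    by (rule summable_sums[OF orthogonal_summable[OF orth sn]])
  show "(\<lambda>k. (lam k * (c k * coeff u k))\<^sup>2) sums (norm (\<Sum>k. (c k * coeff u k) *\<^sub>R b k))\<^sup>2"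
  proof -
    have "(\<lambda>k. (norm ((c k * coeff u k) *\<^sub>R b k))\<^sup>2) sums (norm (\<Sum>k. (c k * coeff u k) *\<^sub>R b k))\<^sup>2"
      by (rule orthogonal_suminf_norm[OF _ sn]) (rule orth)
    then show ?thesis by (simp only: nrm)
  qed
  have "(\<lambda>k. (j ((c k * coeff u k) *\<^sub>R b k)) \<bullet> j (b l)) sums coeff (j (\<Sum>k. (c k * coeff u k) *\<^sub>R b k)) l"
    unfolding coeff_def by (intro bounded_linear.sums[OF bounded_linear_inner_left] j.sums) (use 1 in \<open>simp add: coeff_def\<close>)
  moreover have "(\<lambda>k. (j ((c k * coeff u k) *\<^sub>R b k)) \<bullet> j (b l)) = (\<lambda>k. if k = l then c l * coeff u l else 0)"
    by (cases "j (b l) = 0")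
      (use orthonormal in \<open>auto simp: orthonormal_seq_def fun_eq_iff j.scaleR coeff_def norm_eq_1\<close>)
  ultimately show "coeff (j (\<Sum>k. (c k * coeff u k) *\<^sub>R b k)) l = c l * coeff u l"
    using sums_single[of l "\<lambda>_. c l * coeff u l"] sums_unique2 by fastforce
qed

text \<open>
  Every \<open>v\<close> is bounded below coefficient by coefficient, by completing the square. Equality in all
  coefficients holds for $v_k = u_k/(1 + t^2\lambda_k^2)$, and this series converges in $V_1$ for
  every \<open>u\<close> because $\lambda/(1 + t^2\lambda^2)$ is bounded.
\<close>

lemma K_functional_sq:
  assumes t: "t > 0"
  shows "(\<lambda>k. t\<^sup>2 * (lam k)\<^sup>2 / (1 + t\<^sup>2 * (lam k)\<^sup>2) * (coeff u k)\<^sup>2) sums (K_functional j t u)\<^sup>2"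
proof -
  define q where "q k = t\<^sup>2 * (lam k)\<^sup>2" for k
  have q: "q k > 0" for k using t lam_pos[of k] by (simp add: q_def)
  \<comment> \<open>The factor which turns the coefficients of \<open>u\<close> into those of the optimal \<open>v\<close>.\<close>
  define c where "c k = 1 / (1 + q k)" for k
  let ?m = "\<lambda>k. q k / (1 + q k) * (coeff u k)\<^sup>2"
  let ?E = "\<lambda>v. (norm (u - j v))\<^sup>2 + t\<^sup>2 * (norm v)\<^sup>2"
  have sm: "summable ?m"
  proof (rule summable_comparison_test'[OF coeff_sq_summable[of u], of 0])
    fix k
    have "?m k \<le> 1 * (coeff u k)\<^sup>2" using q[of k] by (intro mult_right_mono) auto
    moreover have "?m k \<ge> 0" using q[of k] by (intro mult_nonneg_nonneg divide_nonneg_pos) auto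
    ultimately show "norm (?m k) \<le> (coeff u k)\<^sup>2" by (simp only: real_norm_def abs_of_nonneg mult_1)
  qed
  have lower: "suminf ?m \<le> ?E v" for v
  proof (rule suminf_le_const[OF sm])
    fix n
    have "(\<Sum>k<n. ?m k) \<le> (\<Sum>k<n. (coeff (u - j v) k)\<^sup>2 + t\<^sup>2 * (lam k * coeff (j v) k)\<^sup>2)"
    proof (rule sum_mono)
      fix k
      let ?x = "coeff (j v) k" and ?u = "coeff u k" and ?q = "q k"
      have "(?u - ?x)\<^sup>2 + ?q * ?x\<^sup>2 - ?q / (1 + ?q) * ?u\<^sup>2 = ((1 + ?q) * ?x - ?u)\<^sup>2 / (1 + ?q)"
        using q[of k] by (simp add: field_simps power2_eq_square)
      also have "\<dots> \<ge> 0" using q[of k] by simp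
      finally show "?m k \<le> (coeff (u - j v) k)\<^sup>2 + t\<^sup>2 * (lam k * coeff (j v) k)\<^sup>2"
        by (simp add: coeff_diff q_def power_mult_distrib mult_ac)
    qed
    also have "\<dots> \<le> ?E v"
      using Bessel_finite[OF orthonormal, of "{..<n}" "u - j v"] V1_Bessel_finite[of "{..<n}" v]
      by (simp add: sum.distrib sum_distrib_left[symmetric] coeff_def[symmetric] add_mono mult_left_mono)
    finally show "(\<Sum>k<n. ?m k) \<le> ?E v" .
  qed
  have "summable (\<lambda>k. (lam k * (c k * coeff u k))\<^sup>2)"
  proof (rule summable_comparison_test'[OF summable_mult[OF coeff_sq_summable[of u], of "1 / t\<^sup>2"], of 0])
    fix k
    have "(lam k * c k)\<^sup>2 * t\<^sup>2 = q k / (1 + q k)\<^sup>2" by (simp add: c_def q_def power_divide power_mult_distrib)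
    also have "q k \<le> (1 + q k)\<^sup>2" using q[of k] by (simp add: power2_eq_square algebra_simps)
    then have "q k / (1 + q k)\<^sup>2 \<le> 1" using q[of k] by (simp add: divide_le_eq_1)
    finally have "(lam k * c k)\<^sup>2 \<le> 1 / t\<^sup>2" using t by (simp add: field_simps)
    then have "(lam k * c k)\<^sup>2 * (coeff u k)\<^sup>2 \<le> 1 / t\<^sup>2 * (coeff u k)\<^sup>2" by (rule mult_right_mono) simp
    then show "norm ((lam k * (c k * coeff u k))\<^sup>2) \<le> 1 / t\<^sup>2 * (coeff u k)\<^sup>2"
      by (simp add: power_mult_distrib mult_ac)
  qed
  note V = V1_series[OF this]
  define v where "v = (\<Sum>k. (c k * coeff u k) *\<^sub>R b k)"
  have "(\<lambda>k. (coeff (u - j v) k)\<^sup>2 + t\<^sup>2 * (lam k * (c k * coeff u k))\<^sup>2) sums ?E v"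
    using V(2) unfolding v_def[symmetric] by (intro sums_add sums_mult coeff_sq_sums)
  moreover have "(coeff (u - j v) k)\<^sup>2 + t\<^sup>2 * (lam k * (c k * coeff u k))\<^sup>2 = ?m k" for k
  proof -
    have "(coeff (u - j v) k)\<^sup>2 + t\<^sup>2 * (lam k * (c k * coeff u k))\<^sup>2
        = (coeff u k)\<^sup>2 * ((1 - c k)\<^sup>2 + q k * (c k)\<^sup>2)"
      using V(3)[of k] by (simp add: v_def coeff_diff q_def power_mult_distrib algebra_simps power2_eq_square)
    also have "(1 - c k)\<^sup>2 + q k * (c k)\<^sup>2 = q k / (1 + q k)"
    proof -
      have "1 - c k = q k * c k" using q[of k] by (simp add: c_def field_simps)
      then have "(1 - c k)\<^sup>2 + q k * (c k)\<^sup>2 = (q k * c k)\<^sup>2 + q k * (c k)\<^sup>2" by simp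
      also have "\<dots> = q k * c k * ((1 + q k) * c k)" by (simp add: power2_eq_square algebra_simps)
      also have "(1 + q k) * c k = 1" using q[of k] by (simp add: c_def)
      finally show ?thesis by (simp add: c_def)
    qed
    finally show ?thesis by simp
  qed
  ultimately have Ev: "?m sums ?E v" by simp
  have "K_functional j t u = sqrt (?E v)"
    unfolding K_functional_def
  proof (rule cInf_eq_minimum)
    show "sqrt (?E v) \<in> range (\<lambda>v. sqrt (?E v))" by blast
    fix x assume "x \<in> range (\<lambda>v. sqrt (?E v))"
    then show "sqrt (?E v) \<le> x" using lower sums_unique[OF Ev] by auto
  qed
  then show ?thesis using Ev by (simp add: q_def)
qed

lemma K_integral:
  assumes s: "0 < s" "s < 1"
  shows "(\<integral>\<^sup>+t. ennreal (t powr (- 2 * s - 1) * (K_functional j t u)\<^sup>2) \<partial>lebesgue_on {0<..})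
    = ennreal (pi / (2 * sin (pi * s))) * (\<Sum>k. ennreal (lam k powr (2 * s) * (coeff u k)\<^sup>2))"
proof -
  let ?w = "\<lambda>k t. t powr (- 2 * s - 1) * (t\<^sup>2 * (lam k)\<^sup>2 / (1 + t\<^sup>2 * (lam k)\<^sup>2))"
  have "(\<integral>\<^sup>+t. ennreal (t powr (- 2 * s - 1) * (K_functional j t u)\<^sup>2) \<partial>lebesgue_on {0<..})
      = (\<integral>\<^sup>+t. (\<Sum>k. ennreal ((coeff u k)\<^sup>2) * ennreal (?w k t)) \<partial>lebesgue_on {0<..})"
  proof (rule nn_integral_cong)
    fix t :: real assume "t \<in> space (lebesgue_on {0<..})"
    then have "t > 0" by simp
    from sums_mult[OF K_functional_sq[OF this, of u], of "t powr (- 2 * s - 1)"]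
    have "(\<lambda>k. (coeff u k)\<^sup>2 * ?w k t) sums (t powr (- 2 * s - 1) * (K_functional j t u)\<^sup>2)"
      by (simp add: mult_ac)
    then have "(\<Sum>k. ennreal ((coeff u k)\<^sup>2 * ?w k t)) = ennreal (t powr (- 2 * s - 1) * (K_functional j t u)\<^sup>2)"
      by (intro sums_unique[symmetric] sums_ennreal[THEN iffD2]) auto
    then show "ennreal (t powr (- 2 * s - 1) * (K_functional j t u)\<^sup>2)
        = (\<Sum>k. ennreal ((coeff u k)\<^sup>2) * ennreal (?w k t))"
      by (simp only: ennreal_mult'[OF zero_le_power2])
  qed
  also have "\<dots> = (\<Sum>k. \<integral>\<^sup>+t. ennreal ((coeff u k)\<^sup>2) * ennreal (?w k t) \<partial>lebesgue_on {0<..})"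
  proof (rule nn_integral_suminf)
    fix k
    have "1 + t\<^sup>2 * (lam k)\<^sup>2 \<noteq> 0" for t by (metis add_pos_nonneg less_irrefl zero_less_one zero_le_power2 zero_le_mult_iff)
    then have "continuous_on {0<..} (?w k)" by (intro continuous_intros) auto
    then show "(\<lambda>t. ennreal ((coeff u k)\<^sup>2) * ennreal (?w k t)) \<in> borel_measurable (lebesgue_on {0<..})"
      using half_line_continuous_measurable by measurable
  qed
  also have "\<dots> = (\<Sum>k. ennreal ((coeff u k)\<^sup>2) * ennreal (lam k powr (2 * s) * (pi / (2 * sin (pi * s)))))"
  proof (rule suminf_cong)
    fix k
    have "1 + t\<^sup>2 * (lam k)\<^sup>2 \<noteq> 0" for t by (metis add_pos_nonneg less_irrefl zero_less_one zero_le_power2 zero_le_mult_iff)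
    then have "continuous_on {0<..} (?w k)" by (intro continuous_intros) auto
    then show "(\<integral>\<^sup>+t. ennreal ((coeff u k)\<^sup>2) * ennreal (?w k t) \<partial>lebesgue_on {0<..})
        = ennreal ((coeff u k)\<^sup>2) * ennreal (lam k powr (2 * s) * (pi / (2 * sin (pi * s))))"
      unfolding K_weight_integral[OF s lam_pos, symmetric]
      by (intro nn_integral_cmult measurable_compose[OF half_line_continuous_measurable measurable_ennreal])
  qed
  also have "\<dots> = (\<Sum>k. ennreal (pi / (2 * sin (pi * s))) * ennreal (lam k powr (2 * s) * (coeff u k)\<^sup>2))"
  proof (rule suminf_cong)
    fix k
    have "sin (pi * s) > 0" using s by (intro sin_gt_zero) auto
    then show "ennreal ((coeff u k)\<^sup>2) * ennreal (lam k powr (2 * s) * (pi / (2 * sin (pi * s))))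
        = ennreal (pi / (2 * sin (pi * s))) * ennreal (lam k powr (2 * s) * (coeff u k)\<^sup>2)"
      by (simp add: ennreal_mult[symmetric] mult_ac)
  qed
  finally show ?thesis by simp
qed

end

section \<open>Cut-off functions\<close>

text \<open>
  A continuously differentiable quadratic spline from $0$ to $1$ on the unit interval; just
  smooth enough for a test function. Its derivative is the \<open>tent\<close> of integral one.
\<close>

definition smooth_step :: "real \<Rightarrow> real" where
  "smooth_step x = 2 * (max 0 x)\<^sup>2 - 4 * (max 0 (x - 1 / 2))\<^sup>2 + 2 * (max 0 (x - 1))\<^sup>2"

definition tent :: "real \<Rightarrow> real" where
  "tent x = 4 * max 0 x - 8 * max 0 (x - 1 / 2) + 4 * max 0 (x - 1)"

lemma max_0_sq_deriv: "((\<lambda>x. (max 0 x)\<^sup>2) has_real_derivative 2 * max 0 x) (at (x :: real))"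
  unfolding DERIV_def
proof (rule LIM_zero_cancel, rule Lim_null_comparison)
  show "\<forall>\<^sub>F h in at 0. norm (((max 0 (x + h))\<^sup>2 - (max 0 x)\<^sup>2) / h - 2 * max 0 x) \<le> \<bar>h\<bar>"
    unfolding eventually_at
  proof (intro exI[of _ 1] conjI ballI impI)
    fix h :: real assume "h \<noteq> 0 \<and> dist h 0 < 1"
    then have h: "h \<noteq> 0" by simp
    \<comment> \<open>The first-order Taylor remainder is quadratic, also when \<open>x\<close> and \<open>x + h\<close> have opposite signs.\<close>
    have "\<bar>(max 0 (x + h))\<^sup>2 - (max 0 x)\<^sup>2 - 2 * max 0 x * h\<bar> \<le> h\<^sup>2"
    proof (cases "x \<ge> 0")
      case True
      show ?thesis
      proof (cases "x + h \<ge> 0")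
        case True
        then show ?thesis using \<open>x \<ge> 0\<close> by (simp add: max_def power2_eq_square algebra_simps)
      next
        case False
        then have nn: "0 \<le> x * (- 2 * h - x)" using True by (intro mult_nonneg_nonneg) auto
        have e: "h\<^sup>2 - (- x\<^sup>2 - 2 * x * h) = (h + x)\<^sup>2" "- x\<^sup>2 - 2 * x * h = x * (- 2 * h - x)"
          by (simp_all add: power2_eq_square algebra_simps)
        have "- x\<^sup>2 - 2 * x * h \<le> h\<^sup>2" using e(1) by (metis diff_ge_0_iff_ge zero_le_power2)
        moreover have "0 \<le> - x\<^sup>2 - 2 * x * h" unfolding e(2) by (rule nn)
        ultimately have "\<bar>- x\<^sup>2 - 2 * x * h\<bar> \<le> h\<^sup>2" by linarith
        then show ?thesis using True False by (simp add: max_def)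
      qed
    next
      case False
      then have "(max 0 (x + h))\<^sup>2 \<le> h\<^sup>2" by (auto simp: max_def intro: power_mono)
      then show ?thesis using False by (simp add: max_def)
    qed
    then have "\<bar>(max 0 (x + h))\<^sup>2 - (max 0 x)\<^sup>2 - 2 * max 0 x * h\<bar> / \<bar>h\<bar> \<le> h\<^sup>2 / \<bar>h\<bar>"
      by (rule divide_right_mono) simp
    also have "h\<^sup>2 / \<bar>h\<bar> = \<bar>h\<bar>" using h by (simp add: power2_eq_square abs_if)
    also have "\<bar>(max 0 (x + h))\<^sup>2 - (max 0 x)\<^sup>2 - 2 * max 0 x * h\<bar> / \<bar>h\<bar>
        = norm (((max 0 (x + h))\<^sup>2 - (max 0 x)\<^sup>2) / h - 2 * max 0 x)"
      using h by (simp add: abs_divide[symmetric] diff_divide_distrib)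
    finally show "norm (((max 0 (x + h))\<^sup>2 - (max 0 x)\<^sup>2) / h - 2 * max 0 x) \<le> \<bar>h\<bar>" .
  qed simp
  show "((\<lambda>h::real. \<bar>h\<bar>) \<longlongrightarrow> 0) (at 0)" by (rule tendsto_rabs_zero) (rule tendsto_ident_at)
qed

lemma smooth_step_deriv: "(smooth_step has_real_derivative tent x) (at x)"
proof -
  have d: "((\<lambda>x. (max 0 (x - a))\<^sup>2) has_real_derivative 2 * max 0 (x - a)) (at x)" for a
  proof -
    have "((\<lambda>x. x - a) has_real_derivative 1) (at x)" by (auto intro!: derivative_eq_intros)
    from DERIV_chain2[where f = "\<lambda>x. (max 0 x)\<^sup>2", OF max_0_sq_deriv this] show ?thesis by simp
  qed
  show ?thesis
    unfolding smooth_step_def[abs_def] tent_def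
    by (rule DERIV_cong[OF DERIV_add[OF DERIV_diff[OF DERIV_cmult[OF max_0_sq_deriv]
            DERIV_cmult[OF d[of "1 / 2"]]] DERIV_cmult[OF d[of 1]]]]) simp
qed

lemma tent_continuous: "continuous_on A tent"
  unfolding tent_def[abs_def] by (intro continuous_intros)

lemma smooth_step_continuous: "continuous_on A smooth_step"
  unfolding smooth_step_def[abs_def] by (intro continuous_intros)

lemma tent_bounds: "0 \<le> tent x" "tent x \<le> 2"
  by (auto simp: tent_def max_def)

lemma tent_eq_0: "x \<le> 0 \<or> 1 \<le> x \<Longrightarrow> tent x = 0"
  by (auto simp: tent_def max_def)

lemma smooth_step_eq: "x \<le> 0 \<Longrightarrow> smooth_step x = 0" "1 \<le> x \<Longrightarrow> smooth_step x = 1"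
  by (auto simp: smooth_step_def max_def power2_eq_square algebra_simps)

lemma smooth_step_mono: "x \<le> y \<Longrightarrow> smooth_step x \<le> smooth_step y"
  by (rule DERIV_nonneg_imp_nondecreasing) (use smooth_step_deriv tent_bounds in blast)+

lemma smooth_step_bounds: "0 \<le> smooth_step x" "smooth_step x \<le> 1"
  using smooth_step_mono[of "min x 0" x] smooth_step_mono[of x "max x 1"]
    smooth_step_eq(1)[of "min x 0"] smooth_step_eq(2)[of "max x 1"] by auto

lemma rising_edge_integral:
  assumes N: "N > 0"
  shows "integrable (lebesgue_on {0<..}) (\<lambda>y. N * tent (N * y - 1))"
    and "(\<integral>y. N * tent (N * y - 1) \<partial>lebesgue_on {0<..}) = 1"
proof -
  let ?f = "\<lambda>y. N * tent (N * y - 1)"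
  have "(?f has_integral (smooth_step (N * (2 / N) - 1) - smooth_step (N * 0 - 1))) {0..2 / N}"
  proof (rule fundamental_theorem_of_calculus)
    show "((\<lambda>y. smooth_step (N * y - 1)) has_vector_derivative ?f y) (at y within {0..2 / N})" for y
      unfolding has_real_derivative_iff_has_vector_derivative[symmetric]
      by (rule DERIV_subset[OF DERIV_chain2[OF smooth_step_deriv, THEN DERIV_cong]])
        (auto intro!: derivative_eq_intros)
  qed (use N in simp)
  then have "(?f has_integral 1) {0..2 / N}" using N by (simp add: smooth_step_eq)
  then have "(?f has_integral 1) {0..}"
  proof (rule has_integral_on_superset)
    fix y assume "y \<notin> {0..2 / N}"
    then consider "y < 0" | "y > 2 / N" by fastforce
    then have "N * y - 1 \<le> 0 \<or> 1 \<le> N * y - 1"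
    proof cases
      case 1
      then show ?thesis using N mult_pos_neg[of N y] by linarith
    next
      case 2
      then show ?thesis using N by (simp add: field_simps)
    qed
    then show "?f y = 0" by (simp add: tent_eq_0)
  qed auto
  then have hi: "(?f has_integral 1) {0<..}"
    by (rule has_integral_spike_set_eq[THEN iffD1, rotated -1])
      (auto intro: negligible_subset[of "{0}"])
  then have "?f absolutely_integrable_on {0<..}"
    by (intro nonnegative_absolutely_integrable_1) (use N tent_bounds in \<open>auto simp: integrable_on_def\<close>)
  then show i: "integrable (lebesgue_on {0<..}) ?f"
    by (rule absolutely_integrable_imp_integrable) simp
  show "(\<integral>y. ?f y \<partial>lebesgue_on {0<..}) = 1"
    by (rule trans[OF lebesgue_integral_eq_integral[OF i half_line_sets(1)] integral_unique[OF hi]])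
qed

text \<open>
  Rises on $[1/N, 2/N]$ and falls on $[N, N + 1]$. For $N \ge 2$ the two edges do not overlap.
\<close>

definition cutoff :: "real \<Rightarrow> real \<Rightarrow> real" where
  "cutoff N y = smooth_step (N * y - 1) * smooth_step (N + 1 - y)"

definition falling_edge :: "real \<Rightarrow> real \<Rightarrow> real" where
  "falling_edge N y = smooth_step (N * y - 1) * tent (N + 1 - y)"

lemma cutoff_bounds: "0 \<le> cutoff N y" "cutoff N y \<le> 1"
  unfolding cutoff_def using smooth_step_bounds by (auto intro: mult_le_one)

lemma falling_edge_bounds: "\<bar>falling_edge N y\<bar> \<le> 2"
proof -
  have "smooth_step (N * y - 1) * tent (N + 1 - y) \<le> 1 * 2"
    using smooth_step_bounds tent_bounds by (intro mult_mono) auto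
  then show ?thesis
    unfolding falling_edge_def using smooth_step_bounds tent_bounds by (simp add: abs_mult)
qed

lemma cutoff_continuous: "continuous_on A (cutoff N)" "continuous_on A (falling_edge N)"
  unfolding cutoff_def[abs_def] falling_edge_def[abs_def]
  by (intro continuous_on_mult continuous_on_compose2[OF smooth_step_continuous[of UNIV]]
      continuous_on_compose2[OF tent_continuous[of UNIV]]; auto intro!: continuous_intros)+

lemma cutoff_deriv:
  assumes N: "N \<ge> 2"
  shows "(cutoff N has_real_derivative N * tent (N * y - 1) - falling_edge N y) (at y)"
proof -
  have D: "(cutoff N has_real_derivative
      (tent (N * y - 1) * N) * smooth_step (N + 1 - y) + (tent (N + 1 - y) * (- 1)) * smooth_step (N * y - 1)) (at y)"
    unfolding cutoff_def[abs_def]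
    by (intro DERIV_mult DERIV_chain2[OF smooth_step_deriv]) (auto intro!: derivative_eq_intros)
  have e: "tent (N * y - 1) * N * smooth_step (N + 1 - y) = N * tent (N * y - 1)"
  proof (cases "y \<le> 1")
    case True
    then show ?thesis using N by (simp add: smooth_step_eq)
  next
    case False
    then have "N * 1 \<le> N * y" using N by (intro mult_left_mono) auto
    then have "1 \<le> N * y - 1" using N unfolding mult_1_right by linarith
    then show ?thesis by (simp add: tent_eq_0)
  qed
  show ?thesis
    by (rule DERIV_cong[OF D]) (simp only: e falling_edge_def, simp)
qed

text \<open>
  The flux times a cut-off is an admissible test function, although the flux need not be
  differentiable at $0$: the cut-off vanishes near $(-\infty, 0]$.
\<close>

lemma cutoff_flux_test_function:
  assumes s: "0 < s" "s < 1" and l: "l > 0" and N: "N \<ge> 2"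
  defines "\<eta> \<equiv> \<lambda>y. cutoff N y * ext_flux s l y"
    and "\<eta>' \<equiv> \<lambda>y. (N * tent (N * y - 1) - falling_edge N y) * ext_flux s l y
      - cutoff N y * (l\<^sup>2 * y powr (1 - 2 * s) * ext_profile s l y)"
  shows "(\<eta> has_real_derivative \<eta>' y) (at y)"
    and "continuous_on UNIV \<eta>'"
    and "y \<notin> {1 / N..N + 1} \<Longrightarrow> \<eta> y = 0"
proof -
  have zero: "cutoff N y = 0" "falling_edge N y = 0" "tent (N * y - 1) = 0" if "y < 1 / N" for y
  proof -
    have "N * y \<le> 1" using that N by (simp add: field_simps)
    then show "cutoff N y = 0" "falling_edge N y = 0" "tent (N * y - 1) = 0"
      by (auto simp: cutoff_def falling_edge_def smooth_step_eq tent_eq_0)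
  qed
  have N': "1 / N > 0" using N by simp
  show "(\<eta> has_real_derivative \<eta>' y) (at y)"
  proof (cases "y > 0")
    case True
    show ?thesis unfolding \<eta>_def
      by (rule DERIV_cong[OF DERIV_mult[OF cutoff_deriv[OF N] ext_flux_deriv[OF s l True]]]) (simp add: \<eta>'_def)
  next
    case False
    then have y: "y < 1 / N" using N' by linarith
    have "((\<lambda>_. 0) has_real_derivative \<eta>' y) (at y)"
      using zero[OF y] by (simp add: \<eta>'_def)
    then show ?thesis
    proof (rule DERIV_cong_ev[OF refl _ refl, THEN iffD1, rotated])
      have "\<forall>\<^sub>F x in nhds y. x < 1 / N" using y by (simp add: eventually_nhds) (intro exI[of _ "{..<1 / N}"], auto)
      then show "\<forall>\<^sub>F x in nhds y. 0 = \<eta> x" by eventually_elim (simp add: \<eta>_def zero)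
    qed
  qed
  have "continuous_on ({0<..} \<union> {..<1 / N}) \<eta>'"
  proof (rule continuous_on_open_Un)
    show "continuous_on {0<..} \<eta>'"
      unfolding \<eta>'_def
      by (intro continuous_on_diff continuous_on_mult cutoff_continuous ext_flux_continuous[OF s(2)]
          ext_profile_continuous[OF s(1)] continuous_on_const continuous_on_compose2[OF tent_continuous[of UNIV]])
        (auto intro!: continuous_intros)
    have "continuous_on {..<1 / N} (\<lambda>_. 0 :: real)" by simp
    then show "continuous_on {..<1 / N} \<eta>'"
      by (rule continuous_on_eq) (simp add: \<eta>'_def zero)
  qed auto
  moreover have "x < 1 / N" if "\<not> 0 < x" for x using that N' by linarith
  then have "{0<..} \<union> {..<1 / N} = UNIV" by auto
  ultimately show "continuous_on UNIV \<eta>'" by simp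
  show "\<eta> y = 0" if "y \<notin> {1 / N..N + 1}"
  proof (cases "y < 1 / N")
    case False
    then have "N + 1 - y \<le> 0" using that by auto
    then show ?thesis by (simp add: \<eta>_def cutoff_def smooth_step_eq)
  qed (simp add: \<eta>_def zero)
qed

section \<open>The one-dimensional lower bound\<close>

lemma half_line_weighted_integrable:
  assumes "h \<in> borel_measurable (lebesgue_on {0<..})"
    and "(\<integral>\<^sup>+y. ennreal (y powr a * (h y)\<^sup>2) \<partial>lebesgue_on {0<..}) < \<infinity>"
  shows "integrable (lebesgue_on {0<..}) (\<lambda>y. y powr a * (h y)\<^sup>2)"
proof (rule integrableI_nonneg)
  have "(\<lambda>y. y powr a) \<in> borel_measurable (lebesgue_on {0<..})"
    by (rule half_line_continuous_measurable) (auto intro!: continuous_intros)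
  then show "(\<lambda>y. y powr a * (h y)\<^sup>2) \<in> borel_measurable (lebesgue_on {0<..})"
    using assms(1) by measurable
qed (use assms(2) in auto)

text \<open>
  The derivatives of the rising edges are an approximate identity at $0$. This is how the weak
  formulation recovers the trace.
\<close>

lemma rising_edge_limit:
  fixes h :: "real \<Rightarrow> real"
  assumes h: "continuous_on {0..} h"
    and int: "\<And>n. integrable (lebesgue_on {0<..}) (\<lambda>y. (real n + 2) * tent ((real n + 2) * y - 1) * h y)"
  shows "(\<lambda>n. \<integral>y. (real n + 2) * tent ((real n + 2) * y - 1) * h y \<partial>lebesgue_on {0<..}) \<longlonglongrightarrow> h 0"
proof (rule LIMSEQ_I)
  fix r :: real assume r: "0 < r"
  let ?L = "lebesgue_on {0<..} :: real measure"
  let ?A = "\<lambda>n y. (real n + 2) * tent ((real n + 2) * y - 1)"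
  have "continuous (at 0 within {0..}) h" using h by (simp add: continuous_on_eq_continuous_within)
  then obtain d where d: "d > 0" "\<And>y. y \<ge> 0 \<Longrightarrow> dist y 0 < d \<Longrightarrow> dist (h y) (h 0) < r / 2"
    unfolding continuous_within_eps_delta using half_gt_zero[OF r] by (metis atLeast_iff)
  obtain n0 :: nat where n0: "2 / d < real n0" using reals_Archimedean2 by blast
  have "norm ((\<integral>y. ?A n y * h y \<partial>?L) - h 0) < r" if n: "n \<ge> n0" for n
  proof -
    have iA: "integrable ?L (?A n)" "(\<integral>y. ?A n y \<partial>?L) = 1"
      using rising_edge_integral[of "real n + 2"] by auto
    have pt: "\<bar>?A n y * h y - ?A n y * h 0\<bar> \<le> ?A n y * (r / 2)" if y: "y > 0" for y
    proof (cases "1 \<le> (real n + 2) * y - 1")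
      case True
      then show ?thesis by (simp add: tent_eq_0)
    next
      case False
      have "real n0 * d > 2" using n0 d(1) by (simp add: field_simps)
      moreover have "(real n + 2) * d \<ge> real n0 * d" using n d(1) by (intro mult_right_mono) auto
      ultimately have "(real n + 2) * y < (real n + 2) * d" using False by linarith
      then have "y < d" by (simp add: mult_less_cancel_left_pos)
      then have "\<bar>h y - h 0\<bar> \<le> r / 2" using d(2)[of y] y by (simp add: dist_real_def)
      moreover have "?A n y \<ge> 0" using tent_bounds by simp
      ultimately have "?A n y * \<bar>h y - h 0\<bar> \<le> ?A n y * (r / 2)" by (intro mult_left_mono)
      moreover have "\<bar>?A n y * h y - ?A n y * h 0\<bar> = ?A n y * \<bar>h y - h 0\<bar>"
        using \<open>?A n y \<ge> 0\<close> by (simp only: right_diff_distrib[symmetric] abs_mult[of "?A n y"] abs_of_nonneg)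
      ultimately show ?thesis by simp
    qed
    have i2: "integrable ?L (\<lambda>y. ?A n y * h 0)" using iA(1) by simp
    have i3: "integrable ?L (\<lambda>y. ?A n y * (r / 2))" using iA(1) by (rule integrable_mult_left)
    have v2: "(\<integral>y. ?A n y * h 0 \<partial>?L) = h 0" and v3: "(\<integral>y. ?A n y * (r / 2) \<partial>?L) = r / 2"
      unfolding Bochner_Integration.integral_mult_left_zero iA(2) by simp_all
    have "(\<integral>y. ?A n y * h y \<partial>?L) - h 0 = (\<integral>y. ?A n y * h y - ?A n y * h 0 \<partial>?L)"
      unfolding Bochner_Integration.integral_diff[OF int i2] v2 ..
    moreover have "norm (\<integral>y. ?A n y * h y - ?A n y * h 0 \<partial>?L) \<le> (\<integral>y. ?A n y * (r / 2) \<partial>?L)"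
      by (rule Bochner_Integration.integral_norm_bound_integral[OF Bochner_Integration.integrable_diff[OF int i2] i3])
        (use pt in simp)
    ultimately show ?thesis using r unfolding v3 by simp
  qed
  then show "\<exists>n0. \<forall>n\<ge>n0. norm ((\<integral>y. ?A n y * h y \<partial>?L) - h 0) < r" by blast
qed

text \<open>
  With $p$ the flux and $a$ the exponent $1 - 2s$ of the weight, $y^{-a} p$ is minus the derivative
  of the profile, so products with the flux are dominated by energies.
\<close>

lemma weighted_AM_GM:
  fixes a x y :: real
  shows "y > 0 \<Longrightarrow> 2 * \<bar>p * f\<bar> \<le> y powr a * (y powr (- a) * p)\<^sup>2 + y powr a * f\<^sup>2"
proof -
  assume y: "y > 0"
  have "p = y powr a * (y powr (- a) * p)"
    using y by (simp add: mult.assoc[symmetric] powr_add[symmetric])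
  then have "2 * \<bar>p * f\<bar> = y powr a * (2 * (\<bar>y powr (- a) * p\<bar> * \<bar>f\<bar>))"
    by (metis abs_mult abs_of_nonneg mult.assoc mult.left_commute powr_ge_zero)
  also have "\<dots> \<le> y powr a * ((y powr (- a) * p)\<^sup>2 + f\<^sup>2)"
    using sum_squares_bound[of "\<bar>y powr (- a) * p\<bar>" "\<bar>f\<bar>"] by (intro mult_left_mono) auto
  finally show ?thesis by (simp add: distrib_left)
qed

text \<open>
  Dirichlet's principle on the half-line. With $P$ the profile, $p$ its flux and $q = y^{-\alpha} p$,
  testing the weak derivative with $\chi p$ and using $p' = - \lambda^2 y^\alpha P$ gives
  $\int \chi' p f = \int \chi y^\alpha (\lambda^2 P f - q g)$. As the cut-off $\chi$ tends to one, the left side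
  tends to $p(0) c(0)$. Multiply by $2 c(0)$: pointwise,
  $2 c(0) (\lambda^2 P f - q g) \le \lambda^2 f^2 + g^2 + c(0)^2 (\lambda^2 P^2 + q^2)$, and the energy of $P$
  equals $p(0) = d_s \lambda^{2s}$, so one of the two copies of $p(0) c(0)^2$ on the left is absorbed.
\<close>

lemma scalar_extension_lower_bound:
  fixes f g c :: "real \<Rightarrow> real"
  assumes s: "0 < s" "s < 1" and l: "l > 0"
    and f: "f \<in> borel_measurable (lebesgue_on {0<..})"
      "(\<integral>\<^sup>+y. ennreal (y powr (1 - 2 * s) * (f y)\<^sup>2) \<partial>lebesgue_on {0<..}) < \<infinity>"
    and g: "g \<in> borel_measurable (lebesgue_on {0<..})"
      "(\<integral>\<^sup>+y. ennreal (y powr (1 - 2 * s) * (g y)\<^sup>2) \<partial>lebesgue_on {0<..}) < \<infinity>"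
    and weak: "\<And>\<eta> \<eta>' K. (\<And>y. (\<eta> has_real_derivative \<eta>' y) (at y)) \<Longrightarrow> continuous_on UNIV \<eta>' \<Longrightarrow> compact K \<Longrightarrow>
      K \<subseteq> {0<..} \<Longrightarrow> (\<And>y. y \<notin> K \<Longrightarrow> \<eta> y = 0) \<Longrightarrow>
      (\<integral>y. \<eta>' y * f y \<partial>lebesgue_on {0<..}) = - (\<integral>y. \<eta> y * g y \<partial>lebesgue_on {0<..})"
    and c: "continuous_on {0..} c" "AE y in lebesgue_on {0<..}. c y = f y"
  shows "ennreal (d_const s * l powr (2 * s) * (c 0)\<^sup>2)
    \<le> (\<integral>\<^sup>+y. ennreal (y powr (1 - 2 * s) * (l\<^sup>2 * (f y)\<^sup>2 + (g y)\<^sup>2)) \<partial>lebesgue_on {0<..})"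
proof -
  let ?L = "lebesgue_on {0<..} :: real measure"
  let ?w = "\<lambda>y::real. y powr (1 - 2 * s)"
  let ?P = "ext_profile s l" and ?p = "ext_flux s l"
  let ?q = "\<lambda>y. y powr (2 * s - 1) * ?p y"
  let ?a = "c 0" and ?D = "d_const s * l powr (2 * s)"
  let ?A = "\<lambda>n y. (real n + 2) * tent ((real n + 2) * y - 1)"
  let ?B = "\<lambda>n. falling_edge (real n + 2)" and ?X = "\<lambda>n. cutoff (real n + 2)"
  note meas = half_line_continuous_measurable
  have mP: "?P \<in> borel_measurable ?L" and mp: "?p \<in> borel_measurable ?L"
    using ext_profile_continuous[OF s(1)] ext_flux_continuous[OF s(2)] by (auto intro!: meas)
  have mw: "?w \<in> borel_measurable ?L" and mw': "(\<lambda>y. y powr (2 * s - 1)) \<in> borel_measurable ?L"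
    by (auto intro!: meas continuous_intros)
  have mq: "?q \<in> borel_measurable ?L" using mw' mp by measurable
  have mX: "?X n \<in> borel_measurable ?L" and mB: "?B n \<in> borel_measurable ?L" for n
    by (intro meas cutoff_continuous)+
  have mA: "?A n \<in> borel_measurable ?L" for n
    by (intro meas continuous_on_mult continuous_on_const continuous_on_compose2[OF tent_continuous[of UNIV]])
      (auto intro!: continuous_intros)
  \<comment> \<open>The energy of the minimizer, and of the competitor, as Bochner integrals.\<close>
  have hD: "has_bochner_integral ?L (\<lambda>y. ?w y * (l\<^sup>2 * (?P y)\<^sup>2 + (?q y)\<^sup>2)) ?D"
  proof (rule has_bochner_integral_nn_integral)
    show "(\<lambda>y. ?w y * (l\<^sup>2 * (?P y)\<^sup>2 + (?q y)\<^sup>2)) \<in> borel_measurable ?L"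
      using mw mP mq by measurable
    show "0 \<le> ?D" using d_const_pos[OF s] by simp
  qed (use ext_profile_energy[OF s l] in auto)
  have iD: "integrable ?L (\<lambda>y. ?w y * (l\<^sup>2 * (?P y)\<^sup>2 + (?q y)\<^sup>2))"
    using hD by (simp add: has_bochner_integral_iff)
  have iq: "integrable ?L (\<lambda>y. ?w y * (?q y)\<^sup>2)"
    by (rule Bochner_Integration.integrable_bound[OF iD]) (use mw mq in \<open>measurable, auto intro!: AE_I2 mult_left_mono\<close>)
  have iP: "integrable ?L (\<lambda>y. ?w y * (?P y)\<^sup>2)"
  proof -
    have "integrable ?L (\<lambda>y. l\<^sup>2 * (?w y * (?P y)\<^sup>2))"
      by (rule Bochner_Integration.integrable_bound[OF iD])
        (use mw mP in \<open>measurable, auto intro!: AE_I2 simp: distrib_left mult_ac\<close>)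
    then show ?thesis using l by simp
  qed
  have if2: "integrable ?L (\<lambda>y. ?w y * (f y)\<^sup>2)" and ig2: "integrable ?L (\<lambda>y. ?w y * (g y)\<^sup>2)"
    using half_line_weighted_integrable f g by blast+
  let ?e = "\<lambda>y. ?w y * (l\<^sup>2 * (f y)\<^sup>2 + (g y)\<^sup>2)"
  have ie: "integrable ?L ?e"
  proof -
    have "integrable ?L (\<lambda>y. l\<^sup>2 * (?w y * (f y)\<^sup>2) + ?w y * (g y)\<^sup>2)"
      using if2 ig2 by (intro Bochner_Integration.integrable_add integrable_mult_right)
    then show ?thesis by (simp add: distrib_left mult_ac)
  qed
  define E where "E = (\<integral>y. ?e y \<partial>?L)"
  have pf: "2 * \<bar>?p y * f y\<bar> \<le> ?w y * (?q y)\<^sup>2 + ?w y * (f y)\<^sup>2" if "y > 0" for y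
    using weighted_AM_GM[OF that, of "?p y" "f y" "1 - 2 * s"] by simp
  have pg: "2 * \<bar>?p y * g y\<bar> \<le> ?w y * (?q y)\<^sup>2 + ?w y * (g y)\<^sup>2" if "y > 0" for y
    using weighted_AM_GM[OF that, of "?p y" "g y" "1 - 2 * s"] by simp
  have ipf: "integrable ?L (\<lambda>y. ?p y * f y)"
    by (rule Bochner_Integration.integrable_bound[OF Bochner_Integration.integrable_add[OF iq if2]])
      (use mp f(1) pf in \<open>measurable, force intro!: AE_I2\<close>)
  have ipg: "integrable ?L (\<lambda>y. ?p y * g y)"
    by (rule Bochner_Integration.integrable_bound[OF Bochner_Integration.integrable_add[OF iq ig2]])
      (use mp g(1) pg in \<open>measurable, force intro!: AE_I2\<close>)
  have iPf: "integrable ?L (\<lambda>y. ?w y * ?P y * f y)"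
  proof (rule Bochner_Integration.integrable_bound[OF Bochner_Integration.integrable_add[OF iP if2]])
    show "(\<lambda>y. ?w y * ?P y * f y) \<in> borel_measurable ?L" using mw mP f(1) by measurable
    have "\<bar>?w y * ?P y * f y\<bar> \<le> ?w y * (?P y)\<^sup>2 + ?w y * (f y)\<^sup>2" for y
    proof -
      have "\<bar>?P y * f y\<bar> \<le> (?P y)\<^sup>2 + (f y)\<^sup>2"
        using sum_squares_bound[of "\<bar>?P y\<bar>" "\<bar>f y\<bar>"] abs_mult[of "?P y" "f y"]
          zero_le_power2[of "?P y"] zero_le_power2[of "f y"] by simp
      then have "?w y * \<bar>?P y * f y\<bar> \<le> ?w y * ((?P y)\<^sup>2 + (f y)\<^sup>2)" by (intro mult_left_mono) auto
      then show ?thesis by (simp add: abs_mult distrib_left mult.assoc)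
    qed
    then show "AE y in ?L. norm (?w y * ?P y * f y) \<le> norm (?w y * (?P y)\<^sup>2 + ?w y * (f y)\<^sup>2)" by simp
  qed
  have bounded_mult: "integrable ?L (\<lambda>y. k y * h y)"
    if "integrable ?L h" "k \<in> borel_measurable ?L" "\<And>y. \<bar>k y\<bar> \<le> C" for h k :: "real \<Rightarrow> real" and C
  proof (rule Bochner_Integration.integrable_bound[OF integrable_mult_right[OF that(1), of C]])
    show "(\<lambda>y. k y * h y) \<in> borel_measurable ?L" using that(1,2) by measurable
    have "C \<ge> 0" using that(3)[of 0] by linarith
    then show "AE y in ?L. norm (k y * h y) \<le> norm (C * h y)"
      using that(3) by (auto simp: abs_mult intro!: mult_right_mono)
  qed
  have iApf: "integrable ?L (\<lambda>y. ?A n y * (?p y * f y))" for n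
  proof (rule bounded_mult[OF ipf mA])
    fix y :: real
    have "(real n + 2) * tent ((real n + 2) * y - 1) \<le> (real n + 2) * 2"
      by (intro mult_left_mono tent_bounds) simp
    then show "\<bar>?A n y\<bar> \<le> (real n + 2) * 2"
      using tent_bounds(1) by (simp add: abs_mult)
  qed
  have iBpf: "integrable ?L (\<lambda>y. ?B n y * (?p y * f y))" for n
    by (rule bounded_mult[OF ipf mB falling_edge_bounds])
  have Xabs: "\<bar>?X n y\<bar> \<le> 1" for n y using cutoff_bounds[of "real n + 2" y] by simp
  have iXpg: "integrable ?L (\<lambda>y. ?X n y * (?p y * g y))" for n
    by (rule bounded_mult[OF ipg mX Xabs])
  have iXPf: "integrable ?L (\<lambda>y. ?X n y * (?w y * ?P y * f y))" for n
    by (rule bounded_mult[OF iPf mX Xabs])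
  \<comment> \<open>Test the weak derivative with the flux of the minimizer, cut off near 0 and near infinity.\<close>
  have main: "2 * ?a * (\<integral>y. ?A n y * (?p y * f y) \<partial>?L) \<le> E + ?a\<^sup>2 * ?D + 2 * ?a * (\<integral>y. ?B n y * (?p y * f y) \<partial>?L)" for n
  proof -
    let ?\<eta> = "\<lambda>y. ?X n y * ?p y"
    let ?\<eta>' = "\<lambda>y. (?A n y - ?B n y) * ?p y - ?X n y * (l\<^sup>2 * ?w y * ?P y)"
    have N: "real n + 2 \<ge> 2" by simp
    note T = cutoff_flux_test_function[OF s l N]
    have sub: "{1 / (real n + 2)..real n + 2 + 1} \<subseteq> {0<..}"
      by (auto intro: less_le_trans[of 0 "1 / (real n + 2)"])
    have "(\<integral>y. ?\<eta>' y * f y \<partial>?L) = - (\<integral>y. ?\<eta> y * g y \<partial>?L)"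
      by (rule weak[OF T(1) T(2) compact_Icc sub T(3)])
    moreover have "(\<integral>y. ?\<eta>' y * f y \<partial>?L) = (\<integral>y. ?A n y * (?p y * f y) - ?B n y * (?p y * f y)
        - l\<^sup>2 * (?X n y * (?w y * ?P y * f y)) \<partial>?L)"
      by (intro Bochner_Integration.integral_cong refl) (simp add: algebra_simps)
    moreover have "\<dots> = (\<integral>y. ?A n y * (?p y * f y) \<partial>?L) - (\<integral>y. ?B n y * (?p y * f y) \<partial>?L)
        - l\<^sup>2 * (\<integral>y. ?X n y * (?w y * ?P y * f y) \<partial>?L)"
      unfolding Bochner_Integration.integral_diff[OF Bochner_Integration.integrable_diff[OF iApf[of n] iBpf[of n]]
          integrable_mult_right[OF iXPf[of n]]]
        Bochner_Integration.integral_diff[OF iApf[of n] iBpf[of n]] integral_mult_right_zero ..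
    moreover have "(\<integral>y. ?\<eta> y * g y \<partial>?L) = (\<integral>y. ?X n y * (?p y * g y) \<partial>?L)"
      by (intro Bochner_Integration.integral_cong refl) (simp add: algebra_simps)
    ultimately have id: "(\<integral>y. ?A n y * (?p y * f y) \<partial>?L) = (\<integral>y. ?B n y * (?p y * f y) \<partial>?L)
        + l\<^sup>2 * (\<integral>y. ?X n y * (?w y * ?P y * f y) \<partial>?L) - (\<integral>y. ?X n y * (?p y * g y) \<partial>?L)"
      by linarith
    have "2 * ?a * (l\<^sup>2 * (\<integral>y. ?X n y * (?w y * ?P y * f y) \<partial>?L) - (\<integral>y. ?X n y * (?p y * g y) \<partial>?L))
        = (\<integral>y. 2 * ?a * (l\<^sup>2 * (?X n y * (?w y * ?P y * f y)) - ?X n y * (?p y * g y)) \<partial>?L)"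
      unfolding integral_mult_right_zero
        Bochner_Integration.integral_diff[OF integrable_mult_right[OF iXPf[of n]] iXpg[of n]] ..
    also have "\<dots> \<le> (\<integral>y. ?e y + ?a\<^sup>2 * (?w y * (l\<^sup>2 * (?P y)\<^sup>2 + (?q y)\<^sup>2)) \<partial>?L)"
    proof (rule integral_mono)
      show "integrable ?L (\<lambda>y. 2 * ?a * (l\<^sup>2 * (?X n y * (?w y * ?P y * f y)) - ?X n y * (?p y * g y)))"
        using iXPf[of n] iXpg[of n] by (intro integrable_mult_right Bochner_Integration.integrable_diff)
      show "integrable ?L (\<lambda>y. ?e y + ?a\<^sup>2 * (?w y * (l\<^sup>2 * (?P y)\<^sup>2 + (?q y)\<^sup>2)))"
        using ie iD by (intro Bochner_Integration.integrable_add integrable_mult_right)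
      fix y assume "y \<in> space ?L"
      then have y: "y > 0" by simp
      have pq: "?p y = ?w y * ?q y" using y by (simp add: mult.assoc[symmetric] powr_add[symmetric])
      let ?u = "2 * ?a * (l\<^sup>2 * ?P y * f y - ?q y * g y)"
      have u: "?u \<le> l\<^sup>2 * (f y)\<^sup>2 + (g y)\<^sup>2 + ?a\<^sup>2 * (l\<^sup>2 * (?P y)\<^sup>2 + (?q y)\<^sup>2)"
      proof -
        have "0 \<le> l\<^sup>2 * (f y - ?a * ?P y)\<^sup>2 + (g y + ?a * ?q y)\<^sup>2" by simp
        then show ?thesis by (simp add: power2_eq_square algebra_simps)
      qed
      have r: "0 \<le> l\<^sup>2 * (f y)\<^sup>2 + (g y)\<^sup>2 + ?a\<^sup>2 * (l\<^sup>2 * (?P y)\<^sup>2 + (?q y)\<^sup>2)" (is "0 \<le> ?r") by simp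
      have X: "?X n y * ?u \<le> ?r"
      proof (cases "?u \<ge> 0")
        case True
        then have "?X n y * ?u \<le> 1 * ?u" using cutoff_bounds by (intro mult_right_mono) auto
        then show ?thesis using u by linarith
      next
        case False
        then have "?u \<le> 0" by linarith
        then have "?X n y * ?u \<le> 0" by (rule mult_nonneg_nonpos[OF cutoff_bounds(1)])
        then show ?thesis using r by linarith
      qed
      have "2 * ?a * (l\<^sup>2 * (?X n y * (?w y * ?P y * f y)) - ?X n y * (?p y * g y)) = ?w y * (?X n y * ?u)"
        by (subst pq) (simp only: right_diff_distrib mult_ac)
      also have "\<dots> \<le> ?w y * ?r" using X by (intro mult_left_mono) auto
      also have "\<dots> = ?e y + ?a\<^sup>2 * (?w y * (l\<^sup>2 * (?P y)\<^sup>2 + (?q y)\<^sup>2))"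
        by (simp only: distrib_left mult_ac)
      finally show "2 * ?a * (l\<^sup>2 * (?X n y * (?w y * ?P y * f y)) - ?X n y * (?p y * g y))
          \<le> ?e y + ?a\<^sup>2 * (?w y * (l\<^sup>2 * (?P y)\<^sup>2 + (?q y)\<^sup>2))" .
    qed
    also have "\<dots> = E + ?a\<^sup>2 * ?D"
      unfolding E_def Bochner_Integration.integral_add[OF ie integrable_mult_right[OF iD]] integral_mult_right_zero
      using hD by (simp only: has_bochner_integral_iff)
    finally show ?thesis unfolding id by (simp only: distrib_left right_diff_distrib)
  qed
  have limA: "(\<lambda>n. \<integral>y. ?A n y * (?p y * f y) \<partial>?L) \<longlonglongrightarrow> ?D * ?a"
  proof -
    have hc: "continuous_on {0..} (\<lambda>y. ?p y * c y)"
      by (intro continuous_on_mult ext_flux_continuous s c)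
    then have mh: "(\<lambda>y. ?p y * c y) \<in> borel_measurable ?L"
      by (intro meas) (rule continuous_on_subset, auto)
    have ae: "AE y in ?L. ?A n y * (?p y * f y) = ?A n y * (?p y * c y)" for n
      using c(2) by eventually_elim simp
    have ic: "integrable ?L (\<lambda>y. ?A n y * (?p y * c y))" for n
      by (rule integrable_cong_AE_imp[OF iApf _ ae]) (use mA[of n] mh in measurable)
    have "(\<integral>y. ?A n y * (?p y * f y) \<partial>?L) = (\<integral>y. ?A n y * (?p y * c y) \<partial>?L)" for n
      using iApf[of n] ic[of n] by (intro integral_cong_AE ae borel_measurable_integrable)
    moreover have "(\<lambda>n. \<integral>y. ?A n y * (?p y * c y) \<partial>?L) \<longlonglongrightarrow> ?p 0 * c 0"
      by (rule rising_edge_limit[OF hc ic])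
    ultimately show ?thesis by (simp only: ext_flux_0[OF s(2)])
  qed
  have limB: "(\<lambda>n. \<integral>y. ?B n y * (?p y * f y) \<partial>?L) \<longlonglongrightarrow> (\<integral>y. 0 \<partial>?L)"
  proof (rule integral_dominated_convergence[where w = "\<lambda>y. 2 * \<bar>?p y * f y\<bar>"])
    show "integrable ?L (\<lambda>y. 2 * \<bar>?p y * f y\<bar>)" using ipf by simp
    show "AE y in ?L. (\<lambda>n. ?B n y * (?p y * f y)) \<longlonglongrightarrow> 0"
    proof (rule AE_I2, rule tendsto_eventually)
      fix y :: real
      obtain n0 :: nat where n0: "y < real n0" using reals_Archimedean2 by blast
      have "?B n y * (?p y * f y) = 0" if "n \<ge> n0" for n
      proof -
        have "real n0 \<le> real n" using that by simp
        then have "1 \<le> real n + 2 + 1 - y" using n0 by linarith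
        then show ?thesis by (simp add: falling_edge_def tent_eq_0)
      qed
      then show "\<forall>\<^sub>F n in sequentially. ?B n y * (?p y * f y) = 0"
        unfolding eventually_sequentially by blast
    qed
    show "AE y in ?L. norm (?B n y * (?p y * f y)) \<le> 2 * \<bar>?p y * f y\<bar>" for n
      using falling_edge_bounds[of "real n + 2"]
      by (intro AE_I2) (simp only: real_norm_def abs_mult[of "?B n _"], intro mult_right_mono, auto)
  qed (use borel_measurable_integrable[OF iBpf] in auto)
  \<comment> \<open>The trace enters twice on the left and the energy of the minimizer once on the right.\<close>
  have "2 * ?a * (?D * ?a) \<le> E + ?a\<^sup>2 * ?D + 2 * ?a * (\<integral>y. 0 \<partial>?L)"
    by (rule LIMSEQ_le[OF tendsto_mult[OF tendsto_const limA] tendsto_add[OF tendsto_const tendsto_mult[OF tendsto_const limB]]])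
      (use main in blast)
  then have "?D * ?a\<^sup>2 \<le> E" by (simp add: power2_eq_square algebra_simps)
  then have "ennreal (?D * ?a\<^sup>2) \<le> ennreal E" by (rule ennreal_leI)
  also have "ennreal E = (\<integral>\<^sup>+y. ennreal (?e y) \<partial>?L)"
    unfolding E_def by (rule nn_integral_eq_integral[symmetric, OF ie]) auto
  finally show ?thesis .
qed

section \<open>Extensions with values in the Hilbert spaces\<close>

lemma half_line_integral_of_supported:
  fixes h :: "real \<Rightarrow> real"
  assumes "0 < a" "continuous_on {a..b} h" "\<And>y. y \<notin> {a..b} \<Longrightarrow> h y = 0"
  shows "integrable (lebesgue_on {0<..}) h" and "(\<integral>y. h y \<partial>lebesgue_on {0<..}) = integral {a..b} h"
proof -
  have hi: "(h has_integral integral {a..b} h) {a..b}"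
    using integrable_continuous_interval[OF assms(2)] by (rule integrable_integral)
  have hi': "(h has_integral integral {a..b} h) {0<..}"
    by (rule has_integral_on_superset[OF hi]) (use assms in auto)
  have "((\<lambda>y. norm (h y)) has_integral integral {a..b} (\<lambda>y. norm (h y))) {a..b}"
    using integrable_continuous_interval[OF continuous_on_norm[OF assms(2)]] by (rule integrable_integral)
  then have "((\<lambda>y. norm (h y)) has_integral integral {a..b} (\<lambda>y. norm (h y))) {0<..}"
    by (rule has_integral_on_superset) (use assms in auto)
  then have "h absolutely_integrable_on {0<..}"
    using hi' by (intro absolutely_integrable_onI) (auto simp: integrable_on_def)
  then show i: "integrable (lebesgue_on {0<..}) h"
    by (rule absolutely_integrable_imp_integrable) simp
  show "(\<integral>y. h y \<partial>lebesgue_on {0<..}) = integral {a..b} h"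
    by (rule trans[OF lebesgue_integral_eq_integral[OF i half_line_sets(1)] integral_unique[OF hi']])
qed

lemma test_function_support:
  fixes \<eta> \<eta>' :: "real \<Rightarrow> real"
  assumes der: "\<And>y. (\<eta> has_real_derivative \<eta>' y) (at y)" and K: "compact K" "K \<subseteq> {0<..}"
    and out: "\<And>y. y \<notin> K \<Longrightarrow> \<eta> y = 0"
  obtains a b where "0 < a" "a < b" "\<And>y. y \<notin> {a<..<b} \<Longrightarrow> \<eta> y = 0" "\<And>y. y \<notin> {a<..<b} \<Longrightarrow> \<eta>' y = 0"
proof -
  obtain a b where ab: "0 < a" "a < b" "K \<subseteq> {a<..<b}"
  proof (cases "K = {}")
    case True
    then show ?thesis using that[of 1 2] by simp
  next
    case False
    obtain m where m: "m \<in> K" "\<And>y. y \<in> K \<Longrightarrow> m \<le> y" using compact_attains_inf[OF K(1) False] by blast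
    obtain M where M: "M \<in> K" "\<And>y. y \<in> K \<Longrightarrow> y \<le> M" using compact_attains_sup[OF K(1) False] by blast
    have "m > 0" using m(1) K(2) by auto
    then have "K \<subseteq> {m / 2<..<M + 1}" using m(2) M(2) by force
    moreover have "m / 2 < M + 1" using m(2)[OF M(1)] \<open>m > 0\<close> by linarith
    ultimately show ?thesis using that[of "m / 2" "M + 1"] \<open>m > 0\<close> by simp
  qed
  have "\<eta>' y = 0" if "y \<notin> K" for y
  proof -
    have "\<forall>\<^sub>F z in nhds y. z \<in> - K"
      using K(1) that by (intro eventually_nhds_in_open) (auto intro: compact_imp_closed)
    then have "\<forall>\<^sub>F z in nhds y. \<eta> z = (\<lambda>_. 0) z" by eventually_elim (simp add: out)
    from DERIV_cong_ev[OF refl this refl, THEN iffD1, OF der] show ?thesis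
      using DERIV_unique[OF _ DERIV_const] by blast
  qed
  then show ?thesis using that[of a b] ab out by blast
qed

text \<open>
  The boundary terms vanish because the support of $\eta$ lies between \<open>a\<close> and \<open>b\<close>, away from the
  origin, where the derivative of \<open>F\<close> may be singular.
\<close>

lemma half_line_integration_by_parts:
  fixes \<eta> \<eta>' F F' :: "real \<Rightarrow> real"
  assumes der: "\<And>y. (\<eta> has_real_derivative \<eta>' y) (at y)" and cont: "continuous_on UNIV \<eta>'"
    and ab: "0 < a" "a < b" "\<And>y. y \<notin> {a<..<b} \<Longrightarrow> \<eta> y = 0" "\<And>y. y \<notin> {a<..<b} \<Longrightarrow> \<eta>' y = 0"
    and F: "\<And>y. y > 0 \<Longrightarrow> (F has_real_derivative F' y) (at y)" "continuous_on {0<..} F'"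
  shows "integrable (lebesgue_on {0<..}) (\<lambda>y. \<eta>' y * F y)"
    and "integrable (lebesgue_on {0<..}) (\<lambda>y. \<eta> y * F' y)"
    and "(\<integral>y. \<eta>' y * F y \<partial>lebesgue_on {0<..}) = - (\<integral>y. \<eta> y * F' y \<partial>lebesgue_on {0<..})"
proof -
  have sub: "{a..b} \<subseteq> {0<..}" using ab(1) by auto
  have c\<eta>: "continuous_on {a..b} \<eta>"
    using der by (intro DERIV_continuous_on) (blast intro: has_field_derivative_at_within)
  have c\<eta>': "continuous_on {a..b} \<eta>'" using cont by (rule continuous_on_subset) simp
  have cF: "continuous_on {a..b} F"
    using F(1) sub by (intro DERIV_continuous_on) (blast intro: has_field_derivative_at_within)
  have cF': "continuous_on {a..b} F'" using F(2) sub by (rule continuous_on_subset)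
  have z: "\<eta> y = 0" "\<eta>' y = 0" if "y \<notin> {a..b}" for y using ab(3,4) that by auto
  note 1 = half_line_integral_of_supported[OF ab(1) continuous_on_mult[OF c\<eta>' cF]]
  note 2 = half_line_integral_of_supported[OF ab(1) continuous_on_mult[OF c\<eta> cF']]
  show i1: "integrable (lebesgue_on {0<..}) (\<lambda>y. \<eta>' y * F y)" by (rule 1) (simp add: z)
  show i2: "integrable (lebesgue_on {0<..}) (\<lambda>y. \<eta> y * F' y)" by (rule 2) (simp add: z)
  have "((\<lambda>y. \<eta>' y * F y + F' y * \<eta> y) has_integral (\<eta> b * F b - \<eta> a * F a)) {a..b}"
  proof (rule fundamental_theorem_of_calculus)
    fix y assume "y \<in> {a..b}"
    then have "y > 0" using sub by auto
    from DERIV_mult[OF der F(1)[OF this]]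
    show "((\<lambda>y. \<eta> y * F y) has_vector_derivative \<eta>' y * F y + F' y * \<eta> y) (at y within {a..b})"
      unfolding has_real_derivative_iff_has_vector_derivative[symmetric] by (rule has_field_derivative_at_within)
  qed (use ab in simp)
  then have "integral {a..b} (\<lambda>y. \<eta>' y * F y + \<eta> y * F' y) = 0"
    using ab(3)[of a] ab(3)[of b] by (simp add: integral_unique mult.commute)
  moreover have "integral {a..b} (\<lambda>y. \<eta>' y * F y + \<eta> y * F' y)
      = integral {a..b} (\<lambda>y. \<eta>' y * F y) + integral {a..b} (\<lambda>y. \<eta> y * F' y)"
    by (intro integral_add integrable_continuous_interval continuous_on_mult c\<eta> c\<eta>' cF cF')
  moreover have "(\<integral>y. \<eta>' y * F y \<partial>lebesgue_on {0<..}) = integral {a..b} (\<lambda>y. \<eta>' y * F y)"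
    by (rule 1(2)) (simp add: z)
  moreover have "(\<integral>y. \<eta> y * F' y \<partial>lebesgue_on {0<..}) = integral {a..b} (\<lambda>y. \<eta> y * F' y)"
    by (rule 2(2)) (simp add: z)
  ultimately show "(\<integral>y. \<eta>' y * F y \<partial>lebesgue_on {0<..}) = - (\<integral>y. \<eta> y * F' y \<partial>lebesgue_on {0<..})"
    by linarith
qed

text \<open>
  A bound uniform in \<open>l\<close>: it makes the extension converge in $V_1$ at every $y > 0$, for arbitrary
  \<open>u\<close> in $V_0$.
\<close>

lemma ext_profile_weighted_bound:
  assumes s: "0 < s" and y: "y > 0"
  shows "(l * ext_profile s l y)\<^sup>2 \<le> 4 * s / y\<^sup>2"
proof -
  note b = ext_profile_bounds[OF s, of l y]
  have "((l * y)\<^sup>2 * ext_profile s l y) * ext_profile s l y \<le> (4 * s) * 1"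
    by (rule mult_mono[OF b(3) b(2)]) (use b(1) s in auto)
  then have "(l * ext_profile s l y)\<^sup>2 * y\<^sup>2 \<le> 4 * s"
    by (simp add: power_mult_distrib power2_eq_square mult_ac)
  then show ?thesis using y by (simp add: pos_le_divide_eq)
qed

text \<open>
  Multiplied by \<open>y\<close>, the slope depends on $z = \lambda y$ only, through $z^{2s} \psi_{1-s}(z)$. This is at
  most $1$ for $z \le 1$, and beyond it is controlled by the quadratic decay.
\<close>

lemma ext_slope_bound:
  assumes s: "0 < s" "s < 1" and l: "l > 0" and y: "y > 0"
  shows "0 \<le> y powr (2 * s - 1) * ext_flux s l y" "y powr (2 * s - 1) * ext_flux s l y \<le> 4 * d_const s / y"
proof -
  show "0 \<le> y powr (2 * s - 1) * ext_flux s l y" using ext_flux_bounds[OF s] by simp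
  let ?z = "l * y"
  have s': "0 < 1 - s" using s by simp
  note n = bessel_profile_nonneg[OF s', of ?z] and u = bessel_profile_le_1[OF s', of ?z]
    and dec = bessel_profile_decay[OF s', of ?z]
  have z: "?z > 0" using l y by simp
  have B: "?z powr (2 * s) * bessel_profile (1 - s) ?z \<le> 4"
  proof (cases "?z \<le> 1")
    case True
    have "?z powr (2 * s) \<le> 1" using True z s by (intro powr_le1) auto
    then have "?z powr (2 * s) * bessel_profile (1 - s) ?z \<le> 1 * 1" using n u by (intro mult_mono) auto
    then show ?thesis by simp
  next
    case False
    have "?z powr (2 * s) \<le> ?z powr 2" using False s by (intro powr_mono) auto
    then have "?z powr (2 * s) \<le> ?z\<^sup>2" using z by simp
    then have "?z powr (2 * s) * bessel_profile (1 - s) ?z \<le> ?z\<^sup>2 * bessel_profile (1 - s) ?z"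
      using n by (rule mult_right_mono)
    then show ?thesis using dec s by simp
  qed
  have "y * (y powr (2 * s - 1) * ext_flux s l y) = d_const s * (?z powr (2 * s) * bessel_profile (1 - s) ?z)"
    using l y by (simp add: ext_flux_def powr_mult powr_diff)
  also have "\<dots> \<le> d_const s * 4" using B d_const_pos[OF s] by (intro mult_left_mono) auto
  finally show "y powr (2 * s - 1) * ext_flux s l y \<le> 4 * d_const s / y"
    using y by (simp add: pos_le_divide_eq mult.commute)
qed

context eigen_sequence
begin

lemma coeff_sq_le: "(coeff u k)\<^sup>2 \<le> (norm u)\<^sup>2"
  using Bessel_finite[OF orthonormal, of "{k}" u] by (simp add: coeff_def)

lemma continuous_coeff: "continuous_on A (\<lambda>u. coeff u k)"
  unfolding coeff_def by (intro continuous_on_inner continuous_on_id continuous_on_const)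

text \<open>
  Each coefficient of an extension is a competitor in the scalar problem, with trace $u_k$. Bessel's
  inequality in $V_1$ for the extension and in $V_0$ for its derivative sums the scalar bounds.
\<close>

lemma extension_energy_lower_bound:
  assumes s: "0 < s" "s < 1" and ext: "ext_fun j s v g" and trace: "has_trace j v u"
  shows "ennreal (d_const s) * (\<Sum>k. ennreal (lam k powr (2 * s) * (coeff u k)\<^sup>2))
    \<le> (\<integral>\<^sup>+y. ennreal (y powr (1 - 2 * s) * ((norm (v y))\<^sup>2 + (norm (g y))\<^sup>2)) \<partial>lebesgue_on {0<..})"
proof -
  let ?L = "lebesgue_on {0<..} :: real measure"
  let ?w = "\<lambda>y::real. y powr (1 - 2 * s)"
  let ?f = "\<lambda>k y. coeff (j (v y)) k" and ?g = "\<lambda>k y. coeff (g y) k"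
  have mj: "(\<lambda>y. j (v y)) \<in> borel_measurable ?L" and mg: "g \<in> borel_measurable ?L"
    and fin: "(\<integral>\<^sup>+y. ennreal (?w y * (norm (j (v y)))\<^sup>2) \<partial>?L) < \<infinity>" "(\<integral>\<^sup>+y. ennreal (?w y * (norm (g y))\<^sup>2) \<partial>?L) < \<infinity>"
    and weak: "has_weak_derivative (\<lambda>y. j (v y)) g"
    using ext by (auto simp: ext_fun_def weighted_L2_def)
  obtain c where c: "continuous_on {0..} c" "AE y in ?L. c y = j (v y)" "c 0 = u"
    using trace by (auto simp: has_trace_def)
  have mc: "(\<lambda>u. coeff u k) \<in> borel_measurable borel" for k
    by (rule borel_measurable_continuous_onI[OF continuous_coeff])
  have mf: "?f k \<in> borel_measurable ?L" and mgk: "?g k \<in> borel_measurable ?L" for k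
    by (rule measurable_compose[OF mj mc], rule measurable_compose[OF mg mc])
  have mw: "?w \<in> borel_measurable ?L"
    by (rule half_line_continuous_measurable) (auto intro!: continuous_intros)
  have fink: "(\<integral>\<^sup>+y. ennreal (?w y * (coeff (h y) k)\<^sup>2) \<partial>?L) < \<infinity>"
    if "(\<integral>\<^sup>+y. ennreal (?w y * (norm (h y))\<^sup>2) \<partial>?L) < \<infinity>" for h :: "real \<Rightarrow> 'a" and k
    by (rule le_less_trans[OF nn_integral_mono that])
      (intro ennreal_leI mult_left_mono coeff_sq_le powr_ge_zero)
  have comp: "ennreal (d_const s * lam k powr (2 * s) * (coeff u k)\<^sup>2)
      \<le> (\<integral>\<^sup>+y. ennreal (?w y * ((lam k)\<^sup>2 * (?f k y)\<^sup>2 + (?g k y)\<^sup>2)) \<partial>?L)" for k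
    unfolding c(3)[symmetric]
  proof (rule scalar_extension_lower_bound[OF s lam_pos mf fink[OF fin(1)] mgk fink[OF fin(2)]])
    show "continuous_on {0..} (\<lambda>y. coeff (c y) k)"
      by (rule continuous_on_compose2[OF continuous_coeff c(1)]) auto
    show "AE y in ?L. coeff (c y) k = ?f k y" using c(2) by eventually_elim simp
    fix \<eta> \<eta>' :: "real \<Rightarrow> real" and K :: "real set"
    assume T: "\<And>y. (\<eta> has_real_derivative \<eta>' y) (at y)" "continuous_on UNIV \<eta>'" "compact K" "K \<subseteq> {0<..}"
      "\<And>y. y \<notin> K \<Longrightarrow> \<eta> y = 0"
    show "(\<integral>y. \<eta>' y * ?f k y \<partial>?L) = - (\<integral>y. \<eta> y * ?g k y \<partial>?L)"
      using weak[unfolded has_weak_derivative_def, rule_format, of \<eta> \<eta>' K "j (b k)"] T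
      unfolding coeff_def by blast
  qed
  have "ennreal (d_const s) * (\<Sum>k. ennreal (lam k powr (2 * s) * (coeff u k)\<^sup>2))
      = (\<Sum>k. ennreal (d_const s * lam k powr (2 * s) * (coeff u k)\<^sup>2))"
    using d_const_pos[OF s] by (simp add: ennreal_suminf_cmult[symmetric] ennreal_mult'[symmetric] mult.assoc)
  also have "\<dots> \<le> (\<Sum>k. \<integral>\<^sup>+y. ennreal (?w y * ((lam k)\<^sup>2 * (?f k y)\<^sup>2 + (?g k y)\<^sup>2)) \<partial>?L)"
    by (intro suminf_le comp) auto
  also have "\<dots> = (\<integral>\<^sup>+y. (\<Sum>k. ennreal (?w y * ((lam k)\<^sup>2 * (?f k y)\<^sup>2 + (?g k y)\<^sup>2))) \<partial>?L)"
    by (rule nn_integral_suminf[symmetric]) (use mw mf mgk in measurable)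
  also have "\<dots> \<le> (\<integral>\<^sup>+y. ennreal (?w y * ((norm (v y))\<^sup>2 + (norm (g y))\<^sup>2)) \<partial>?L)"
  proof (rule nn_integral_mono, rule suminf_le_const)
    fix y :: real and n
    have "(\<Sum>k<n. (lam k)\<^sup>2 * (?f k y)\<^sup>2 + (?g k y)\<^sup>2) \<le> (norm (v y))\<^sup>2 + (norm (g y))\<^sup>2"
      using V1_Bessel_finite[of "{..<n}" "v y"] Bessel_finite[OF orthonormal, of "{..<n}" "g y"]
      by (simp add: sum.distrib power_mult_distrib coeff_def)
    then have "?w y * (\<Sum>k<n. (lam k)\<^sup>2 * (?f k y)\<^sup>2 + (?g k y)\<^sup>2) \<le> ?w y * ((norm (v y))\<^sup>2 + (norm (g y))\<^sup>2)"
      by (rule mult_left_mono) simp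
    then show "(\<Sum>k<n. ennreal (?w y * ((lam k)\<^sup>2 * (?f k y)\<^sup>2 + (?g k y)\<^sup>2)))
        \<le> ennreal (?w y * ((norm (v y))\<^sup>2 + (norm (g y))\<^sup>2))"
      by (subst sum_ennreal) (auto simp: sum_distrib_left intro!: ennreal_leI)
  qed auto
  finally show ?thesis .
qed

lemma V0_series:
  assumes sq: "summable (\<lambda>k. (c k * coeff u k)\<^sup>2)"
  shows "(\<lambda>k. (c k * coeff u k) *\<^sub>R j (b k)) sums (\<Sum>k. (c k * coeff u k) *\<^sub>R j (b k))"
    and "(\<lambda>k. (c k * coeff u k)\<^sup>2) sums (norm (\<Sum>k. (c k * coeff u k) *\<^sub>R j (b k)))\<^sup>2"
proof -
  have nrm: "(norm ((c k * coeff u k) *\<^sub>R j (b k)))\<^sup>2 = (c k * coeff u k)\<^sup>2" for k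
  proof (cases "j (b k) = 0")
    case False
    then have "norm (j (b k)) = 1" using orthonormal unfolding orthonormal_seq_def by blast
    then show ?thesis by (simp add: power2_abs)
  qed (simp add: coeff_def)
  have sn: "summable (\<lambda>k. (norm ((c k * coeff u k) *\<^sub>R j (b k)))\<^sup>2)" using sq by (simp only: nrm)
  show "(\<lambda>k. (c k * coeff u k) *\<^sub>R j (b k)) sums (\<Sum>k. (c k * coeff u k) *\<^sub>R j (b k))"
    by (rule summable_sums[OF orthonormal_summable(1)[OF orthonormal sq]])
  have "(\<lambda>k. (norm ((c k * coeff u k) *\<^sub>R j (b k)))\<^sup>2) sums (norm (\<Sum>k. (c k * coeff u k) *\<^sub>R j (b k)))\<^sup>2"
    by (rule orthogonal_suminf_norm[OF _ sn]) (rule orthonormal_seq_scaled(1)[OF orthonormal])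
  then show "(\<lambda>k. (c k * coeff u k)\<^sup>2) sums (norm (\<Sum>k. (c k * coeff u k) *\<^sub>R j (b k)))\<^sup>2"
    by (simp only: nrm)
qed

lemma summable_scaled_coeff:
  assumes "\<And>k. (c k)\<^sup>2 \<le> C"
  shows "summable (\<lambda>k. (c k * coeff u k)\<^sup>2)"
proof (rule summable_comparison_test'[OF summable_mult[OF coeff_sq_summable[of u], of C], of 0])
  fix k
  show "norm ((c k * coeff u k)\<^sup>2) \<le> C * (coeff u k)\<^sup>2"
    using mult_right_mono[OF assms[of k], of "(coeff u k)\<^sup>2"] by (simp add: power_mult_distrib)
qed

text \<open>
  The weighted-harmonic extension, by superposition of the scalar minimizers. Its slope is the
  derivative formed termwise, and its trace is the same series in $V_0$, which still converges at
  $y = 0$.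
\<close>

definition harmonic_extension :: "real \<Rightarrow> 'a \<Rightarrow> real \<Rightarrow> 'b" where
  "harmonic_extension s u y = (\<Sum>k. (ext_profile s (lam k) y * coeff u k) *\<^sub>R b k)"

definition harmonic_slope :: "real \<Rightarrow> 'a \<Rightarrow> real \<Rightarrow> 'a" where
  "harmonic_slope s u y = (\<Sum>k. (- (y powr (2 * s - 1) * ext_flux s (lam k) y) * coeff u k) *\<^sub>R j (b k))"

definition harmonic_trace :: "real \<Rightarrow> 'a \<Rightarrow> real \<Rightarrow> 'a" where
  "harmonic_trace s u y = (\<Sum>k. (ext_profile s (lam k) y * coeff u k) *\<^sub>R j (b k))"

lemma harmonic_extension_series:
  assumes s: "0 < s" and y: "y > 0"
  shows "(\<lambda>k. (ext_profile s (lam k) y * coeff u k) *\<^sub>R b k) sums harmonic_extension s u y"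
    and "(\<lambda>k. (lam k * ext_profile s (lam k) y * coeff u k)\<^sup>2) sums (norm (harmonic_extension s u y))\<^sup>2"
proof -
  have "summable (\<lambda>k. (lam k * (ext_profile s (lam k) y * coeff u k))\<^sup>2)"
    using summable_scaled_coeff[OF ext_profile_weighted_bound[OF s y], where u = u] by (simp only: mult.assoc)
  note V = V1_series[OF this]
  show "(\<lambda>k. (ext_profile s (lam k) y * coeff u k) *\<^sub>R b k) sums harmonic_extension s u y"
    using V(1) by (simp only: harmonic_extension_def)
  show "(\<lambda>k. (lam k * ext_profile s (lam k) y * coeff u k)\<^sup>2) sums (norm (harmonic_extension s u y))\<^sup>2"
    using V(2) by (simp only: harmonic_extension_def mult.assoc)
qed

lemma harmonic_slope_series:
  assumes s: "0 < s" "s < 1" and y: "y > 0"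
  shows "(\<lambda>k. (- (y powr (2 * s - 1) * ext_flux s (lam k) y) * coeff u k) *\<^sub>R j (b k)) sums harmonic_slope s u y"
    and "(\<lambda>k. (y powr (2 * s - 1) * ext_flux s (lam k) y * coeff u k)\<^sup>2) sums (norm (harmonic_slope s u y))\<^sup>2"
proof -
  have "(- (y powr (2 * s - 1) * ext_flux s (lam k) y))\<^sup>2 \<le> (4 * d_const s / y)\<^sup>2" for k
    unfolding power2_minus using ext_slope_bound[OF s lam_pos y] by (intro power_mono)
  note V = V0_series[OF summable_scaled_coeff[OF this], where u = u]
  show "(\<lambda>k. (- (y powr (2 * s - 1) * ext_flux s (lam k) y) * coeff u k) *\<^sub>R j (b k)) sums harmonic_slope s u y"
    using V(1) by (simp only: harmonic_slope_def)
  show "(\<lambda>k. (y powr (2 * s - 1) * ext_flux s (lam k) y * coeff u k)\<^sup>2) sums (norm (harmonic_slope s u y))\<^sup>2"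
    using V(2) by (simp only: harmonic_slope_def power_mult_distrib power2_minus)
qed

lemma ext_profile_sq_le_1: "0 < s \<Longrightarrow> (ext_profile s l y)\<^sup>2 \<le> 1"
  using ext_profile_bounds[of s l y] by (simp add: power_le_one)

lemma harmonic_trace_series:
  assumes s: "0 < s"
  shows "(\<lambda>k. (ext_profile s (lam k) y * coeff u k) *\<^sub>R j (b k)) sums harmonic_trace s u y"
  using V0_series(1)[OF summable_scaled_coeff[OF ext_profile_sq_le_1[OF s]]]
  by (simp only: harmonic_trace_def)

lemma harmonic_trace_eq:
  assumes s: "0 < s" and y: "y > 0"
  shows "harmonic_trace s u y = j (harmonic_extension s u y)"
proof -
  have "(\<lambda>k. j ((ext_profile s (lam k) y * coeff u k) *\<^sub>R b k)) sums j (harmonic_extension s u y)"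
    by (rule j.sums[OF harmonic_extension_series(1)[OF s y]])
  then show ?thesis
    using sums_unique2[OF harmonic_trace_series[OF s]] by (simp only: j.scaleR)
qed

lemma harmonic_trace_0: "0 < s \<Longrightarrow> harmonic_trace s u 0 = u"
  using sums_unique2[OF harmonic_trace_series[of s 0 u]] orthonormal_expansion[OF orthonormal dense, of u]
  by (simp add: ext_profile_0 coeff_def)

text \<open>
  The profiles are at most one, so by orthogonality the squared remainder of the series is at most
  $\sum_{k \ge n} u_k^2$, uniformly in \<open>y\<close>.
\<close>

lemma harmonic_trace_continuous:
  assumes s: "0 < s"
  shows "continuous_on A (harmonic_trace s u)"
proof (rule uniform_limit_theorem[OF _ _ trivial_limit_sequentially])
  let ?t = "\<lambda>k y. (ext_profile s (lam k) y * coeff u k) *\<^sub>R j (b k)"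
  show "\<forall>\<^sub>F n in sequentially. continuous_on A (\<lambda>y. \<Sum>k<n. ?t k y)"
    by (intro always_eventually allI continuous_on_sum continuous_on_scaleR continuous_on_mult
        ext_profile_continuous[OF s] continuous_on_const)
  show "uniform_limit A (\<lambda>n y. \<Sum>k<n. ?t k y) (harmonic_trace s u) sequentially"
  proof (rule uniform_limitI)
    fix r :: real assume r: "r > 0"
    have "(\<lambda>n. \<Sum>k. (coeff u (k + n))\<^sup>2) \<longlonglongrightarrow> 0"
      by (rule suminf_exist_split2[OF coeff_sq_summable])
    then have "\<forall>\<^sub>F n in sequentially. (\<Sum>k. (coeff u (k + n))\<^sup>2) < r\<^sup>2"
      using r by (intro order_tendstoD(2)) auto
    then show "\<forall>\<^sub>F n in sequentially. \<forall>y\<in>A. dist (\<Sum>k<n. ?t k y) (harmonic_trace s u y) < r"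
    proof eventually_elim
      case (elim n)
      show ?case
      proof
        fix y
        let ?a = "\<lambda>k. ext_profile s (lam k) y * coeff u k"
        have sa: "summable (\<lambda>k. (?a k)\<^sup>2)" by (rule summable_scaled_coeff[OF ext_profile_sq_le_1[OF s]])
        have nle: "(norm (?t k y))\<^sup>2 \<le> (coeff u k)\<^sup>2" for k
        proof -
          have "(norm (?t k y))\<^sup>2 \<le> (?a k)\<^sup>2" by (rule orthonormal_seq_scaled(2)[OF orthonormal])
          also have "\<dots> \<le> 1 * (coeff u k)\<^sup>2"
            unfolding power_mult_distrib by (rule mult_right_mono[OF ext_profile_sq_le_1[OF s]]) simp
          finally show ?thesis by simp
        qed
        have sn: "summable (\<lambda>k. (norm (?t (k + n) y))\<^sup>2)"
          using summable_ignore_initial_segment[OF orthonormal_summable(2)[OF orthonormal sa], of n] .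
        have "harmonic_trace s u y = (\<Sum>k. ?t (k + n) y) + (\<Sum>k<n. ?t k y)"
          unfolding harmonic_trace_def
          by (rule suminf_split_initial_segment[OF orthonormal_summable(1)[OF orthonormal sa]])
        then have "(dist (\<Sum>k<n. ?t k y) (harmonic_trace s u y))\<^sup>2 = (norm (\<Sum>k. ?t (k + n) y))\<^sup>2"
          by (simp add: dist_norm)
        also have "\<dots> = (\<Sum>k. (norm (?t (k + n) y))\<^sup>2)"
          by (rule sums_unique[OF orthogonal_suminf_norm[OF _ sn]])
            (rule orthonormal_seq_scaled(1)[OF orthonormal], simp)
        also have "\<dots> \<le> (\<Sum>k. (coeff u (k + n))\<^sup>2)"
          by (rule suminf_le[OF nle sn summable_ignore_initial_segment[OF coeff_sq_summable]])
        also have "\<dots> < r\<^sup>2" by (rule elim)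
        finally show "dist (\<Sum>k<n. ?t k y) (harmonic_trace s u y) < r"
          using r by (simp add: power_less_imp_less_base)
      qed
    qed
  qed
qed

lemma harmonic_extension_measurable:
  assumes s: "0 < s"
  shows "harmonic_extension s u \<in> borel_measurable (lebesgue_on {0<..})"
proof (rule borel_measurable_LIMSEQ_metric)
  show "(\<lambda>y. \<Sum>k<n. (ext_profile s (lam k) y * coeff u k) *\<^sub>R b k) \<in> borel_measurable (lebesgue_on {0<..})" for n
    by (intro half_line_continuous_measurable continuous_on_sum continuous_on_scaleR continuous_on_mult
        ext_profile_continuous[OF s] continuous_on_const)
  show "(\<lambda>n. \<Sum>k<n. (ext_profile s (lam k) y * coeff u k) *\<^sub>R b k) \<longlonglongrightarrow> harmonic_extension s u y"
    if "y \<in> space (lebesgue_on {0<..})" for y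
    using harmonic_extension_series(1)[OF s, of y u] that by (simp add: sums_def)
qed

lemma harmonic_slope_measurable:
  assumes s: "0 < s" "s < 1"
  shows "harmonic_slope s u \<in> borel_measurable (lebesgue_on {0<..})"
proof (rule borel_measurable_LIMSEQ_metric)
  let ?t = "\<lambda>k y. (- (y powr (2 * s - 1) * ext_flux s (lam k) y) * coeff u k) *\<^sub>R j (b k)"
  show "(\<lambda>y. \<Sum>k<n. ?t k y) \<in> borel_measurable (lebesgue_on {0<..})" for n
    by (intro half_line_continuous_measurable continuous_on_sum continuous_on_scaleR continuous_on_mult
        continuous_on_minus ext_flux_continuous[OF s(2)] continuous_on_const) (auto intro!: continuous_intros)
  show "(\<lambda>n. \<Sum>k<n. ?t k y) \<longlonglongrightarrow> harmonic_slope s u y"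
    if "y \<in> space (lebesgue_on {0<..})" for y
    using harmonic_slope_series(1)[OF s, of y u] that by (simp add: sums_def)
qed

text \<open>
  Parseval in both spaces and monotone convergence reduce this to the energy of the scalar
  minimizers. Both sides may be infinite.
\<close>

lemma harmonic_extension_energy:
  assumes s: "0 < s" "s < 1"
  shows "(\<integral>\<^sup>+y. ennreal (y powr (1 - 2 * s) * ((norm (harmonic_extension s u y))\<^sup>2 + (norm (harmonic_slope s u y))\<^sup>2))
      \<partial>lebesgue_on {0<..}) = ennreal (d_const s) * (\<Sum>k. ennreal (lam k powr (2 * s) * (coeff u k)\<^sup>2))"
proof -
  let ?L = "lebesgue_on {0<..} :: real measure"
  let ?w = "\<lambda>y::real. y powr (1 - 2 * s)"
  let ?e = "\<lambda>k y. ?w y * ((lam k)\<^sup>2 * (ext_profile s (lam k) y)\<^sup>2 + (y powr (2 * s - 1) * ext_flux s (lam k) y)\<^sup>2)"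
  have me: "?e k \<in> borel_measurable ?L" for k
    by (intro half_line_continuous_measurable continuous_on_add continuous_on_mult continuous_on_power
        ext_profile_continuous[OF s(1)] ext_flux_continuous[OF s(2)] continuous_on_const)
      (auto intro!: continuous_intros)
  have "(\<integral>\<^sup>+y. ennreal (?w y * ((norm (harmonic_extension s u y))\<^sup>2 + (norm (harmonic_slope s u y))\<^sup>2)) \<partial>?L)
      = (\<integral>\<^sup>+y. (\<Sum>k. ennreal ((coeff u k)\<^sup>2) * ennreal (?e k y)) \<partial>?L)"
  proof (rule nn_integral_cong)
    fix y assume "y \<in> space ?L"
    then have y: "y > 0" by simp
    have "(\<lambda>k. ?w y * ((lam k * ext_profile s (lam k) y * coeff u k)\<^sup>2
          + (y powr (2 * s - 1) * ext_flux s (lam k) y * coeff u k)\<^sup>2))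
        sums (?w y * ((norm (harmonic_extension s u y))\<^sup>2 + (norm (harmonic_slope s u y))\<^sup>2))"
      by (intro sums_mult sums_add harmonic_extension_series(2)[OF s(1) y] harmonic_slope_series(2)[OF s y])
    moreover have "?w y * ((lam k * ext_profile s (lam k) y * coeff u k)\<^sup>2
          + (y powr (2 * s - 1) * ext_flux s (lam k) y * coeff u k)\<^sup>2) = (coeff u k)\<^sup>2 * ?e k y" for k
      by (simp only: power_mult_distrib distrib_left mult_ac)
    ultimately have "(\<lambda>k. (coeff u k)\<^sup>2 * ?e k y)
        sums (?w y * ((norm (harmonic_extension s u y))\<^sup>2 + (norm (harmonic_slope s u y))\<^sup>2))"
      by (simp only:)
    then have "(\<Sum>k. ennreal ((coeff u k)\<^sup>2 * ?e k y))
        = ennreal (?w y * ((norm (harmonic_extension s u y))\<^sup>2 + (norm (harmonic_slope s u y))\<^sup>2))"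
      by (intro sums_unique[symmetric] sums_ennreal[THEN iffD2]) auto
    then show "ennreal (?w y * ((norm (harmonic_extension s u y))\<^sup>2 + (norm (harmonic_slope s u y))\<^sup>2))
        = (\<Sum>k. ennreal ((coeff u k)\<^sup>2) * ennreal (?e k y))"
      by (simp only: ennreal_mult'[OF zero_le_power2])
  qed
  also have "\<dots> = (\<Sum>k. \<integral>\<^sup>+y. ennreal ((coeff u k)\<^sup>2) * ennreal (?e k y) \<partial>?L)"
    by (rule nn_integral_suminf) (use me in measurable)
  also have "\<dots> = (\<Sum>k. ennreal ((coeff u k)\<^sup>2) * ennreal (d_const s * lam k powr (2 * s)))"
    unfolding ext_profile_energy[OF s lam_pos, symmetric]
    by (intro suminf_cong nn_integral_cmult measurable_compose[OF me measurable_ennreal])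
  also have "\<dots> = (\<Sum>k. ennreal (d_const s) * ennreal (lam k powr (2 * s) * (coeff u k)\<^sup>2))"
    using d_const_pos[OF s] by (simp add: ennreal_mult'[symmetric] ennreal_mult''[symmetric] mult_ac)
  finally show ?thesis by simp
qed

text \<open>
  Partial sums are smooth on the open half-line and can be integrated by parts. After pairing with
  \<open>x\<close> the coefficients are the absolutely summable products $u_k x_k$, and profile and slope are
  bounded uniformly in \<open>k\<close> on the support of the test function, so the limit is dominated.
\<close>

lemma harmonic_extension_weak_derivative:
  assumes s: "0 < s" "s < 1"
  shows "has_weak_derivative (\<lambda>y. j (harmonic_extension s u y)) (harmonic_slope s u)"
  unfolding has_weak_derivative_def
proof (intro allI impI, elim conjE)
  fix \<eta> \<eta>' :: "real \<Rightarrow> real" and K :: "real set" and x :: 'a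
  assume T: "\<forall>y. (\<eta> has_real_derivative \<eta>' y) (at y)" "continuous_on UNIV \<eta>'" "compact K" "K \<subseteq> {0<..}"
    "\<forall>y. y \<notin> K \<longrightarrow> \<eta> y = 0"
  let ?L = "lebesgue_on {0<..} :: real measure"
  obtain a b' where ab: "0 < a" "a < b'" "\<And>y. y \<notin> {a<..<b'} \<Longrightarrow> \<eta> y = 0" "\<And>y. y \<notin> {a<..<b'} \<Longrightarrow> \<eta>' y = 0"
    using test_function_support[of \<eta> \<eta>' K] T by blast
  let ?x = "\<lambda>k. coeff u k * coeff x k"
  let ?P = "\<lambda>k. ext_profile s (lam k)" and ?Q = "\<lambda>k y. - (y powr (2 * s - 1) * ext_flux s (lam k) y)"
  let ?F = "\<lambda>n y. \<Sum>k<n. ?P k y * ?x k" and ?G = "\<lambda>n y. \<Sum>k<n. ?Q k y * ?x k"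
  have sx: "summable (\<lambda>k. \<bar>?x k\<bar>)"
  proof (rule summable_comparison_test'[OF summable_add[OF coeff_sq_summable[of u] coeff_sq_summable[of x]], of 0])
    fix k
    show "norm \<bar>?x k\<bar> \<le> (coeff u k)\<^sup>2 + (coeff x k)\<^sup>2"
      using sum_squares_bound[of "\<bar>coeff u k\<bar>" "\<bar>coeff x k\<bar>"]
        mult_nonneg_nonneg[OF abs_ge_zero abs_ge_zero, of "coeff u k" "coeff x k"]
      unfolding real_norm_def abs_mult abs_idempotent power2_abs by linarith
  qed
  let ?M = "\<Sum>k. \<bar>?x k\<bar>"
  have partial: "\<bar>\<Sum>k<n. r k * ?x k\<bar> \<le> C * ?M" if "\<And>k. \<bar>r k\<bar> \<le> C" for r :: "nat \<Rightarrow> real" and C n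
  proof -
    have "\<bar>\<Sum>k<n. r k * ?x k\<bar> \<le> (\<Sum>k<n. C * \<bar>?x k\<bar>)"
      by (rule order_trans[OF sum_abs sum_mono]) (use that in \<open>simp only: abs_mult[of "r _"], intro mult_right_mono, auto\<close>)
    also have "\<dots> \<le> C * ?M"
      unfolding sum_distrib_left[symmetric] using that[of 0]
      by (intro mult_left_mono sum_le_suminf sx) auto
    finally show ?thesis .
  qed
  have dF: "(?F n has_real_derivative ?G n y) (at y)" if "y > 0" for n y
    by (intro DERIV_sum DERIV_cmult_right ext_profile_deriv s lam_pos that)
  have cG: "continuous_on {0<..} (?G n)" for n
    by (intro continuous_on_sum continuous_on_mult continuous_on_minus ext_flux_continuous[OF s(2)] continuous_on_const)
      (auto intro!: continuous_intros)
  note ibp = half_line_integration_by_parts[OF T(1)[rule_format] T(2) ab dF cG]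
  have c\<eta>: "continuous_on UNIV \<eta>" using T(1) by (intro DERIV_continuous_on) blast
  have i\<eta>: "integrable ?L (\<lambda>y. \<bar>\<eta> y\<bar>)" and i\<eta>': "integrable ?L (\<lambda>y. \<bar>\<eta>' y\<bar>)"
    using ab c\<eta> T(2)
    by (auto intro!: half_line_integral_of_supported[of a b'] continuous_on_rabs elim: continuous_on_subset)
  have limF: "(\<lambda>n. ?F n y) \<longlonglongrightarrow> j (harmonic_extension s u y) \<bullet> x" and limG: "(\<lambda>n. ?G n y) \<longlonglongrightarrow> harmonic_slope s u y \<bullet> x"
    if y: "y > 0" for y
  proof -
    have "(\<lambda>k. ((?P k y * coeff u k) *\<^sub>R j (b k)) \<bullet> x) sums (j (harmonic_extension s u y) \<bullet> x)"
      using bounded_linear.sums[OF bounded_linear_inner_left harmonic_trace_series[OF s(1), of y u]]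
      unfolding harmonic_trace_eq[OF s(1) y] .
    then show "(\<lambda>n. ?F n y) \<longlonglongrightarrow> j (harmonic_extension s u y) \<bullet> x"
      unfolding sums_def by (simp add: coeff_def inner_commute mult.assoc)
    have "(\<lambda>k. ((?Q k y * coeff u k) *\<^sub>R j (b k)) \<bullet> x) sums (harmonic_slope s u y \<bullet> x)"
      using bounded_linear.sums[OF bounded_linear_inner_left harmonic_slope_series(1)[OF s y, of u]] .
    then show "(\<lambda>n. ?G n y) \<longlonglongrightarrow> harmonic_slope s u y \<bullet> x"
      unfolding sums_def by (simp add: coeff_def inner_commute mult.assoc)
  qed
  have mx: "(\<lambda>z. z \<bullet> x) \<in> borel_measurable borel"
    by (intro borel_measurable_continuous_onI continuous_on_inner continuous_on_id continuous_on_const)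
  have m\<eta>: "\<eta> \<in> borel_measurable ?L" "\<eta>' \<in> borel_measurable ?L"
    using c\<eta> T(2) by (auto intro!: half_line_continuous_measurable elim: continuous_on_subset)
  have mj: "j \<in> borel_measurable borel"
    by (rule borel_measurable_continuous_onI[OF j.continuous_on[OF continuous_on_id]])
  have A: "(\<lambda>n. \<integral>y. \<eta>' y * ?F n y \<partial>?L) \<longlonglongrightarrow> (\<integral>y. \<eta>' y * (j (harmonic_extension s u y) \<bullet> x) \<partial>?L)"
  proof (rule integral_dominated_convergence[where w = "\<lambda>y. ?M * \<bar>\<eta>' y\<bar>"])
    show "(\<lambda>y. \<eta>' y * (j (harmonic_extension s u y) \<bullet> x)) \<in> borel_measurable ?L"
      by (intro borel_measurable_times m\<eta> measurable_compose[OF measurable_compose[OF harmonic_extension_measurable[OF s(1)] mj] mx])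
    show "integrable ?L (\<lambda>y. ?M * \<bar>\<eta>' y\<bar>)" using i\<eta>' by simp
    show "AE y in ?L. (\<lambda>n. \<eta>' y * ?F n y) \<longlonglongrightarrow> \<eta>' y * (j (harmonic_extension s u y) \<bullet> x)"
      by (rule AE_I2) (rule tendsto_mult[OF tendsto_const limF], simp)
    show "AE y in ?L. norm (\<eta>' y * ?F n y) \<le> ?M * \<bar>\<eta>' y\<bar>" for n
    proof (rule AE_I2)
      fix y
      have "\<bar>?F n y\<bar> \<le> 1 * ?M" by (rule partial) (use ext_profile_bounds[OF s(1)] in simp)
      then have "\<bar>\<eta>' y\<bar> * \<bar>?F n y\<bar> \<le> \<bar>\<eta>' y\<bar> * ?M" by (intro mult_left_mono) auto
      then show "norm (\<eta>' y * ?F n y) \<le> ?M * \<bar>\<eta>' y\<bar>" by (simp only: real_norm_def abs_mult mult.commute)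
    qed
  qed (use borel_measurable_integrable[OF ibp(1)] in blast)
  have B: "(\<lambda>n. \<integral>y. \<eta> y * ?G n y \<partial>?L) \<longlonglongrightarrow> (\<integral>y. \<eta> y * (harmonic_slope s u y \<bullet> x) \<partial>?L)"
  proof (rule integral_dominated_convergence[where w = "\<lambda>y. (4 * d_const s / a * ?M) * \<bar>\<eta> y\<bar>"])
    show "(\<lambda>y. \<eta> y * (harmonic_slope s u y \<bullet> x)) \<in> borel_measurable ?L"
      by (intro borel_measurable_times m\<eta> measurable_compose[OF harmonic_slope_measurable[OF s] mx])
    show "integrable ?L (\<lambda>y. (4 * d_const s / a * ?M) * \<bar>\<eta> y\<bar>)" using i\<eta> by simp
    show "AE y in ?L. (\<lambda>n. \<eta> y * ?G n y) \<longlonglongrightarrow> \<eta> y * (harmonic_slope s u y \<bullet> x)"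
      by (rule AE_I2) (rule tendsto_mult[OF tendsto_const limG], simp)
    show "AE y in ?L. norm (\<eta> y * ?G n y) \<le> (4 * d_const s / a * ?M) * \<bar>\<eta> y\<bar>" for n
    proof (rule AE_I2)
      fix y
      show "norm (\<eta> y * ?G n y) \<le> (4 * d_const s / a * ?M) * \<bar>\<eta> y\<bar>"
      proof (cases "y \<in> {a<..<b'}")
        case True
        then have y: "0 < y" "a \<le> y" using ab(1) by auto
        have "\<bar>?Q k y\<bar> \<le> 4 * d_const s / a" for k
        proof -
          have "\<bar>?Q k y\<bar> \<le> 4 * d_const s / y" using ext_slope_bound[OF s lam_pos[of k] y(1)] by simp
          also have "\<dots> \<le> 4 * d_const s / a" using d_const_pos[OF s] y(2) ab(1) by (intro divide_left_mono) auto
          finally show ?thesis .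
        qed
        then have "\<bar>?G n y\<bar> \<le> 4 * d_const s / a * ?M" by (rule partial)
        then have "\<bar>\<eta> y\<bar> * \<bar>?G n y\<bar> \<le> \<bar>\<eta> y\<bar> * (4 * d_const s / a * ?M)" by (intro mult_left_mono) auto
        then show ?thesis by (simp only: real_norm_def abs_mult mult.commute)
      qed (simp add: ab(3))
    qed
  qed (use borel_measurable_integrable[OF ibp(2)] in blast)
  have ibp3: "(\<integral>y. \<eta>' y * ?F n y \<partial>?L) = - (\<integral>y. \<eta> y * ?G n y \<partial>?L)" for n
    by (rule half_line_integration_by_parts(3)[OF T(1)[rule_format] T(2) ab]) (assumption | rule dF cG)+
  have "(\<lambda>n. \<integral>y. \<eta>' y * ?F n y \<partial>?L) \<longlonglongrightarrow> - (\<integral>y. \<eta> y * (harmonic_slope s u y \<bullet> x) \<partial>?L)"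
    unfolding ibp3 by (rule tendsto_minus[OF B])
  then show "(\<integral>y. \<eta>' y * (j (harmonic_extension s u y) \<bullet> x) \<partial>?L) = - (\<integral>y. \<eta> y * (harmonic_slope s u y \<bullet> x) \<partial>?L)"
    by (rule LIMSEQ_unique[OF A])
qed

end

section \<open>Equality of the norms\<close>

lemma esqrt_mono: "x \<le> y \<Longrightarrow> esqrt x \<le> esqrt y"
  by (cases x; cases y) (auto simp: esqrt_def top_unique intro!: ennreal_leI)

lemma esqrt_mult_ennreal:
  assumes "0 < r"
  shows "esqrt (ennreal r * x) = ennreal (sqrt r) * esqrt x"
proof (cases x)
  case (real a)
  then show ?thesis using assms
    by (simp add: esqrt_def ennreal_mult'[symmetric] real_sqrt_mult)
next
  case top
  then show ?thesis using assms by (simp add: esqrt_def ennreal_mult_top)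
qed

lemma esqrt_less_top_iff: "esqrt x < \<infinity> \<longleftrightarrow> x < \<infinity>"
  by (cases x) (auto simp: esqrt_def)

lemma infsum_ennreal_indicator:
  fixes f :: "nat \<Rightarrow> real"
  shows "(\<Sum>\<^sub>\<infinity>k\<in>I. ennreal (f k)) = (\<Sum>k. ennreal (if k \<in> I then f k else 0))"
proof -
  let ?g = "\<lambda>k. ennreal (if k \<in> I then f k else 0)"
  have "(\<Sum>\<^sub>\<infinity>k\<in>I. ennreal (f k)) = (\<Sum>\<^sub>\<infinity>k\<in>UNIV. ?g k)"
    by (rule infsum_cong_neutral) auto
  also have "\<dots> = (\<Sum>k. ?g k)"
    by (intro sums_unique has_sum_imp_sums has_sum_infsum nonneg_summable_on_complete) auto
  finally show ?thesis .
qed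

lemma eigenbasis_imp_eigen_sequence:
  fixes j :: "'b::{real_inner, banach} \<Rightarrow> 'a::{real_inner, banach}"
  assumes j: "bounded_linear j" and basis: "eigenbasis j I \<phi> lam"
  shows "eigen_sequence j (\<lambda>k. if k \<in> I then \<phi> k else 0) (\<lambda>k. if k \<in> I then lam k else 1)"
proof (rule eigen_sequence.intro)
  interpret j: bounded_linear j by fact
  show "bounded_linear j" by fact
  have orth: "j (\<phi> k) \<bullet> j (\<phi> l) = (if k = l then 1 else 0)" if "k \<in> I" "l \<in> I" for k l
    using basis that by (auto simp: eigenbasis_def)
  show "orthonormal_seq (\<lambda>k. j (if k \<in> I then \<phi> k else 0))"
    unfolding orthonormal_seq_def using orth by (auto simp: j.zero norm_eq_1)
  have "span ((\<lambda>k. j (\<phi> k)) ` I) \<subseteq> span (range (\<lambda>k. j (if k \<in> I then \<phi> k else 0)))"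
    by (rule span_mono) force
  then have "closure (span ((\<lambda>k. j (\<phi> k)) ` I)) \<subseteq> closure (span (range (\<lambda>k. j (if k \<in> I then \<phi> k else 0))))"
    by (rule closure_mono)
  then show "closure (span (range (\<lambda>k. j (if k \<in> I then \<phi> k else 0)))) = UNIV"
    using basis by (auto simp: eigenbasis_def)
  show "0 < (if k \<in> I then lam k else 1)" for k
    using basis by (auto simp: eigenbasis_def)
  show "(if k \<in> I then \<phi> k else 0) \<bullet> w = (if k \<in> I then lam k else 1)\<^sup>2 * (j (if k \<in> I then \<phi> k else 0) \<bullet> j w)" for k w
    using basis by (auto simp: eigenbasis_def j.zero)
qed

context eigen_sequence
begin

text \<open>
  The square of the Hilbert interpolation norm.
\<close>

definition spectral_sum :: "real \<Rightarrow> 'a \<Rightarrow> ennreal" where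
  "spectral_sum s u = (\<Sum>k. ennreal (lam k powr (2 * s) * (coeff u k)\<^sup>2))"

lemma K_norm_spectral:
  assumes s: "0 < s" "s < 1"
  shows "K_norm j s u = ennreal (sqrt (pi / (2 * sin (pi * s)))) * esqrt (spectral_sum s u)"
proof -
  have "sin (pi * s) > 0" using s by (intro sin_gt_zero) auto
  then have "pi / (2 * sin (pi * s)) > 0" by simp
  then show ?thesis
    unfolding K_norm_def K_integral[OF s] spectral_sum_def[symmetric] by (rule esqrt_mult_ennreal)
qed

lemma K_norm_eq:
  assumes s: "0 < s" "s < 1"
  shows "ennreal (sqrt (d_const s)) * esqrt (spectral_sum s u) = ennreal (sqrt (d_const s) * C_const s) * K_norm j s u"
proof -
  let ?c = "pi / (2 * sin (pi * s))"
  have sin: "sin (pi * s) > 0" using s by (intro sin_gt_zero) auto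
  then have C: "C_const s \<ge> 0" "C_const s * sqrt ?c = 1"
    by (auto simp: C_const_def real_sqrt_mult[symmetric])
  have "sqrt (d_const s) * C_const s \<ge> 0" using C(1) d_const_pos[OF s] by simp
  then have "ennreal (sqrt (d_const s) * C_const s) * K_norm j s u
      = ennreal (sqrt (d_const s) * C_const s * sqrt ?c) * esqrt (spectral_sum s u)"
    unfolding K_norm_spectral[OF s] by (simp only: ennreal_mult' mult.assoc[symmetric])
  also have "sqrt (d_const s) * C_const s * sqrt ?c = sqrt (d_const s)"
    by (simp only: mult.assoc C(2) mult_1_right)
  finally show ?thesis ..
qed

lemma ext_norm_lower_bound:
  assumes s: "0 < s" "s < 1" and "ext_fun j s v g" "has_trace j v u"
  shows "ennreal (sqrt (d_const s)) * esqrt (spectral_sum s u) \<le> ext_norm s v g"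
  unfolding ext_norm_def esqrt_mult_ennreal[OF d_const_pos[OF s], symmetric] spectral_sum_def
  by (rule esqrt_mono[OF extension_energy_lower_bound[OF assms]])

text \<open>
  The two integrability conditions on an extension make its norm finite; so an extension can exist
  only if the lower bound is finite.
\<close>

lemma ext_norm_finite:
  assumes "ext_fun j s v g"
  shows "ext_norm s v g < \<infinity>"
proof -
  let ?L = "lebesgue_on {0<..} :: real measure"
  let ?w = "\<lambda>y::real. y powr (1 - 2 * s)"
  have v: "v \<in> borel_measurable ?L" "(\<integral>\<^sup>+y. ennreal (?w y * (norm (v y))\<^sup>2) \<partial>?L) < \<infinity>"
    and g: "g \<in> borel_measurable ?L" "(\<integral>\<^sup>+y. ennreal (?w y * (norm (g y))\<^sup>2) \<partial>?L) < \<infinity>"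
    using assms by (auto simp: ext_fun_def weighted_L2_def)
  have w: "?w \<in> borel_measurable ?L"
    by (rule half_line_continuous_measurable) (auto intro!: continuous_intros)
  have n: "(\<lambda>y. norm (v y)) \<in> borel_measurable ?L" "(\<lambda>y. norm (g y)) \<in> borel_measurable ?L"
    using measurable_compose[OF v(1) borel_measurable_continuous_onI[OF continuous_on_norm_id]]
      measurable_compose[OF g(1) borel_measurable_continuous_onI[OF continuous_on_norm_id]] by auto
  have "(\<integral>\<^sup>+y. ennreal (?w y * ((norm (v y))\<^sup>2 + (norm (g y))\<^sup>2)) \<partial>?L)
      = (\<integral>\<^sup>+y. ennreal (?w y * (norm (v y))\<^sup>2) + ennreal (?w y * (norm (g y))\<^sup>2) \<partial>?L)"
    by (intro nn_integral_cong) (simp add: distrib_left)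
  also have "\<dots> = (\<integral>\<^sup>+y. ennreal (?w y * (norm (v y))\<^sup>2) \<partial>?L) + (\<integral>\<^sup>+y. ennreal (?w y * (norm (g y))\<^sup>2) \<partial>?L)"
    by (rule nn_integral_add) (use w n in measurable)
  also have "\<dots> < \<infinity>" using v(2) g(2) by simp
  finally show ?thesis unfolding ext_norm_def esqrt_less_top_iff .
qed

lemma harmonic_extension_admissible:
  assumes s: "0 < s" "s < 1" and fin: "spectral_sum s u < \<infinity>"
  shows "ext_fun j s (harmonic_extension s u) (harmonic_slope s u)"
    and "has_trace j (harmonic_extension s u) u"
    and "ext_norm s (harmonic_extension s u) (harmonic_slope s u)
      = ennreal (sqrt (d_const s)) * esqrt (spectral_sum s u)"
proof -
  let ?L = "lebesgue_on {0<..} :: real measure"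
  let ?w = "\<lambda>y::real. y powr (1 - 2 * s)"
  let ?v = "harmonic_extension s u" and ?g = "harmonic_slope s u"
  have en: "(\<integral>\<^sup>+y. ennreal (?w y * ((norm (?v y))\<^sup>2 + (norm (?g y))\<^sup>2)) \<partial>?L) = ennreal (d_const s) * spectral_sum s u"
    unfolding spectral_sum_def by (rule harmonic_extension_energy[OF s])
  show "ext_norm s ?v ?g = ennreal (sqrt (d_const s)) * esqrt (spectral_sum s u)"
    unfolding ext_norm_def en by (rule esqrt_mult_ennreal[OF d_const_pos[OF s]])
  have enfin: "(\<integral>\<^sup>+y. ennreal (?w y * ((norm (?v y))\<^sup>2 + (norm (?g y))\<^sup>2)) \<partial>?L) < \<infinity>"
    unfolding en using fin by (simp add: ennreal_mult_less_top)
  note mv = harmonic_extension_measurable[OF s(1), of u] and mg = harmonic_slope_measurable[OF s, of u]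
  have fv: "(\<integral>\<^sup>+y. ennreal (?w y * (norm (?v y))\<^sup>2) \<partial>?L) < \<infinity>"
    by (rule le_less_trans[OF nn_integral_mono enfin]) (auto intro!: ennreal_leI mult_left_mono)
  have fg: "(\<integral>\<^sup>+y. ennreal (?w y * (norm (?g y))\<^sup>2) \<partial>?L) < \<infinity>"
    by (rule le_less_trans[OF nn_integral_mono enfin]) (auto intro!: ennreal_leI mult_left_mono)
  obtain B where B: "B > 0" "\<And>x. norm (j x) \<le> norm x * B" using j.pos_bounded by blast
  have w: "?w \<in> borel_measurable ?L"
    by (rule half_line_continuous_measurable) (auto intro!: continuous_intros)
  have nv: "(\<lambda>y. norm (?v y)) \<in> borel_measurable ?L"
    using measurable_compose[OF mv borel_measurable_continuous_onI[OF continuous_on_norm_id]] .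
  have fj: "(\<integral>\<^sup>+y. ennreal (?w y * (norm (j (?v y)))\<^sup>2) \<partial>?L) < \<infinity>"
  proof -
    have "(\<integral>\<^sup>+y. ennreal (?w y * (norm (j (?v y)))\<^sup>2) \<partial>?L) \<le> (\<integral>\<^sup>+y. ennreal (B\<^sup>2) * ennreal (?w y * (norm (?v y))\<^sup>2) \<partial>?L)"
    proof (rule nn_integral_mono)
      fix y
      have "(norm (j (?v y)))\<^sup>2 \<le> (norm (?v y) * B)\<^sup>2" by (rule power_mono[OF B(2)]) simp
      then have "?w y * (norm (j (?v y)))\<^sup>2 \<le> ?w y * (norm (?v y) * B)\<^sup>2" by (rule mult_left_mono) simp
      also have "\<dots> = B\<^sup>2 * (?w y * (norm (?v y))\<^sup>2)" by (simp add: power_mult_distrib)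
      finally show "ennreal (?w y * (norm (j (?v y)))\<^sup>2) \<le> ennreal (B\<^sup>2) * ennreal (?w y * (norm (?v y))\<^sup>2)"
        by (simp only: ennreal_mult'[OF zero_le_power2, symmetric] ennreal_leI)
    qed
    also have "\<dots> = ennreal (B\<^sup>2) * (\<integral>\<^sup>+y. ennreal (?w y * (norm (?v y))\<^sup>2) \<partial>?L)"
      by (rule nn_integral_cmult) (use w nv in measurable)
    also have "\<dots> < \<infinity>" using fv by (simp add: ennreal_mult_less_top)
    finally show ?thesis .
  qed
  have mj: "(\<lambda>y. j (?v y)) \<in> borel_measurable ?L"
    using measurable_compose[OF mv borel_measurable_continuous_onI[OF j.continuous_on[OF continuous_on_id]]] .
  show "ext_fun j s ?v ?g"
    unfolding ext_fun_def weighted_L2_def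
    using mv mj mg fv fj fg harmonic_extension_weak_derivative[OF s, of u] by simp
  show "has_trace j ?v u"
    unfolding has_trace_def
  proof (intro exI conjI)
    show "continuous_on {0..} (harmonic_trace s u)" by (rule harmonic_trace_continuous[OF s(1)])
    show "AE y in ?L. harmonic_trace s u y = j (?v y)"
      by (rule AE_I2) (rule harmonic_trace_eq[OF s(1)], simp)
    show "harmonic_trace s u 0 = u" by (rule harmonic_trace_0[OF s(1)])
  qed
qed

lemma E_norm_eq:
  assumes s: "0 < s" "s < 1"
  shows "E_norm j s u = ennreal (sqrt (d_const s)) * esqrt (spectral_sum s u)"
proof (rule antisym)
  show "E_norm j s u \<le> ennreal (sqrt (d_const s)) * esqrt (spectral_sum s u)"
  proof (cases "spectral_sum s u < \<infinity>")
    case True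
    show ?thesis
      unfolding harmonic_extension_admissible(3)[OF s True, symmetric] E_norm_def
      using harmonic_extension_admissible(1,2)[OF s True] by (intro Inf_lower) blast
  next
    case False
    then have "esqrt (spectral_sum s u) = \<infinity>" by (simp add: esqrt_def top.not_eq_extremum)
    then show ?thesis using d_const_pos[OF s] by (simp add: ennreal_mult_top)
  qed
  show "ennreal (sqrt (d_const s)) * esqrt (spectral_sum s u) \<le> E_norm j s u"
    unfolding E_norm_def by (rule Inf_greatest) (use ext_norm_lower_bound[OF s] in blast)
qed

lemma E_space_iff:
  assumes s: "0 < s" "s < 1"
  shows "u \<in> E_space j s \<longleftrightarrow> spectral_sum s u < \<infinity>"
proof
  assume "u \<in> E_space j s"
  then obtain v g where vg: "ext_fun j s v g" "has_trace j v u" by (auto simp: E_space_def)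
  have "ennreal (sqrt (d_const s)) * esqrt (spectral_sum s u) < \<infinity>"
    by (rule le_less_trans[OF ext_norm_lower_bound[OF s vg] ext_norm_finite[OF vg(1)]])
  then have "esqrt (spectral_sum s u) < \<infinity>"
    using d_const_pos[OF s] by (auto simp: ennreal_mult_less_top ennreal_eq_0_iff)
  then show "spectral_sum s u < \<infinity>" unfolding esqrt_less_top_iff .
next
  assume "spectral_sum s u < \<infinity>"
  then show "u \<in> E_space j s"
    using harmonic_extension_admissible(1,2)[OF s] unfolding E_space_def by blast
qed

lemma K_space_iff:
  assumes s: "0 < s" "s < 1"
  shows "u \<in> K_space j s \<longleftrightarrow> spectral_sum s u < \<infinity>"
proof -
  have "sin (pi * s) > 0" using s by (intro sin_gt_zero) auto
  then have "pi / (2 * sin (pi * s)) > 0" by simp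
  then show ?thesis
    unfolding K_space_def mem_Collect_eq K_norm_spectral[OF s] esqrt_less_top_iff[of "spectral_sum s u", symmetric]
    by (auto simp: ennreal_mult_less_top ennreal_eq_0_iff)
qed

end

theorem theorem2p4:
  fixes j :: "'b::{real_inner, banach} \<Rightarrow> 'a::{real_inner, banach}" and s :: real
  assumes "dense_compact_embedding j" and "0 < s" and "s < 1"
  shows "(\<exists>I \<phi> lam. eigenbasis j I \<phi> lam) \<and>
    (\<forall>I \<phi> lam. eigenbasis j I \<phi> lam \<longrightarrow>
       (\<forall>u. E_norm j s u = ennreal (sqrt (d_const s)) * H_norm j I \<phi> lam s u \<and>
            ennreal (sqrt (d_const s)) * H_norm j I \<phi> lam s u =
              ennreal (sqrt (d_const s) * C_const s) * K_norm j s u) \<and>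
       E_space j s = H_space j I \<phi> lam s \<and> H_space j I \<phi> lam s = K_space j s)"
proof (rule conjI[OF eigenbasis_exists[OF assms(1)]], intro allI impI)
  fix I :: "nat set" and \<phi> :: "nat \<Rightarrow> 'b" and lam :: "nat \<Rightarrow> real"
  assume basis: "eigenbasis j I \<phi> lam"
  have j: "bounded_linear j" using assms(1) by (simp add: dense_compact_embedding_def)
  interpret eigen_sequence j "\<lambda>k. if k \<in> I then \<phi> k else 0" "\<lambda>k. if k \<in> I then lam k else 1"
    by (rule eigenbasis_imp_eigen_sequence[OF j basis])
  have H: "H_norm j I \<phi> lam s u = esqrt (spectral_sum s u)" for u
    unfolding H_norm_def infsum_ennreal_indicator spectral_sum_def
    by (intro arg_cong[of _ _ esqrt] suminf_cong) (simp add: coeff_def j.zero)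
  have "u \<in> H_space j I \<phi> lam s \<longleftrightarrow> spectral_sum s u < \<infinity>" for u
    unfolding H_space_def mem_Collect_eq H esqrt_less_top_iff ..
  then have "E_space j s = H_space j I \<phi> lam s" "H_space j I \<phi> lam s = K_space j s"
    using E_space_iff[OF assms(2,3)] K_space_iff[OF assms(2,3)] by auto
  then show "(\<forall>u. E_norm j s u = ennreal (sqrt (d_const s)) * H_norm j I \<phi> lam s u \<and>
            ennreal (sqrt (d_const s)) * H_norm j I \<phi> lam s u =
              ennreal (sqrt (d_const s) * C_const s) * K_norm j s u) \<and>
       E_space j s = H_space j I \<phi> lam s \<and> H_space j I \<phi> lam s = K_space j s"
    unfolding H using E_norm_eq[OF assms(2,3)] K_norm_eq[OF assms(2,3)] by simp
qed

end
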